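(* Let $(\mathrm{M},\mathcal{G})$ be a complete built matroid. Then its Chow polynomial $\mathrm{H}(\mathrm{M},\mathcal{G})(t)$ is $\gamma$-positive.
   Context: $\mathrm{M}$ is a loopless matroid on a finite set $E$ with lattice of flats $\mathcal{L}$ (ordered by inclusion, $\hat0=\varnothing$, $\hat1=E$, $F\vee G=\operatorname{cl}_{\mathrm{M}}(F\cup G)$). A building set is $\mathcal{G}\subseteq\mathcal{L}\setminus\{\hat0\}$ such that for every $F\neq\hat0$ the join map $\prod_{G\in\max\mathcal{G}_{\leqslant F}}[\hat0,G]\to[\hat0,F]$ is a poset isomorphism, where $\max\mathcal{G}_{\leqslant F}$ is the set of maximal elements of $\{G\in\mathcal{G}:G\leqslant F\}$. A subset $\mathcal{S}\subseteq\mathcal{G}$ is nested if for every antichain $A\subseteq\mathcal{S}$ and every $\{S_1,\dots,S_k\}\subseteq A$ with $k\geqslant2$, $S_1\vee\dots\vee S_k\notin\mathcal{G}$. The Chow ring is $\mathrm{CH}(\mathrm{M},\mathcal{G})=\mathbb{Q}[x_G:G\in\mathcal{G}]/(I+J)$, $I$ generated by the monomials $x_{G_1}\cdots x_{G_k}$ with $\{G_1,\dots,G_k\}$ not nested, $J$ by $\sum_{G\in\mathcal{G},G\geqslant a}x_G$ for each atom $a$. The Chow polynomial $\mathrm{H}(\mathrm{M},\mathcal{G})(t)=\sum_i\dim\mathrm{CH}^i(\mathrm{M},\mathcal{G})t^i$ is palindromic of degree $d$; it is $\gamma$-positive if in the unique expansion $\sum_{i=0}^{\lfloor d/2\rfloor}\gamma_it^i(1+t)^{d-2i}$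 all $\gamma_i\geqslant0$. Completeness: for a total order $\vartriangleleft$ on $E$ and flats $F\leqslant G$, with $G\setminus F=\{e_1\vartriangleleft\dots\vartriangleleft e_k\}$ and $F_i=\operatorname{cl}_{\mathrm{M}}(F\cup\{e_1,\dots,e_i\})$, let $C_\vartriangleleft(F,G)=\{F,F_1,\dots,F_k\}$. Let $\mathcal{G}_F=\{F\vee H:H\in\mathcal{G}\}\setminus\{F\}$ and $\mathcal{G}_F^G=\mathcal{G}_F\cap[F,G]$. $(\mathrm{M},\mathcal{G})$ is complete if for some total order $\vartriangleleft$ on $E$, $C_\vartriangleleft(F,G)\subseteq\mathcal{G}_F^G\cup\{F\}$ for every flat $F$ and every $G\in\mathcal{G}$ with $F\leqslant G$. *)

theory Defs
  imports "HOL-Library.FuncSet" "HOL-Library.Poly_Mapping" "HOL-Computational_Algebra.Polynomial"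
begin

definition matroid :: "'a set \<Rightarrow> ('a set \<Rightarrow> bool) \<Rightarrow> bool" where
  "matroid E indep \<longleftrightarrow> finite E \<and> indep {} \<and>
     (\<forall>X. indep X \<longrightarrow> X \<subseteq> E) \<and>
     (\<forall>X Y. indep X \<and> Y \<subseteq> X \<longrightarrow> indep Y) \<and>
     (\<forall>X Y. indep X \<and> indep Y \<and> card X < card Y \<longrightarrow> (\<exists>e\<in>Y - X. indep (insert e X)))"

definition mrank :: "('a set \<Rightarrow> bool) \<Rightarrow> 'a set \<Rightarrow> nat" where
  "mrank indep X = Max {card Y | Y. Y \<subseteq> X \<and> indep Y}"

definition mcl :: "'a set \<Rightarrow> ('a set \<Rightarrow> bool) \<Rightarrow> 'a set \<Rightarrow> 'a set" where
  "mcl E indep X = {e \<in> E. mrank indep (insert e X) = mrank indep X}"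

definition flat :: "'a set \<Rightarrow> ('a set \<Rightarrow> bool) \<Rightarrow> 'a set \<Rightarrow> bool" where
  "flat E indep F \<longleftrightarrow> F \<subseteq> E \<and> mcl E indep F = F"

definition loopless :: "'a set \<Rightarrow> ('a set \<Rightarrow> bool) \<Rightarrow> bool" where
  "loopless E indep \<longleftrightarrow> (\<forall>e\<in>E. indep {e})"

definition mjoin :: "'a set \<Rightarrow> ('a set \<Rightarrow> bool) \<Rightarrow> 'a set set \<Rightarrow> 'a set" where
  "mjoin E indep S = mcl E indep (\<Union>S)"

definition atom :: "'a set \<Rightarrow> ('a set \<Rightarrow> bool) \<Rightarrow> 'a set \<Rightarrow> bool" where
  "atom E indep a \<longleftrightarrow> flat E indep a \<and> a \<noteq> {} \<and>
     (\<forall>F. flat E indep F \<and> F \<subseteq> a \<longrightarrow> F = {} \<or> F = a)"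

definition max_below :: "'a set set \<Rightarrow> 'a set \<Rightarrow> 'a set set" where
  "max_below \<G> F = {G \<in> \<G>. G \<subseteq> F \<and> (\<forall>H\<in>\<G>. H \<subseteq> F \<and> G \<subseteq> H \<longrightarrow> H = G)}"

text \<open>For a flat F, the join map from the product of the intervals [0,G], G maximal in
  G_{<=F}, to [0,F] is a poset isomorphism (bijective, and order preserving and reflecting
  with respect to the componentwise order).\<close>
definition building_set :: "'a set \<Rightarrow> ('a set \<Rightarrow> bool) \<Rightarrow> 'a set set \<Rightarrow> bool" where
  "building_set E indep \<G> \<longleftrightarrow>
     \<G> \<subseteq> {F. flat E indep F} - {{}} \<and>
     (\<forall>F. flat E indep F \<and> F \<noteq> {} \<longrightarrow>
        (let Ms = max_below \<G> F;
             Dom = {h \<in> Ms \<rightarrow>\<^sub>E {H. flat E indep H}. \<forall>G\<in>Ms. h G \<subseteq> G};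
             jn = (\<lambda>h. mjoin E indep (h ` Ms))
         in bij_betw jn Dom {H. flat E indep H \<and> H \<subseteq> F} \<and>
            (\<forall>h\<in>Dom. \<forall>h'\<in>Dom. (\<forall>G\<in>Ms. h G \<subseteq> h' G) \<longleftrightarrow> jn h \<subseteq> jn h')))"

definition nested :: "'a set \<Rightarrow> ('a set \<Rightarrow> bool) \<Rightarrow> 'a set set \<Rightarrow> 'a set set \<Rightarrow> bool" where
  "nested E indep \<G> S \<longleftrightarrow> S \<subseteq> \<G> \<and>
     (\<forall>A \<subseteq> S. (\<forall>X\<in>A. \<forall>Y\<in>A. X \<subseteq> Y \<longrightarrow> X = Y) \<longrightarrow>
        (\<forall>T \<subseteq> A. 2 \<le> card T \<longrightarrow> mjoin E indep T \<notin> \<G>))"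

text \<open>Polynomials over Q in variables indexed by sets; monomials are finitely supported
  exponent vectors.\<close>
type_synonym 'a cpoly = "('a set \<Rightarrow>\<^sub>0 nat) \<Rightarrow>\<^sub>0 rat"

definition var :: "'a set \<Rightarrow> 'a cpoly" where
  "var G = Poly_Mapping.single (Poly_Mapping.single G 1) 1"

definition cscale :: "rat \<Rightarrow> 'a cpoly \<Rightarrow> 'a cpoly" where
  "cscale c p = Poly_Mapping.single 0 c * p"

definition mdeg :: "('a set \<Rightarrow>\<^sub>0 nat) \<Rightarrow> nat" where
  "mdeg m = (\<Sum>G\<in>Poly_Mapping.keys m. Poly_Mapping.lookup m G)"

definition poly_ring :: "'a set set \<Rightarrow> 'a cpoly set" where
  "poly_ring \<G> = {p. \<forall>m\<in>Poly_Mapping.keys p. Poly_Mapping.keys m \<subseteq> \<G>}"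

definition poly_ring_deg :: "'a set set \<Rightarrow> nat \<Rightarrow> 'a cpoly set" where
  "poly_ring_deg \<G> i = {p \<in> poly_ring \<G>. \<forall>m\<in>Poly_Mapping.keys p. mdeg m = i}"

definition chow_gens :: "'a set \<Rightarrow> ('a set \<Rightarrow> bool) \<Rightarrow> 'a set set \<Rightarrow> 'a cpoly set" where
  "chow_gens E indep \<G> =
     {\<Prod>G\<in>S. var G | S. S \<subseteq> \<G> \<and> \<not> nested E indep \<G> S} \<union>
     {\<Sum>G\<in>{G\<in>\<G>. a \<subseteq> G}. var G | a. atom E indep a}"

definition chow_ideal :: "'a set \<Rightarrow> ('a set \<Rightarrow> bool) \<Rightarrow> 'a set set \<Rightarrow> 'a cpoly set" where
  "chow_ideal E indep \<G> =
     {\<Sum>g\<in>Gs. r g * g | Gs r. finite Gs \<and> Gs \<subseteq> chow_gens E indep \<G> \<and>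
                             (\<forall>g\<in>Gs. r g \<in> poly_ring \<G>)}"

text \<open>dim_Q CH^i = dim_Q (S_i / (I+J)_i) = dim_Q S_i - dim_Q (I+J)_i (finite dimensional).\<close>
definition chow_dim :: "'a set \<Rightarrow> ('a set \<Rightarrow> bool) \<Rightarrow> 'a set set \<Rightarrow> nat \<Rightarrow> nat" where
  "chow_dim E indep \<G> i =
     vector_space.dim cscale (poly_ring_deg \<G> i)
     - vector_space.dim cscale (chow_ideal E indep \<G> \<inter> poly_ring_deg \<G> i)"

text \<open>Chow polynomial H(t) = sum_i dim CH^i t^i, as its coefficient sequence.\<close>

definition gamma_positive :: "(nat \<Rightarrow> nat) \<Rightarrow> bool" where
  "gamma_positive c \<longleftrightarrow> (\<exists>d::nat. \<exists>\<gamma>::nat \<Rightarrow> rat. (\<forall>i. 0 \<le> \<gamma> i) \<and>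
     (\<forall>n. of_nat (c n) =
        coeff (\<Sum>i\<le>d div 2. smult (\<gamma> i) ([:0, 1:] ^ i * [:1, 1:] ^ (d - 2 * i))) n))"

definition chain_C :: "'a set \<Rightarrow> ('a set \<Rightarrow> bool) \<Rightarrow> 'a list \<Rightarrow> 'a set \<Rightarrow> 'a set \<Rightarrow> 'a set set" where
  "chain_C E indep es F G =
     (let l = filter (\<lambda>e. e \<in> G - F) es
      in {mcl E indep (F \<union> set (take i l)) | i. i \<le> length l})"

definition G_F :: "'a set \<Rightarrow> ('a set \<Rightarrow> bool) \<Rightarrow> 'a set set \<Rightarrow> 'a set \<Rightarrow> 'a set set" where
  "G_F E indep \<G> F = {mjoin E indep {F, H} | H. H \<in> \<G>} - {F}"

definition G_F_G :: "'a set \<Rightarrow> ('a set \<Rightarrow> bool) \<Rightarrow> 'a set set \<Rightarrow> 'a set \<Rightarrow> 'a set \<Rightarrow> 'a set set" where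
  "G_F_G E indep \<G> F G = {H \<in> G_F E indep \<G> F. F \<subseteq> H \<and> H \<subseteq> G}"

text \<open>A total order on E is represented by a duplicate-free enumeration es of E.\<close>
definition complete :: "'a set \<Rightarrow> ('a set \<Rightarrow> bool) \<Rightarrow> 'a set set \<Rightarrow> bool" where
  "complete E indep \<G> \<longleftrightarrow> (\<exists>es. distinct es \<and> set es = E \<and>
     (\<forall>F G. flat E indep F \<and> G \<in> \<G> \<and> F \<subseteq> G \<longrightarrow>
        chain_C E indep es F G \<subseteq> G_F_G E indep \<G> F G \<union> {F}))"

end

theory Submission
  imports Defs
begin

text \<open>Write e(G) for the rank of G minus the rank of the join of the elements of a nested set below G.
The monomials whose support S is nested and whose exponent at each G in S is less than e(G) form a
basis of the Chow ring. They span because x_S * h_G^d lies in the ideal whenever the elements of S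
are below G and the rank of G exceeds that of their join by at most d, where h_G is the sum of the
x_H with H above G. For independence, the products of the h_G with the same exponents are paired
with functionals, one for each chain of flats, given by a dragon marriage condition in every
interval of the chain; the pairing is triangular.

It remains to count. Label every element K of a maximal nested set T by the first element of K that
is not in the join of the elements of T below K, and call K a descent if its parent has a smaller
label. By completeness, every nested set S lies in a unique maximal nested set T all of whose
descents are in S, and every element of T has at most one ascending child. So T splits into
ascending paths, and the exponent vectors belonging to T correspond to the sets of ascents that
contain a child of every descent. Counting these sets by cardinality gives
t^d (1 + t)^(N - 2d), where d is the number of descents of T, or zero if some descent has no
ascending child.\<close>

section \<open>Rank and closure\<close>

text \<open>The spanning argument says nothing about independence, so linear forms vanishing on the
  ideal have to be produced. They live on the Chow ring of the maximal building set (all nonempty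
  flats), whose relations are simple in the h-variables: h_a = 0 for atoms a, and (h_F - h_K)(h_G -
  h_K) = 0 for incomparable F, G with join K. The indicator of a dragon marriage condition respects
  both, the second by submodularity of the rank. The substitution \<open>pull\<close> carries x_G
  there and sends h_G to h_G; hence the independent elements are monomials in the h, although the
  spanning ones are monomials in the x.

  In the count, completeness enters in one form: for a flat F inside G in the building set, the
  closure of F with an initial segment of G is F itself or the join of F with a single building
  element. Because one element suffices, the hyperplane of G reached greedily from F contributes one
  new component, which can never become a descent; and two ascending children of P are impossible,
  since generating the elements below P from the rest would take two building elements.\<close>

locale loopless_matroid =
  fixes E :: "'a set" and indep :: "'a set \<Rightarrow> bool"
  assumes matroid: "matroid E indep" and loopless: "loopless E indep"
begin

abbreviation rk where "rk \<equiv> mrank indep"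
abbreviation cl where "cl \<equiv> mcl E indep"
abbreviation fl where "fl \<equiv> flat E indep"

lemma finite_E: "finite E"
  and indep_empty: "indep {}"
  and indep_subset_E: "indep X \<Longrightarrow> X \<subseteq> E"
  and indep_mono: "indep X \<Longrightarrow> Y \<subseteq> X \<Longrightarrow> indep Y"
  and indep_exchange: "indep X \<Longrightarrow> indep Y \<Longrightarrow> card X < card Y \<Longrightarrow> \<exists>e\<in>Y - X. indep (insert e X)"
  using matroid unfolding matroid_def by blast+

lemma finite_indep: "indep X \<Longrightarrow> finite X"
  using finite_E finite_subset indep_subset_E by blast

lemma finite_indep_cards: "finite {card Y | Y. Y \<subseteq> X \<and> indep Y}"
  by (rule finite_subset[of _ "card ` Pow E"]) (use finite_E indep_subset_E in auto)

lemma card_le_rk: "Y \<subseteq> X \<Longrightarrow> indep Y \<Longrightarrow> card Y \<le> rk X"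
  unfolding mrank_def by (rule Max_ge[OF finite_indep_cards]) auto

lemma rk_attained: obtains Y where "Y \<subseteq> X" "indep Y" "card Y = rk X"
proof -
  have "Max {card Y | Y. Y \<subseteq> X \<and> indep Y} \<in> {card Y | Y. Y \<subseteq> X \<and> indep Y}"
    by (rule Max_in[OF finite_indep_cards]) (use indep_empty in auto)
  then have "rk X \<in> {card Y | Y. Y \<subseteq> X \<and> indep Y}" by (simp only: mrank_def)
  then show thesis using that by auto
qed

lemma rk_mono: "X \<subseteq> Y \<Longrightarrow> rk X \<le> rk Y"
  by (metis card_le_rk rk_attained order_trans)

lemma rk_le_card: "finite X \<Longrightarrow> rk X \<le> card X"
  by (metis rk_attained card_mono)

lemma rk_empty [simp]: "rk {} = 0"
  using rk_le_card[of "{}"] by simp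

lemma indep_extend:
  assumes "indep I" "I \<subseteq> X"
  obtains B where "I \<subseteq> B" "B \<subseteq> X" "indep B" "card B = rk X"
proof -
  have "\<exists>B. I \<subseteq> B \<and> B \<subseteq> X \<and> indep B \<and> card B = rk X"
    using assms
  proof (induction "rk X - card I" arbitrary: I rule: less_induct)
    case less
    show ?case
    proof (cases "card I = rk X")
      case True then show ?thesis using less.prems by blast
    next
      case False
      then have lt: "card I < rk X" using card_le_rk[OF less.prems(2,1)] by simp
      obtain Y where Y: "Y \<subseteq> X" "indep Y" "card Y = rk X" by (rule rk_attained)
      then obtain e where e: "e \<in> Y - I" "indep (insert e I)"
        using indep_exchange[OF less.prems(1) Y(2)] lt by auto
      have "card (insert e I) = Suc (card I)"
        using e finite_indep[OF less.prems(1)] by simp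
      then have "\<exists>B. insert e I \<subseteq> B \<and> B \<subseteq> X \<and> indep B \<and> card B = rk X"
        using e Y less.prems lt by (intro less.hyps) auto
      then show ?thesis by blast
    qed
  qed
  then show thesis using that by blast
qed

text \<open>A basis \<open>I\<close> of the intersection is extended to a basis \<open>J\<close> of
  the union. The traces of \<open>J\<close> on A and B bound the two ranks from below, and their
  overlap contains \<open>I\<close>.\<close>

lemma rk_submodular: "rk (A \<union> B) + rk (A \<inter> B) \<le> rk A + rk B"
proof -
  obtain I where I: "I \<subseteq> A \<inter> B" "indep I" "card I = rk (A \<inter> B)" by (rule rk_attained)
  obtain J where J: "I \<subseteq> J" "J \<subseteq> A \<union> B" "indep J" "card J = rk (A \<union> B)"
    using indep_extend[OF I(2), of "A \<union> B"] I by blast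
  have fJ: "finite J" using J finite_indep by blast
  have "card (J \<inter> A) + card (J \<inter> B) = card J + card (J \<inter> A \<inter> B)"
    using card_Un_Int[of "J \<inter> A" "J \<inter> B"] fJ J(2)
    by (simp add: Int_Un_distrib[symmetric] Int_absorb2 Int_assoc Int_left_commute)
  moreover have "card (J \<inter> A \<inter> B) \<ge> card I"
    by (rule card_mono) (use fJ I J in auto)
  moreover have "card (J \<inter> A) \<le> rk A" "card (J \<inter> B) \<le> rk B"
    using card_le_rk[of "J \<inter> A" A] card_le_rk[of "J \<inter> B" B] indep_mono[OF J(3)] by auto
  ultimately show ?thesis using I J by linarith
qed

lemma rk_Un_le: "rk (A \<union> B) \<le> rk A + rk B"
  using rk_submodular[of A B] by linarith

lemma rk_insert_le: "rk (insert e X) \<le> rk X + 1"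
  using rk_Un_le[of X "{e}"] rk_le_card[of "{e}"] by simp

lemma rk_singleton: "e \<in> E \<Longrightarrow> rk {e} = 1"
  using loopless card_le_rk[of "{e}" "{e}"] rk_le_card[of "{e}"] unfolding loopless_def by auto

section \<open>Closure and flats\<close>

lemma cl_subset_E: "cl X \<subseteq> E"
  unfolding mcl_def by auto

lemma subset_cl: "X \<subseteq> E \<Longrightarrow> X \<subseteq> cl X"
  unfolding mcl_def by (auto simp: insert_absorb)

lemma rk_Un_eqI:
  assumes "finite Y" "\<And>e. e \<in> Y \<Longrightarrow> rk (insert e X) = rk X"
  shows "rk (X \<union> Y) = rk X"
  using assms
proof (induction Y)
  case (insert e Y)
  have "rk ((X \<union> Y) \<union> insert e X) + rk X \<le> rk (X \<union> Y) + rk (insert e X)"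
    using rk_submodular[of "X \<union> Y" "insert e X"] rk_mono[of X "(X \<union> Y) \<inter> insert e X", OF Int_greatest]
    by fastforce
  moreover have "rk (X \<union> Y) = rk X" "rk (insert e X) = rk X" using insert by auto
  moreover have "(X \<union> Y) \<union> insert e X = X \<union> insert e Y" by auto
  ultimately have "rk (X \<union> insert e Y) \<le> rk X" by simp
  then show ?case using rk_mono[of X "X \<union> insert e Y", OF Un_upper1] by simp
qed simp

lemma rk_Un_cl: "rk (X \<union> cl X) = rk X"
  by (rule rk_Un_eqI) (use finite_subset[OF cl_subset_E finite_E] in \<open>auto simp: mcl_def\<close>)

lemma rk_cl: "X \<subseteq> E \<Longrightarrow> rk (cl X) = rk X"
  using rk_Un_cl[of X] subset_cl[of X] by (simp add: Un_absorb1)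

lemma in_cl_iff: "e \<in> cl X \<longleftrightarrow> e \<in> E \<and> rk (insert e X) = rk X"
  unfolding mcl_def by simp

lemma in_cl_if_rk: "e \<in> E \<Longrightarrow> e \<in> Y \<Longrightarrow> X \<subseteq> Y \<Longrightarrow> rk Y \<le> rk X \<Longrightarrow> e \<in> cl X"
  using rk_mono[of "insert e X" Y] rk_mono[of X "insert e X", OF subset_insertI] unfolding in_cl_iff by auto

lemma cl_mono: "X \<subseteq> Y \<Longrightarrow> cl X \<subseteq> cl Y"
proof
  fix e assume XY: "X \<subseteq> Y" and e: "e \<in> cl X"
  have "rk (Y \<union> insert e X) + rk X \<le> rk Y + rk (insert e X)"
    using rk_submodular[of Y "insert e X"] rk_mono[of X "Y \<inter> insert e X", OF Int_greatest[OF XY subset_insertI]]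
    by linarith
  moreover have "Y \<union> insert e X = insert e Y" using XY by auto
  ultimately show "e \<in> cl Y" using e rk_mono[of Y "insert e Y", OF subset_insertI] unfolding in_cl_iff by auto
qed

lemma cl_idem: "X \<subseteq> E \<Longrightarrow> cl (cl X) = cl X"
proof (rule antisym)
  assume X: "X \<subseteq> E"
  show "cl (cl X) \<subseteq> cl X"
  proof
    fix e assume e: "e \<in> cl (cl X)"
    have "X \<subseteq> insert e (cl X)" using subset_cl[OF X] by auto
    then show "e \<in> cl X"
      using e rk_cl[OF X] by (intro in_cl_if_rk[of e "insert e (cl X)"]) (auto simp: in_cl_iff)
  qed
  show "cl X \<subseteq> cl (cl X)" using cl_subset_E by (rule subset_cl)
qed

lemma fl_subset_E: "fl F \<Longrightarrow> F \<subseteq> E" and fl_cl_eq: "fl F \<Longrightarrow> cl F = F"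
  unfolding flat_def by auto

lemma fl_finite: "fl F \<Longrightarrow> finite F"
  using fl_subset_E finite_E finite_subset by blast

lemma finite_flats: "finite {F. fl F}"
  by (rule finite_subset[of _ "Pow E"]) (use fl_subset_E finite_E in auto)

lemma fl_cl: "X \<subseteq> E \<Longrightarrow> fl (cl X)"
  unfolding flat_def by (simp add: cl_subset_E cl_idem)

lemma fl_E: "fl E"
  unfolding flat_def using subset_cl[of E] cl_subset_E[of E] by auto

lemma cl_least: "fl F \<Longrightarrow> X \<subseteq> F \<Longrightarrow> cl X \<subseteq> F"
  using cl_mono[of X F] fl_cl_eq by auto

lemma cl_subset_iff: "fl F \<Longrightarrow> X \<subseteq> E \<Longrightarrow> cl X \<subseteq> F \<longleftrightarrow> X \<subseteq> F"
  using cl_least subset_cl by blast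

lemma fl_empty: "fl {}"
  unfolding flat_def using rk_singleton by (auto simp: in_cl_iff)

lemma rk_insert_fl: "fl F \<Longrightarrow> e \<in> E \<Longrightarrow> e \<notin> F \<Longrightarrow> rk (insert e F) = rk F + 1"
  using fl_cl_eq[of F] rk_insert_le[of e F] rk_mono[of F "insert e F"] in_cl_iff[of e F]
  by (metis Suc_eq_plus1 le_antisym not_less_eq_eq subset_insertI)

lemma rk_less_of_not_subset: "fl F \<Longrightarrow> F \<subseteq> X \<Longrightarrow> X \<subseteq> E \<Longrightarrow> \<not> X \<subseteq> F \<Longrightarrow> rk F < rk X"
proof -
  assume a: "fl F" "F \<subseteq> X" "X \<subseteq> E" "\<not> X \<subseteq> F"
  then obtain e where "e \<in> X" "e \<notin> F" by blast
  then have "rk (insert e F) = rk F + 1" "rk (insert e F) \<le> rk X"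
    using rk_insert_fl rk_mono[of "insert e F" X] a by auto
  then show ?thesis by simp
qed

lemma fl_eq_of_rk: "fl F \<Longrightarrow> F \<subseteq> X \<Longrightarrow> X \<subseteq> E \<Longrightarrow> rk X \<le> rk F \<Longrightarrow> X = F"
  using rk_less_of_not_subset[of F X] by (cases "X \<subseteq> F") auto

lemma cl_eq_of_rk: "X \<subseteq> F \<Longrightarrow> fl F \<Longrightarrow> rk F \<le> rk X \<Longrightarrow> cl X = F"
  using fl_eq_of_rk[of "cl X" F] cl_least[of F X] fl_cl[of X] rk_cl[of X] fl_subset_E[of F] by auto

lemma rk_pos: "X \<subseteq> E \<Longrightarrow> X \<noteq> {} \<Longrightarrow> 0 < rk X"
  using rk_less_of_not_subset[OF fl_empty] by auto

lemma cl_Un_cl: "X \<subseteq> E \<Longrightarrow> Y \<subseteq> E \<Longrightarrow> cl (cl X \<union> Y) = cl (X \<union> Y)"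
proof (rule antisym)
  assume a: "X \<subseteq> E" "Y \<subseteq> E"
  show "cl (cl X \<union> Y) \<subseteq> cl (X \<union> Y)"
    using a by (intro cl_least fl_cl) (use cl_mono[of X "X \<union> Y"] subset_cl[of "X \<union> Y"] in auto)
  show "cl (X \<union> Y) \<subseteq> cl (cl X \<union> Y)"
    using a subset_cl[of X] by (intro cl_mono) auto
qed

lemma rk_eq_of_cl: "X \<subseteq> E \<Longrightarrow> Y \<subseteq> E \<Longrightarrow> cl X = cl Y \<Longrightarrow> rk X = rk Y"
  by (metis rk_cl)

lemma atom_cl: "e \<in> E \<Longrightarrow> atom E indep (cl {e})"
  unfolding atom_def
proof (intro conjI allI impI)
  assume e: "e \<in> E"
  show "fl (cl {e})" using e by (intro fl_cl) auto
  show "cl {e} \<noteq> {}" using subset_cl[of "{e}"] e by auto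
  fix F assume F: "fl F \<and> F \<subseteq> cl {e}"
  have "rk (cl {e}) = 1" using rk_cl[of "{e}"] rk_singleton e by simp
  moreover have "F \<noteq> {} \<Longrightarrow> 0 < rk F" using rk_pos[of F] F fl_subset_E[of F] by blast
  ultimately show "F = {} \<or> F = cl {e}"
    using fl_eq_of_rk[of F "cl {e}", OF _ _ cl_subset_E] F by (cases "F = {}") auto
qed

lemma atom_rk: "atom E indep a \<Longrightarrow> rk a = 1"
proof -
  assume a: "atom E indep a"
  then obtain e where e: "e \<in> a" "e \<in> E" "fl a" unfolding atom_def using fl_subset_E by blast
  then have "cl {e} = a"
    using a cl_least[of a "{e}"] subset_cl[of "{e}"] fl_cl[of "{e}"] unfolding atom_def by blast
  then show ?thesis using rk_cl[of "{e}"] rk_singleton e by auto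
qed

text \<open>By submodularity, enlarging one of the two sets raises the rank of the union by no more
  than it raises the rank of that set. So a defect for the small sets would persist for the large
  ones.\<close>

lemma rk_additive_mono:
  assumes "rk (A \<union> B) = rk A + rk B" "A' \<subseteq> A" "B' \<subseteq> B"
  shows "rk (A' \<union> B') = rk A' + rk B'"
proof -
  have "rk (A \<union> B') = rk A + rk B'"
  proof -
    have "rk ((A \<union> B') \<union> B) + rk B' \<le> rk (A \<union> B') + rk B"
      using rk_submodular[of "A \<union> B'" B] rk_mono[of B' "(A \<union> B') \<inter> B"] assms by auto
    moreover have "(A \<union> B') \<union> B = A \<union> B" using assms by auto
    ultimately show ?thesis using assms rk_Un_le[of A B'] by auto
  qed
  moreover have "rk ((A' \<union> B') \<union> A) + rk A' \<le> rk (A' \<union> B') + rk A"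
    using rk_submodular[of "A' \<union> B'" A] rk_mono[of A' "(A' \<union> B') \<inter> A"] assms by auto
  moreover have "(A' \<union> B') \<union> A = A \<union> B'" using assms by auto
  ultimately show ?thesis using rk_Un_le[of A' B'] by auto
qed

lemma rk_Union_le: "finite \<C> \<Longrightarrow> rk (\<Union>\<C>) \<le> (\<Sum>C\<in>\<C>. rk C)"
proof (induction rule: finite_induct)
  case (insert C \<C>)
  then show ?case using rk_Un_le[of C "\<Union>\<C>"] by simp
qed simp

end

section \<open>Building sets and nested sets\<close>

locale built_matroid = loopless_matroid +
  fixes \<G> :: "'a set set"
  assumes building: "building_set E indep \<G>"
begin

abbreviation comps where "comps \<equiv> max_below \<G>"
abbreviation nst where "nst \<equiv> nested E indep \<G>"

lemma building_fl: "G \<in> \<G> \<Longrightarrow> fl G" and building_nonempty: "G \<in> \<G> \<Longrightarrow> G \<noteq> {}"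
  using building unfolding building_set_def by auto

lemma building_subset_E: "G \<in> \<G> \<Longrightarrow> G \<subseteq> E"
  using building_fl fl_subset_E by blast

lemma finite_building: "finite \<G>"
  by (rule finite_subset[OF _ finite_flats]) (use building_fl in auto)

lemma compsD: "C \<in> comps F \<Longrightarrow> C \<in> \<G>" "C \<in> comps F \<Longrightarrow> C \<subseteq> F"
  and comps_maximal: "C \<in> comps F \<Longrightarrow> H \<in> \<G> \<Longrightarrow> H \<subseteq> F \<Longrightarrow> C \<subseteq> H \<Longrightarrow> H = C"
  unfolding max_below_def by auto

lemma comps_subset: "comps F \<subseteq> \<G>"
  using compsD by blast

lemma finite_comps: "finite (comps F)"
  using comps_subset finite_building finite_subset by blast

lemma in_comps_above:
  assumes "G \<in> \<G>" "G \<subseteq> F"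
  obtains C where "C \<in> comps F" "G \<subseteq> C"
proof -
  have "finite {H \<in> \<G>. H \<subseteq> F}" using finite_building by simp
  from finite_has_maximal2[OF this, of G] assms
  obtain C where "C \<in> {H \<in> \<G>. H \<subseteq> F}" "G \<subseteq> C" "\<forall>b\<in>{H \<in> \<G>. H \<subseteq> F}. C \<le> b \<longrightarrow> C = b"
    by auto
  then show thesis by (intro that[of C]) (auto simp: max_below_def)
qed

lemma comps_empty: "comps {} = {}"
  unfolding max_below_def using building_nonempty by auto

lemma comps_building: "G \<in> \<G> \<Longrightarrow> comps G = {G}"
  unfolding max_below_def by auto

text \<open>A poset isomorphism maps strict chains to strict chains, which bounds the rank of a join
  from below by the sum of the ranks.\<close>
lemma comps_rk_Union:
  assumes F: "fl F"
  shows "rk F = (\<Sum>C\<in>comps F. rk C) \<and> \<Union>(comps F) = F"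
proof (cases "F = {}")
  case True
  then show ?thesis by (simp add: comps_empty)
next
  case False
  define D where "D = {h \<in> comps F \<rightarrow>\<^sub>E {H. fl H}. \<forall>G\<in>comps F. h G \<subseteq> G}"
  define jn where "jn = (\<lambda>h. cl (\<Union>(h ` comps F)))"
  have "fl F \<and> F \<noteq> {}" using F False by simp
  have iso: "bij_betw jn D {H. fl H \<and> H \<subseteq> F} \<and>
      (\<forall>h\<in>D. \<forall>h'\<in>D. (\<forall>G\<in>comps F. h G \<subseteq> h' G) \<longleftrightarrow> jn h \<subseteq> jn h')"
    unfolding D_def jn_def
    by (rule building[unfolded building_set_def Let_def mjoin_def, THEN conjunct2, THEN spec,
          THEN mp]) fact
  have bij: "bij_betw jn D {H. fl H \<and> H \<subseteq> F}"
    and ord: "\<And>h h'. h \<in> D \<Longrightarrow> h' \<in> D \<Longrightarrow> (\<forall>G\<in>comps F. h G \<subseteq> h' G) \<longleftrightarrow> jn h \<subseteq> jn h'"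
    using iso by simp_all
  have DE: "\<Union>(h ` comps F) \<subseteq> E" if "h \<in> D" for h
    using that fl_subset_E unfolding D_def by fastforce
  have lower: "(\<Sum>C\<in>comps F. rk (h C)) \<le> rk (jn h)" if "h \<in> D" for h
    using that
  proof (induction "\<Sum>C\<in>comps F. card (h C)" arbitrary: h rule: less_induct)
    case less
    show ?case
    proof (cases "\<forall>C\<in>comps F. h C = {}")
      case True then show ?thesis by simp
    next
      case False
      then obtain C where C: "C \<in> comps F" "h C \<noteq> {}" by blast
      have hC: "fl (h C)" "h C \<subseteq> C" using less.prems C unfolding D_def by auto
      obtain I where I: "I \<subseteq> h C" "indep I" "card I = rk (h C)" by (rule rk_attained)
      have "I \<noteq> {}" using I(3) rk_pos[OF fl_subset_E[OF hC(1)] C(2)] by auto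
      then obtain e where e: "e \<in> I" by blast
      \<comment> \<open>Dropping one element of a basis of \<open>h C\<close> lowers that coordinate
        by a single rank. The join map is injective and monotone, so the rank of the join drops as
        well.\<close>
      define H where "H = cl (I - {e})"
      have IE: "I - {e} \<subseteq> E" using I(2) indep_subset_E by blast
      have H: "fl H" "H \<subseteq> h C" using fl_cl[OF IE] cl_least[OF hC(1), of "I - {e}"] I unfolding H_def by auto
      have "rk (insert e (I - {e})) = rk (h C)"
        using card_le_rk[of I I] I rk_mono[OF I(1)] e by (simp add: insert_absorb)
      then have rH: "rk (h C) \<le> rk H + 1"
        using rk_insert_le[of e "I - {e}"] rk_cl[OF IE] unfolding H_def by simp
      have "rk (I - {e}) < rk (h C)"
        using rk_le_card[of "I - {e}"] finite_indep[OF I(2)] e I(3) card_Diff1_less[of I e] by simp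
      then have neq: "H \<noteq> h C" using rk_cl[OF IE] H_def by auto
      then have psub: "H \<subset> h C" using H by auto
      define h' where "h' = h(C := H)"
      have "H \<subseteq> C" using H hC by blast
      then have h': "h' \<in> D" using less.prems H C unfolding D_def h'_def
        by (auto simp: PiE_iff extensional_def)
      have le: "jn h' \<subseteq> jn h"
        using ord[OF h' less.prems] H unfolding h'_def by (auto split: if_splits)
      have "h' \<noteq> h" using neq unfolding h'_def by (metis fun_upd_same)
      then have "jn h' \<noteq> jn h" using bij h' less.prems unfolding bij_betw_def inj_on_def by blast
      then have lt: "rk (jn h') < rk (jn h)"
        using rk_less_of_not_subset[of "jn h'" "jn h"] fl_cl[OF DE[OF h']] le cl_subset_E
        unfolding jn_def by blast
      have "card H < card (h C)" using psub fl_finite[OF hC(1)] psubset_card_mono by blast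
      then have cd: "(\<Sum>C\<in>comps F. card (h' C)) < (\<Sum>C\<in>comps F. card (h C))"
        using C by (intro sum_strict_mono_ex1 finite_comps) (auto simp: h'_def)
      have "(\<Sum>D\<in>comps F. rk (h D)) = rk (h C) + (\<Sum>D\<in>comps F - {C}. rk (h D))"
        using C finite_comps by (simp add: sum.remove)
      moreover have "(\<Sum>D\<in>comps F. rk (h' D)) = rk H + (\<Sum>D\<in>comps F - {C}. rk (h D))"
        using C finite_comps by (simp add: sum.remove h'_def)
      ultimately show ?thesis using less.hyps[OF cd h'] lt rH by linarith
    qed
  qed
  define hid where "hid = restrict (\<lambda>C. C) (comps F)"
  have hid: "hid \<in> D" unfolding hid_def D_def using compsD building_fl by auto
  have jn_sub: "jn h \<subseteq> F" if "h \<in> D" for h using bij that unfolding bij_betw_def by blast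
  have jid: "jn hid = cl (\<Union>(comps F))" unfolding jn_def hid_def by simp
  have surj: "\<exists>h\<in>D. jn h = H" if "fl H" "H \<subseteq> F" for H
    using bij that unfolding bij_betw_def by (metis (mono_tags, lifting) image_iff mem_Collect_eq)
  obtain h where h: "h \<in> D" "jn h = F" using surj F by blast
  have "jn h \<subseteq> jn hid" using ord[OF h(1) hid] h unfolding D_def hid_def by auto
  then have Feq: "jn hid = F" using h jn_sub[OF hid] by auto
  have clF: "cl (\<Union>(comps F)) = F" by (rule jid[symmetric, THEN trans, OF Feq])
  have sub: "\<Union>(comps F) \<subseteq> F" using compsD by blast
  have rkF: "rk F = (\<Sum>C\<in>comps F. rk C)"
  proof (rule antisym)
    show "rk F \<le> (\<Sum>C\<in>comps F. rk C)"
      using rk_Union_le[OF finite_comps, of F] rk_cl[OF order_trans[OF sub fl_subset_E[OF F]]] clF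
      by simp
    show "(\<Sum>C\<in>comps F. rk C) \<le> rk F"
      using lower[OF hid] unfolding Feq by (simp add: hid_def)
  qed
  \<comment> \<open>The closure of {e} has rank 1, so by \<open>lower\<close> its preimage has only
    one nonempty coordinate. That coordinate is the closure itself, and it lies below one
    component.\<close>
  moreover have "F \<subseteq> \<Union>(comps F)"
  proof
    fix e assume e: "e \<in> F"
    then have eE: "e \<in> E" using fl_subset_E F by blast
    then obtain h where h: "h \<in> D" "jn h = cl {e}"
      using surj[of "cl {e}"] fl_cl[of "{e}"] cl_least[OF F, of "{e}"] e by auto
    have r1: "rk (cl {e}) = 1" using rk_cl[of "{e}"] rk_singleton eE by simp
    have fh: "fl (h C)" "h C \<subseteq> C" if "C \<in> comps F" for C using h that unfolding D_def by auto
    obtain C where C: "C \<in> comps F" "h C \<noteq> {}"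
    proof (rule ccontr)
      assume "\<not> thesis"
      then have "\<Union>(h ` comps F) = {}" using that by blast
      then show False using h r1 fl_cl_eq[OF fl_empty] unfolding jn_def by simp
    qed
    have "h D = {}" if D: "D \<in> comps F" "D \<noteq> C" for D
    proof (rule ccontr)
      assume "h D \<noteq> {}"
      then have "0 < rk (h D)" "0 < rk (h C)"
        using rk_pos fh[OF D(1)] fh[OF C(1)] C fl_subset_E by auto
      moreover have "(\<Sum>X\<in>{C,D}. rk (h X)) \<le> (\<Sum>X\<in>comps F. rk (h X))"
        by (rule sum_mono2) (use finite_comps C D in auto)
      ultimately show False using lower[OF h(1)] h r1 D by simp
    qed
    then have "\<Union>(h ` comps F) = h C" using C by blast
    then have "cl {e} = h C" using h fl_cl_eq fh[OF C(1)] unfolding jn_def by simp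
    then show "e \<in> \<Union>(comps F)" using fh[OF C(1)] C subset_cl[of "{e}"] eE by auto
  qed
  ultimately show ?thesis using sub by blast
qed

lemma comps_rk: "fl F \<Longrightarrow> rk F = (\<Sum>C\<in>comps F. rk C)"
  and Union_comps: "fl F \<Longrightarrow> \<Union>(comps F) = F"
  using comps_rk_Union by auto

text \<open>The rank of \<open>F\<close> is the sum over its components, which leaves no room for a
  defect between one component and the union of the others. Additivity then descends to
  subsets.\<close>

lemma comps_split_aux:
  assumes F: "fl F" and C: "C \<in> comps F" and XY: "X \<subseteq> C" "Y \<subseteq> \<Union>(comps F - {C})"
  shows "rk (X \<union> Y) = rk X + rk Y"
proof (rule rk_additive_mono[OF _ XY])
  have "C \<union> \<Union>(comps F - {C}) = F" using Union_comps[OF F] C by blast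
  moreover have "rk F = rk C + (\<Sum>D\<in>comps F - {C}. rk D)"
    using comps_rk[OF F] C finite_comps by (simp add: sum.remove)
  moreover have "rk (\<Union>(comps F - {C})) \<le> (\<Sum>D\<in>comps F - {C}. rk D)"
    using finite_comps by (intro rk_Union_le) auto
  ultimately show "rk (C \<union> \<Union>(comps F - {C})) = rk C + rk (\<Union>(comps F - {C}))"
    using rk_Un_le[of C "\<Union>(comps F - {C})"] by simp
qed

lemma comps_disjoint:
  assumes F: "fl F" and C: "C \<in> comps F" "D \<in> comps F" "C \<noteq> D"
  shows "C \<inter> D = {}"
proof (rule ccontr)
  assume "C \<inter> D \<noteq> {}"
  then obtain e where e: "e \<in> C" "e \<in> D" by blast
  then have "e \<in> E" using C compsD building_subset_E by blast
  moreover have "rk ({e} \<union> {e}) = rk {e} + rk {e}"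
    by (rule comps_split_aux[OF F C(1)]) (use e C in auto)
  ultimately show False using rk_singleton by simp
qed

lemma comps_split:
  assumes F: "fl F" and C: "C \<in> comps F" and XY: "X \<subseteq> C" "Y \<subseteq> F - C"
  shows "rk (X \<union> Y) = rk X + rk Y"
  by (rule comps_split_aux[OF F C XY(1)]) (use XY Union_comps[OF F] in blast)

lemma comps_eqI: "fl F \<Longrightarrow> C \<in> comps F \<Longrightarrow> D \<in> comps F \<Longrightarrow> e \<in> C \<Longrightarrow> e \<in> D \<Longrightarrow> C = D"
  using comps_disjoint by blast

text \<open>Both sets lie below components of their join. These components meet, hence coincide, and
  a component containing both sets is the whole join.\<close>

lemma building_join:
  assumes G: "G \<in> \<G>" "H \<in> \<G>" "G \<inter> H \<noteq> {}"
  shows "cl (G \<union> H) \<in> \<G>"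
proof -
  have GH: "G \<union> H \<subseteq> E" using building_subset_E G by auto
  then have F: "fl (cl (G \<union> H))" by (rule fl_cl)
  have s: "G \<union> H \<subseteq> cl (G \<union> H)" using GH subset_cl by blast
  obtain C D where C: "C \<in> comps (cl (G \<union> H))" "G \<subseteq> C" and D: "D \<in> comps (cl (G \<union> H))" "H \<subseteq> D"
    using in_comps_above[OF G(1)] in_comps_above[OF G(2)] s by (metis Un_subset_iff)
  have "C = D" using comps_eqI[OF F C(1) D(1)] G(3) C D by blast
  then have "cl (G \<union> H) \<subseteq> C"
    using C D cl_least[OF building_fl[OF compsD(1)[OF C(1)]], of "G \<union> H"] by auto
  then show ?thesis using compsD[OF C(1)] by auto
qed

lemma atom_in_building: "atom E indep a \<Longrightarrow> a \<in> \<G>"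
proof -
  assume a: "atom E indep a"
  then have fa: "fl a" "a \<noteq> {}" unfolding atom_def by auto
  then obtain C where C: "C \<in> comps a" using Union_comps[OF fa(1)] by auto
  then have "C = {} \<or> C = a" using a compsD[OF C] building_fl unfolding atom_def by blast
  then show ?thesis using compsD[OF C] building_nonempty by auto
qed

section \<open>Nested sets\<close>

abbreviation antichain :: "'a set set \<Rightarrow> bool" where
  "antichain A \<equiv> \<forall>X\<in>A. \<forall>Y\<in>A. X \<subseteq> Y \<longrightarrow> X = Y"

lemma nested_subset_building: "nst S \<Longrightarrow> S \<subseteq> \<G>"
  unfolding nested_def by auto

lemma nestedD: "nst S \<Longrightarrow> A \<subseteq> S \<Longrightarrow> antichain A \<Longrightarrow> 2 \<le> card A \<Longrightarrow> cl (\<Union>A) \<notin> \<G>"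
  unfolding nested_def mjoin_def by blast

text \<open>A subset of an antichain is an antichain, so the two sets \<open>A\<close> and
  \<open>T\<close> of the definition collapse to one.\<close>

lemma nestedI:
  assumes "S \<subseteq> \<G>" "\<And>A. A \<subseteq> S \<Longrightarrow> antichain A \<Longrightarrow> 2 \<le> card A \<Longrightarrow> cl (\<Union>A) \<in> \<G> \<Longrightarrow> False"
  shows "nst S"
  unfolding nested_def mjoin_def
proof (intro conjI allI impI notI)
  fix A T assume *: "A \<subseteq> S" "antichain A" "T \<subseteq> A" "2 \<le> card T" "cl (\<Union>T) \<in> \<G>"
  have "T \<subseteq> S" "antichain T" using * by blast+
  then show False using assms(2)[of T] * by blast
qed (rule assms(1))

lemma nested_subset: "nst S \<Longrightarrow> T \<subseteq> S \<Longrightarrow> nst T"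
  unfolding nested_def by (meson order_trans)

lemma nested_finite: "nst S \<Longrightarrow> finite S"
  using nested_subset_building finite_building finite_subset by blast

lemma not_nested_pair:
  assumes "G \<in> \<G>" "H \<in> \<G>" "G \<inter> H \<noteq> {}" "\<not> G \<subseteq> H" "\<not> H \<subseteq> G" "G \<in> S" "H \<in> S"
  shows "\<not> nst S"
proof
  assume "nst S"
  moreover have "G \<noteq> H" using assms by blast
  then have "card {G, H} = 2" by simp
  ultimately have "cl (\<Union>{G, H}) \<notin> \<G>" using assms by (intro nestedD[of S]) auto
  then show False using building_join[OF assms(1-3)] by simp
qed

lemma nested_comparable:
  "nst S \<Longrightarrow> X \<in> S \<Longrightarrow> Y \<in> S \<Longrightarrow> X \<inter> Y \<noteq> {} \<Longrightarrow> X \<subseteq> Y \<or> Y \<subseteq> X"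
  using not_nested_pair[of X Y S] nested_subset_building by blast

text \<open>Let C be a component of the join. Members of \<open>A\<close> not inside C lie in other
  components, so by rank additivity the members inside C must already generate C. Nestedness allows
  only one such member, which is then C itself.\<close>

lemma nested_antichain_comps:
  assumes S: "nst S" and A: "A \<subseteq> S" "antichain A"
  shows "comps (cl (\<Union>A)) = A"
proof -
  have AG: "A \<subseteq> \<G>" using nested_subset_building S A by blast
  have finA: "finite A" using AG finite_building finite_subset by blast
  have UE: "\<Union>A \<subseteq> E" using AG building_subset_E by blast
  define F where "F = cl (\<Union>A)"
  have F: "fl F" unfolding F_def using UE by (rule fl_cl)
  have sF: "G \<subseteq> F" if "G \<in> A" for G using that subset_cl[OF UE] unfolding F_def by blast
  have AC: "{G \<in> A. G \<subseteq> C} = {C}" if C: "C \<in> comps F" for C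
  proof -
    define B where "B = {G \<in> A. G \<subseteq> C}"
    have sub: "\<Union>A \<subseteq> \<Union>B \<union> (F - C)"
    proof
      fix e assume "e \<in> \<Union>A"
      then obtain G where G: "G \<in> A" "e \<in> G" by blast
      then obtain D where D: "D \<in> comps F" "G \<subseteq> D" using in_comps_above[of G F] sF AG by blast
      show "e \<in> \<Union>B \<union> (F - C)"
      proof (cases "D = C")
        case True then show ?thesis using G D unfolding B_def by auto
      next
        case False then show ?thesis using comps_disjoint[OF F C D(1)] G D compsD(2)[OF D(1)] by blast
      qed
    qed
    have BC: "\<Union>B \<subseteq> C" unfolding B_def by auto
    have "rk F = rk (C \<union> (F - C))" using compsD(2)[OF C] by (simp add: Un_absorb1)
    then have "rk F = rk C + rk (F - C)" using comps_split[OF F C, of C "F - C"] by simp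
    moreover have "rk F \<le> rk (\<Union>B \<union> (F - C))"
      using rk_cl[OF UE] rk_mono[OF sub] unfolding F_def by simp
    moreover have "rk (\<Union>B \<union> (F - C)) = rk (\<Union>B) + rk (F - C)" using comps_split[OF F C BC] by simp
    ultimately have "rk C \<le> rk (\<Union>B)" by linarith
    then have cB: "cl (\<Union>B) = C" using cl_eq_of_rk[OF BC] building_fl compsD(1)[OF C] by blast
    have "B \<noteq> {}" using cB fl_cl_eq[OF fl_empty] building_nonempty[OF compsD(1)[OF C]] by auto
    moreover have "\<not> 2 \<le> card B"
      using nestedD[OF S, of B] A cB compsD(1)[OF C] unfolding B_def by auto
    moreover have "finite B" using finA unfolding B_def by simp
    ultimately have "card B = 1" using card_gt_0_iff[of B] by linarith
    then obtain G where "B = {G}" by (auto simp: card_1_singleton_iff)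
    moreover have "G \<in> A" using \<open>B = {G}\<close> by (auto simp: B_def)
    then have "cl G = G" using AG building_fl[THEN fl_cl_eq] by auto
    ultimately show ?thesis using cB unfolding B_def by simp
  qed
  show ?thesis
    unfolding F_def[symmetric]
  proof
    show "comps F \<subseteq> A" using AC by blast
    show "A \<subseteq> comps F"
    proof
      fix G assume G: "G \<in> A"
      then obtain D where D: "D \<in> comps F" "G \<subseteq> D" using in_comps_above[of G F] sF AG by blast
      then have "G \<in> {G \<in> A. G \<subseteq> D}" using G by simp
      then show "G \<in> comps F" unfolding AC[OF D(1)] using D(1) by simp
    qed
  qed
qed

text \<open>Joins in a nested set are plain unions: the maximal elements are the components of their
  join, and a flat is the union of its components.\<close>

lemma nested_comps:
  assumes S: "nst S" and A: "A \<subseteq> S"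
  shows "comps (\<Union>A) = {X \<in> A. \<forall>Y\<in>A. X \<subseteq> Y \<longrightarrow> Y = X}" and "fl (\<Union>A)"
proof -
  define M where "M = {X \<in> A. \<forall>Y\<in>A. X \<subseteq> Y \<longrightarrow> Y = X}"
  have finA: "finite A" using A nested_finite[OF S] finite_subset by blast
  have "\<exists>Y\<in>M. X \<subseteq> Y" if "X \<in> A" for X
  proof -
    from that have "X \<in> A" .
    then obtain Y where "Y \<in> A" "X \<subseteq> Y" "\<forall>Z\<in>A. Y \<subseteq> Z \<longrightarrow> Y = Z"
      using finite_has_maximal2[OF finA] by blast
    then show ?thesis unfolding M_def by auto
  qed
  then have U: "\<Union>A = \<Union>M" unfolding M_def by blast
  have M: "M \<subseteq> S" "antichain M" using A unfolding M_def by auto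
  have c: "comps (cl (\<Union>M)) = M" by (rule nested_antichain_comps[OF S M])
  have "fl (cl (\<Union>M))"
    using M(1) nested_subset_building[OF S] building_subset_E by (intro fl_cl) blast
  then have "cl (\<Union>M) = \<Union>M" "fl (\<Union>M)" using Union_comps[of "cl (\<Union>M)"] c by auto
  then show "comps (\<Union>A) = {X \<in> A. \<forall>Y\<in>A. X \<subseteq> Y \<longrightarrow> Y = X}" "fl (\<Union>A)"
    using c U unfolding M_def by auto
qed

lemma nested_below_Union:
  assumes S: "nst S" and A: "A \<subseteq> S" and H: "H \<in> \<G>" "H \<subseteq> \<Union>A"
  obtains X where "X \<in> A" "H \<subseteq> X"
proof -
  obtain C where "C \<in> comps (\<Union>A)" "H \<subseteq> C" using in_comps_above[OF H] .
  then show thesis using that[of C] by (simp add: nested_comps(1)[OF S A])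
qed

text \<open>For nested \<open>S\<close> this union is already the join, by
  \<open>nested_comps\<close>, so no closure is taken.\<close>

definition below :: "'a set set \<Rightarrow> 'a set \<Rightarrow> 'a set" where
  "below S G = \<Union>{X \<in> S. X \<subset> G}"

lemma below_subset: "below S G \<subseteq> G"
  unfolding below_def by auto

lemma below_mono: "S \<subseteq> T \<Longrightarrow> below S G \<subseteq> below T G"
  unfolding below_def by auto

lemma fl_below: "nst S \<Longrightarrow> fl (below S G)"
  unfolding below_def by (rule nested_comps(2)) auto

lemma comps_below: "nst S \<Longrightarrow> C \<in> comps (below S G) \<longleftrightarrow> C \<in> S \<and> C \<subset> G \<and> (\<forall>Y\<in>S. Y \<subset> G \<longrightarrow> C \<subseteq> Y \<longrightarrow> Y = C)"
  unfolding below_def by (subst nested_comps(1)[of S]) auto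

lemma below_neq:
  assumes S: "nst S" and G: "G \<in> \<G>"
  shows "below S G \<noteq> G"
proof
  assume "below S G = G"
  then have "G \<in> comps (below S G)" using comps_building[OF G] by simp
  then show False using comps_below[OF S] by auto
qed

lemma rk_below_less: "nst S \<Longrightarrow> G \<in> \<G> \<Longrightarrow> rk (below S G) < rk G"
  using rk_less_of_not_subset[OF fl_below below_subset building_subset_E, of S G] below_neq[of S G]
    below_subset[of S G] by auto

text \<open>Both unions split along the component \<open>K\<close> of the larger one: inside
  \<open>K\<close> they give \<open>K\<close> and \<open>below S K\<close>, and outside
  \<open>K\<close> they agree. This computes ranks one element at a time.\<close>

lemma rk_remove_maximal:
  assumes S: "nst S" and A: "A \<subseteq> S" and K: "K \<in> A" "\<And>X. X \<in> A \<Longrightarrow> K \<subseteq> X \<Longrightarrow> X = K"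
    and down: "{X \<in> S. X \<subset> K} \<subseteq> A"
  shows "rk (\<Union>A) + rk (below S K) = rk K + rk (\<Union>(A - {K}))"
proof -
  have F: "fl (\<Union>A)" and C: "K \<in> comps (\<Union>A)" using nested_comps[OF S A] K by auto
  have 1: "\<Union>A = K \<union> (\<Union>A - K)" using K by blast
  have meet: "X \<subset> K" if "X \<in> A - {K}" "X \<inter> K \<noteq> {}" for X
    using nested_comparable[OF S, of X K] that A K by blast
  have 2: "\<Union>(A - {K}) = below S K \<union> (\<Union>A - K)"
  proof (intro set_eqI iffI)
    fix x assume "x \<in> \<Union>(A - {K})"
    then obtain X where X: "X \<in> A - {K}" "x \<in> X" by blast
    show "x \<in> below S K \<union> (\<Union>A - K)"
    proof (cases "x \<in> K")
      case True
      then have "X \<subset> K" using meet X by blast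
      then show ?thesis using X A unfolding below_def by blast
    next
      case False
      then show ?thesis using X by blast
    qed
  next
    fix x assume x: "x \<in> below S K \<union> (\<Union>A - K)"
    show "x \<in> \<Union>(A - {K})"
    proof (cases "x \<in> below S K")
      case True
      then obtain X where "X \<in> S" "X \<subset> K" "x \<in> X" unfolding below_def by blast
      then show ?thesis using down by blast
    next
      case False
      then show ?thesis using x by blast
    qed
  qed
  have "rk (\<Union>A) = rk K + rk (\<Union>A - K)" using comps_split[OF F C, of K "\<Union>A - K"] 1 by simp
  moreover have "rk (\<Union>(A - {K})) = rk (below S K) + rk (\<Union>A - K)"
    using comps_split[OF F C below_subset, of "\<Union>A - K"] 2 by simp
  ultimately show ?thesis by linarith
qed

end

section \<open>Polynomials\<close>

abbreviation keys :: "('b \<Rightarrow>\<^sub>0 'c::zero) \<Rightarrow> 'b set" where "keys \<equiv> Poly_Mapping.keys"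
abbreviation lookup :: "('b \<Rightarrow>\<^sub>0 'c::zero) \<Rightarrow> 'b \<Rightarrow> 'c" where "lookup \<equiv> Poly_Mapping.lookup"
abbreviation single :: "'b \<Rightarrow> 'c \<Rightarrow> 'b \<Rightarrow>\<^sub>0 'c::zero" where "single \<equiv> Poly_Mapping.single"

lemma lookup_cscale: "lookup (cscale c p) m = c * lookup p m"
  unfolding cscale_def mult_map_scale_conv_mult[symmetric] by (simp add: map.rep_eq when_def)

interpretation cpoly: vector_space "cscale :: rat \<Rightarrow> 'a cpoly \<Rightarrow> 'a cpoly"
  by unfold_locales
    (auto simp: cscale_def distrib_left single_add distrib_right mult.assoc[symmetric] mult_single)

lemma single_eq_cscale: "single m c = cscale c (single m 1)"
  unfolding cscale_def by (simp add: mult_single)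

lemma sum_monomials:
  fixes a :: "'b \<Rightarrow>\<^sub>0 'c::comm_monoid_add"
  shows "(\<Sum>x\<in>keys a. single x (lookup a x)) = a"
  by (rule poly_mapping_eqI) (auto simp: lookup_sum lookup_single when_def in_keys_iff)

lemma cpoly_expand:
  "p = (\<Sum>m\<in>keys p. cscale (lookup p m) (single m 1))"
  using sum_monomials[of p] by (simp add: single_eq_cscale[symmetric])

lemma cscale_mult_left: "cscale c p * q = cscale c (p * q)"
  unfolding cscale_def by (simp add: mult.assoc)

lemma cscale_mult_right: "p * cscale c q = cscale c (p * q)"
  unfolding cscale_def by (simp add: algebra_simps)

text \<open>The span of the monomials in \<open>M\<close>. One notion serves for the polynomial
  ring, its graded pieces and the truncations by weight.\<close>

definition supported :: "('a set \<Rightarrow>\<^sub>0 nat) set \<Rightarrow> 'a cpoly set" where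
  "supported M = {p. keys p \<subseteq> M}"

lemma poly_ring_supported: "poly_ring \<G> = supported {m. keys m \<subseteq> \<G>}"
  unfolding poly_ring_def supported_def by auto

lemma poly_ring_deg_supported:
  "poly_ring_deg \<G> i = supported {m. keys m \<subseteq> \<G> \<and> mdeg m = i}"
  unfolding poly_ring_deg_def poly_ring_def supported_def by auto

lemma supported_zero: "0 \<in> supported M"
  unfolding supported_def by auto

lemma supported_add: "p \<in> supported M \<Longrightarrow> q \<in> supported M \<Longrightarrow> p + q \<in> supported M"
  unfolding supported_def using Poly_Mapping.keys_add[of p q] by blast

lemma supported_sum: "(\<And>x. x \<in> A \<Longrightarrow> f x \<in> supported M) \<Longrightarrow> sum f A \<in> supported M"
  by (induction A rule: infinite_finite_induct) (auto intro: supported_zero supported_add)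

lemma supported_mult:
  assumes "p \<in> supported M" "q \<in> supported N" "\<And>m n. m \<in> M \<Longrightarrow> n \<in> N \<Longrightarrow> m + n \<in> L"
  shows "p * q \<in> supported L"
  using Poly_Mapping.keys_mult[of p q] assms unfolding supported_def by fastforce

lemma supported_single: "m \<in> M \<Longrightarrow> single m c \<in> supported M"
  unfolding supported_def by (cases "c = 0") auto

lemma supported_subset_span:
  "supported M \<subseteq> cpoly.span ((\<lambda>m. single m 1) ` M)"
proof
  fix p :: "'a cpoly" assume "p \<in> supported M"
  then have "(\<Sum>m\<in>keys p. cscale (lookup p m) (single m 1))
      \<in> cpoly.span ((\<lambda>m. single m 1) ` M)"
    unfolding supported_def by (intro cpoly.span_sum cpoly.span_scale cpoly.span_base) auto
  then show "p \<in> cpoly.span ((\<lambda>m. single m 1) ` M)"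
    using cpoly_expand[of p] by simp
qed

text \<open>Weighted degree: weight 1 gives \<open>mdeg\<close>, and weight \<open>codim\<close>
  drives the straightening of monomials.\<close>

definition wt :: "('a set \<Rightarrow> nat) \<Rightarrow> ('a set \<Rightarrow>\<^sub>0 nat) \<Rightarrow> nat" where
  "wt v m = (\<Sum>G\<in>keys m. lookup m G * v G)"

lemma mdeg_wt: "mdeg m = wt (\<lambda>_. 1) m"
  unfolding mdeg_def wt_def by simp

lemma wt_add: "wt v (m + n) = wt v m + wt v n"
  unfolding wt_def
  using setsum_keys_plus_distrib[of "\<lambda>G k. k * v G" m n] by (simp add: add_mult_distrib)

lemma wt_zero [simp]: "wt v 0 = 0"
  unfolding wt_def by simp

lemma wt_single [simp]: "wt v (single G k) = k * v G"
  unfolding wt_def by (cases "k = 0") auto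

lemma mdeg_add: "mdeg (m + n) = mdeg m + mdeg n"
  by (simp add: mdeg_wt wt_add)

lemma keys_add_nat:
  fixes m n :: "'b \<Rightarrow>\<^sub>0 nat"
  shows "keys (m + n) = keys m \<union> keys n"
  by (auto simp: in_keys_iff lookup_add)

lemma finite_monomials:
  assumes "finite \<G>"
  shows "finite {m :: 'a set \<Rightarrow>\<^sub>0 nat. keys m \<subseteq> \<G> \<and> mdeg m = i}" (is "finite ?M")
proof (rule inj_on_finite)
  let ?f = "\<lambda>m :: 'a set \<Rightarrow>\<^sub>0 nat. restrict (lookup m) \<G>"
  show "inj_on ?f ?M"
  proof (rule inj_onI)
    fix m n assume mn: "m \<in> ?M" "n \<in> ?M" "?f m = ?f n"
    show "m = n"
    proof (rule poly_mapping_eqI)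
      fix G
      show "lookup m G = lookup n G"
      proof (cases "G \<in> \<G>")
        case True then show ?thesis using fun_cong[OF mn(3), of G] by simp
      next
        case False
        then have "G \<notin> keys m" "G \<notin> keys n" using mn by auto
        then show ?thesis by (simp add: in_keys_iff)
      qed
    qed
  qed
  show "?f ` ?M \<subseteq> \<G> \<rightarrow>\<^sub>E {..i}"
  proof
    fix f assume "f \<in> ?f ` ?M"
    then obtain m where m: "m \<in> ?M" "f = ?f m" by blast
    have "lookup m G \<le> i" for G
    proof (cases "G \<in> keys m")
      case True
      then have "lookup m G \<le> mdeg m" unfolding mdeg_def by (intro member_le_sum) auto
      then show ?thesis using m by simp
    qed (simp add: in_keys_iff)
    then show "f \<in> \<G> \<rightarrow>\<^sub>E {..i}" using m by auto
  qed
  show "finite (\<G> \<rightarrow>\<^sub>E {..i})" using assms by (intro finite_PiE) auto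
qed

text \<open>The monomial \<open>m\<close> evaluated at \<sigma>: \<open>mon var\<close> is the
  monomial itself, and \<open>mon hvar\<close> its analogue in the h-variables.\<close>

definition mon :: "('a set \<Rightarrow> 'a cpoly) \<Rightarrow> ('a set \<Rightarrow>\<^sub>0 nat) \<Rightarrow> 'a cpoly" where
  "mon \<sigma> m = (\<Prod>G\<in>keys m. \<sigma> G ^ lookup m G)"

lemma mon_superset:
  "finite A \<Longrightarrow> keys m \<subseteq> A \<Longrightarrow> mon \<sigma> m = (\<Prod>G\<in>A. \<sigma> G ^ lookup m G)"
  unfolding mon_def by (rule prod.mono_neutral_left) (auto simp: in_keys_iff)

lemma mon_add: "mon \<sigma> (m + n) = mon \<sigma> m * mon \<sigma> n"
proof -
  let ?A = "keys m \<union> keys n"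
  have "mon \<sigma> (m + n) = (\<Prod>G\<in>?A. \<sigma> G ^ lookup (m + n) G)"
    by (rule mon_superset) (use Poly_Mapping.keys_add[of m n] in auto)
  moreover have "mon \<sigma> m = (\<Prod>G\<in>?A. \<sigma> G ^ lookup m G)"
    "mon \<sigma> n = (\<Prod>G\<in>?A. \<sigma> G ^ lookup n G)"
    by (rule mon_superset; simp)+
  ultimately show ?thesis by (simp add: lookup_add power_add prod.distrib)
qed

lemma mon_zero [simp]: "mon \<sigma> 0 = 1"
  unfolding mon_def by simp

lemma prod_single: "(\<Prod>x\<in>A. single (f x) (1::rat)) = single (\<Sum>x\<in>A. f x) 1"
  by (induction A rule: infinite_finite_induct) (auto simp: mult_single)

lemma var_power: "var G ^ k = single (single G k) 1"
  unfolding var_def by (induction k) (auto simp: mult_single single_add[symmetric])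

lemma mon_var: "mon var m = single m 1"
  unfolding mon_def var_power prod_single sum_monomials ..

definition subst :: "('a set \<Rightarrow> 'a cpoly) \<Rightarrow> 'a cpoly \<Rightarrow> 'a cpoly" where
  "subst \<sigma> p = (\<Sum>m\<in>keys p. cscale (lookup p m) (mon \<sigma> m))"

definition lin :: "(('a set \<Rightarrow>\<^sub>0 nat) \<Rightarrow> rat) \<Rightarrow> 'a cpoly \<Rightarrow> rat" where
  "lin w p = (\<Sum>m\<in>keys p. lookup p m * w m)"

lemma lin_add: "lin w (p + q) = lin w p + lin w q"
  unfolding lin_def
  using setsum_keys_plus_distrib[of "\<lambda>m a. a * w m" p q] by (simp add: distrib_right)

lemma lin_zero [simp]: "lin w 0 = 0"
  unfolding lin_def by simp

lemma lin_single [simp]: "lin w (single m c) = c * w m"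
  unfolding lin_def by (cases "c = 0") auto

lemma lin_cscale: "lin w (cscale c p) = c * lin w p"
proof (cases "c = 0")
  case False
  then have "keys (cscale c p) = keys p" by (auto simp: in_keys_iff lookup_cscale)
  then show ?thesis unfolding lin_def by (simp add: lookup_cscale sum_distrib_left mult.assoc)
qed (simp add: lin_def)

lemma lin_sum: "lin w (sum f A) = (\<Sum>x\<in>A. lin w (f x))"
  by (induction A rule: infinite_finite_induct) (auto simp: lin_add)

lemma lin_uminus: "lin w (- p) = - lin w p"
  using lin_add[of w p "- p"] by simp

lemma lin_diff: "lin w (p - q) = lin w p - lin w q"
  using lin_add[of w p "- q"] by (simp add: lin_uminus)

lemma subst_add: "subst \<sigma> (p + q) = subst \<sigma> p + subst \<sigma> q"
  unfolding subst_def
  using setsum_keys_plus_distrib[of "\<lambda>m a. cscale a (mon \<sigma> m)" p q]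
  by (simp add: cpoly.scale_left_distrib)

lemma subst_zero [simp]: "subst \<sigma> 0 = 0"
  unfolding subst_def by simp

lemma subst_single: "subst \<sigma> (single m c) = cscale c (mon \<sigma> m)"
  unfolding subst_def by (cases "c = 0") auto

lemma subst_sum: "subst \<sigma> (sum f A) = (\<Sum>x\<in>A. subst \<sigma> (f x))"
  by (induction A rule: infinite_finite_induct) (auto simp: subst_add)

lemma subst_mult: "subst \<sigma> (p * q) = subst \<sigma> p * subst \<sigma> q"
proof -
  have exp: "p = (\<Sum>m\<in>keys p. single m (lookup p m))" for p :: "'a cpoly"
    by (rule sum_monomials[symmetric])
  have "p * q = (\<Sum>m\<in>keys p. \<Sum>n\<in>keys q.
      single (m + n) (lookup p m * lookup q n))"
    by (subst exp[of p], subst exp[of q]) (simp add: sum_product mult_single)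
  then have "subst \<sigma> (p * q) = (\<Sum>m\<in>keys p. \<Sum>n\<in>keys q.
      cscale (lookup p m * lookup q n) (mon \<sigma> m * mon \<sigma> n))"
    by (simp add: subst_sum subst_single mon_add)
  also have "\<dots> = subst \<sigma> p * subst \<sigma> q"
    unfolding subst_def sum_product by (simp add: cscale_mult_left cscale_mult_right mult.commute)
  finally show ?thesis .
qed

lemma subst_one [simp]: "subst \<sigma> 1 = 1"
  using subst_single[of \<sigma> 0 1] by simp

lemma subst_prod: "subst \<sigma> (prod f A) = (\<Prod>x\<in>A. subst \<sigma> (f x))"
  by (induction A rule: infinite_finite_induct) (auto simp: subst_mult)

lemma subst_power: "subst \<sigma> (p ^ k) = subst \<sigma> p ^ k"
  by (induction k) (auto simp: subst_mult)

lemma subst_cscale: "subst \<sigma> (cscale c p) = cscale c (subst \<sigma> p)"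
  unfolding cscale_def subst_mult subst_single by (simp add: cscale_def)

lemma subst_var [simp]: "subst \<sigma> (var G) = \<sigma> G"
  unfolding var_def subst_single by (simp add: mon_def)

lemma subst_mon: "subst \<sigma> (mon h m) = mon (\<lambda>G. subst \<sigma> (h G)) m"
  unfolding mon_def by (simp add: subst_prod subst_power)

text \<open>A triangular system in which \<open>peel\<close> replaces an explicit order. The
  functional of the peeled index vanishes on \<open>B\<close> and on the other members of
  \<open>J\<close> but not on its own vector, which is therefore outside their span. In the
  application \<open>B\<close> is a basis of a graded piece of the ideal.\<close>

lemma independent_by_functionals:
  fixes h :: "'i \<Rightarrow> 'a cpoly" and l :: "'i \<Rightarrow> 'a cpoly \<Rightarrow> rat"
  assumes fin: "finite I" and B: "cpoly.independent B" "finite B"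
    and l0: "\<And>i b. i \<in> I \<Longrightarrow> b \<in> B \<Longrightarrow> l i b = 0"
    and ladd: "\<And>i p q. l i (p + q) = l i p + l i q" and lsc: "\<And>i c p. l i (cscale c p) = c * l i p"
    and diag: "\<And>i. i \<in> I \<Longrightarrow> l i (h i) \<noteq> 0"
    and peel: "\<And>J. J \<subseteq> I \<Longrightarrow> J \<noteq> {} \<Longrightarrow> \<exists>i\<in>J. \<forall>j\<in>J. j \<noteq> i \<longrightarrow> l i (h j) = 0"
  shows "cpoly.independent (B \<union> h ` I) \<and> card (B \<union> h ` I) = card B + card I"
proof -
  have "J \<subseteq> I \<Longrightarrow> cpoly.independent (B \<union> h ` J) \<and> card (B \<union> h ` J) = card B + card J" for J
  proof (induction "card J" arbitrary: J)
    case 0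
    then have "J = {}" using fin finite_subset by fastforce
    then show ?case using B by simp
  next
    case (Suc n)
    have finJ: "finite J" using Suc fin finite_subset by blast
    have "J \<noteq> {}" using Suc by auto
    then obtain i where i: "i \<in> J" "\<And>j. j \<in> J \<Longrightarrow> j \<noteq> i \<Longrightarrow> l i (h j) = 0"
      using peel[OF Suc.prems] by blast
    let ?J = "J - {i}"
    have cJ: "card J = Suc (card ?J)" using card.remove[OF finJ i(1)] .
    then have "n = card ?J" "?J \<subseteq> I" using Suc.hyps(2) Suc.prems by auto
    then have IH: "cpoly.independent (B \<union> h ` ?J)" "card (B \<union> h ` ?J) = card B + card ?J"
      using Suc.hyps(1)[of ?J] by auto
    have l00: "l i 0 = 0" using ladd[of i 0 0] by simp
    have "cpoly.subspace {p. l i p = 0}"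
      unfolding cpoly.subspace_def by (simp add: ladd lsc l00)
    moreover have "B \<union> h ` ?J \<subseteq> {p. l i p = 0}" using l0 i Suc.prems by auto
    ultimately have "cpoly.span (B \<union> h ` ?J) \<subseteq> {p. l i p = 0}" by (rule cpoly.span_minimal[rotated])
    then have notin: "h i \<notin> cpoly.span (B \<union> h ` ?J)" using diag[of i] i Suc.prems by auto
    have "h i \<notin> B \<union> h ` ?J" by (rule contrapos_nn[OF notin]) (rule cpoly.span_base)
    moreover have "B \<union> h ` J = insert (h i) (B \<union> h ` ?J)" using i(1) by blast
    ultimately show ?case
      using IH cpoly.independent_insertI[OF notin IH(1)] B(2) finJ by (simp add: cJ)
  qed
  then show ?thesis by simp
qed

section \<open>The Feichtner--Yuzvinsky monomials span\<close>

lemma poly_ring_zero: "0 \<in> poly_ring \<G>"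
  and poly_ring_add: "p \<in> poly_ring \<G> \<Longrightarrow> q \<in> poly_ring \<G> \<Longrightarrow> p + q \<in> poly_ring \<G>"
  unfolding poly_ring_supported by (auto intro: supported_zero supported_add)

lemma poly_ring_mult: "p \<in> poly_ring \<G> \<Longrightarrow> q \<in> poly_ring \<G> \<Longrightarrow> p * q \<in> poly_ring \<G>"
  unfolding poly_ring_supported by (rule supported_mult) (auto simp: keys_add_nat)

lemma poly_ring_single: "keys m \<subseteq> \<G> \<Longrightarrow> single m c \<in> poly_ring \<G>"
  unfolding poly_ring_supported by (rule supported_single) auto

lemma poly_ring_var: "G \<in> \<G> \<Longrightarrow> var G \<in> poly_ring \<G>"
  unfolding var_def by (rule poly_ring_single) auto

lemma poly_ring_one: "1 \<in> poly_ring \<G>"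
  using poly_ring_single[of 0 \<G> 1] by simp

lemma poly_ring_power: "p \<in> poly_ring \<G> \<Longrightarrow> p ^ k \<in> poly_ring \<G>"
  by (induction k) (auto intro: poly_ring_one poly_ring_mult)

lemma poly_ring_prod: "(\<And>x. x \<in> A \<Longrightarrow> f x \<in> poly_ring \<G>) \<Longrightarrow> prod f A \<in> poly_ring \<G>"
  by (induction A rule: infinite_finite_induct) (auto intro: poly_ring_one poly_ring_mult)

lemma poly_ring_sum: "(\<And>x. x \<in> A \<Longrightarrow> f x \<in> poly_ring \<G>) \<Longrightarrow> sum f A \<in> poly_ring \<G>"
  unfolding poly_ring_supported by (rule supported_sum)

context built_matroid
begin

section \<open>Arithmetic in the Chow ideal\<close>

abbreviation ideal where "ideal \<equiv> chow_ideal E indep \<G>"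
abbreviation gens where "gens \<equiv> chow_gens E indep \<G>"

lemma ideal_iff: "p \<in> ideal \<longleftrightarrow>
    (\<exists>Gs r. p = (\<Sum>g\<in>Gs. r g * g) \<and> finite Gs \<and> Gs \<subseteq> gens \<and> (\<forall>g\<in>Gs. r g \<in> poly_ring \<G>))"
  by (simp only: chow_ideal_def mem_Collect_eq)

lemma idealI: "finite Gs \<Longrightarrow> Gs \<subseteq> gens \<Longrightarrow> (\<And>g. g \<in> Gs \<Longrightarrow> r g \<in> poly_ring \<G>) \<Longrightarrow>
    (\<Sum>g\<in>Gs. r g * g) \<in> ideal"
  unfolding ideal_iff by (intro exI[of _ Gs] exI[of _ r] conjI ballI refl)

lemma idealE:
  assumes "p \<in> ideal"
  obtains Gs r where "p = (\<Sum>g\<in>Gs. r g * g)" "finite Gs" "Gs \<subseteq> gens"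
    "\<And>g. g \<in> Gs \<Longrightarrow> r g \<in> poly_ring \<G>"
proof -
  from assms obtain Gs r where *: "p = (\<Sum>g\<in>Gs. r g * g) \<and> finite Gs \<and> Gs \<subseteq> gens \<and> (\<forall>g\<in>Gs. r g \<in> poly_ring \<G>)"
    unfolding ideal_iff by (elim exE)
  show thesis by (rule that[of r Gs]) (use * in auto)
qed

lemma ideal_zero: "0 \<in> ideal"
  using idealI[of "{}"] by simp

lemma ideal_gen: "g \<in> gens \<Longrightarrow> g \<in> ideal"
  using idealI[of "{g}" "\<lambda>_. 1"] poly_ring_one by auto

lemma ideal_mult: assumes "p \<in> ideal" "q \<in> poly_ring \<G>" shows "q * p \<in> ideal"
proof -
  obtain Gs r where p: "p = (\<Sum>g\<in>Gs. r g * g)" "finite Gs" "Gs \<subseteq> gens"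
    "\<And>g. g \<in> Gs \<Longrightarrow> r g \<in> poly_ring \<G>" by (rule idealE[OF assms(1)]) (rule that)
  have "q * p = (\<Sum>g\<in>Gs. (q * r g) * g)" unfolding p(1) by (simp add: sum_distrib_left mult.assoc)
  also have "\<dots> \<in> ideal" using p assms(2) by (intro idealI) (auto intro: poly_ring_mult)
  finally show ?thesis .
qed

lemma ideal_add: assumes "p \<in> ideal" "q \<in> ideal" shows "p + q \<in> ideal"
proof -
  obtain A r where p: "p = (\<Sum>g\<in>A. r g * g)" "finite A" "A \<subseteq> gens"
    "\<And>g. g \<in> A \<Longrightarrow> r g \<in> poly_ring \<G>" by (rule idealE[OF assms(1)]) (rule that)
  obtain B s where q: "q = (\<Sum>g\<in>B. s g * g)" "finite B" "B \<subseteq> gens"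
    "\<And>g. g \<in> B \<Longrightarrow> s g \<in> poly_ring \<G>" by (rule idealE[OF assms(2)]) (rule that)
  define u where "u g = (if g \<in> A then r g else 0) + (if g \<in> B then s g else 0)" for g
  have "p = (\<Sum>g\<in>A \<union> B. (if g \<in> A then r g else 0) * g)"
    unfolding p(1) using p q by (intro sum.mono_neutral_cong_left) auto
  moreover have "q = (\<Sum>g\<in>A \<union> B. (if g \<in> B then s g else 0) * g)"
    unfolding q(1) using p q by (intro sum.mono_neutral_cong_left) auto
  ultimately have "p + q = (\<Sum>g\<in>A \<union> B. u g * g)"
    unfolding u_def by (simp add: distrib_right sum.distrib)
  also have "\<dots> \<in> ideal"
    using p q unfolding u_def by (intro idealI) (auto intro: poly_ring_add poly_ring_zero)
  finally show ?thesis .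
qed

lemma ideal_cscale: "p \<in> ideal \<Longrightarrow> cscale c p \<in> ideal"
  unfolding cscale_def by (rule ideal_mult) (auto intro: poly_ring_single)

lemma ideal_uminus: "p \<in> ideal \<Longrightarrow> - p \<in> ideal"
  using ideal_cscale[of p "-1"] by simp

lemma ideal_diff: "p \<in> ideal \<Longrightarrow> q \<in> ideal \<Longrightarrow> p - q \<in> ideal"
  using ideal_add[of p "- q"] ideal_uminus[of q] by simp

lemma ideal_sum: "(\<And>x. x \<in> A \<Longrightarrow> f x \<in> ideal) \<Longrightarrow> sum f A \<in> ideal"
  by (induction A rule: infinite_finite_induct) (auto intro: ideal_zero ideal_add)

lemma ideal_mult_right: "p \<in> ideal \<Longrightarrow> q \<in> poly_ring \<G> \<Longrightarrow> p * q \<in> ideal"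
  using ideal_mult[of p q] by (simp add: mult.commute)

lemma nonnested_in_ideal: "S \<subseteq> \<G> \<Longrightarrow> \<not> nst S \<Longrightarrow> (\<Prod>G\<in>S. var G) \<in> ideal"
  by (rule ideal_gen) (auto simp: chow_gens_def)

text \<open>At an atom this is exactly a linear generator of the ideal.\<close>

definition hvar :: "'a set \<Rightarrow> 'a cpoly" where
  "hvar G = (\<Sum>H\<in>{H \<in> \<G>. G \<subseteq> H}. var H)"

lemma hvar_in_poly_ring: "hvar G \<in> poly_ring \<G>"
  unfolding hvar_def by (rule poly_ring_sum) (auto intro: poly_ring_var)

lemma hvar_atom_in_ideal: "e \<in> E \<Longrightarrow> hvar (cl {e}) \<in> ideal"
  unfolding hvar_def using atom_cl[of e] by (intro ideal_gen) (auto simp: chow_gens_def)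

text \<open>The terms of h_G missing from h at the join are x_K with K above G but not above H. Such
  a K meets H and is incomparable to it, so x_H x_K comes from a set that is not nested.\<close>

lemma var_hvar_cong:
  assumes G: "G \<in> \<G>" "H \<in> \<G>" "G \<inter> H \<noteq> {}" "\<not> G \<subseteq> H"
  shows "var H * hvar G ^ k - var H * hvar (cl (G \<union> H)) ^ k \<in> ideal"
proof (induction k)
  case (Suc k)
  let ?Q = "cl (G \<union> H)"
  have sub: "G \<union> H \<subseteq> E" using G building_subset_E by auto
  have Q: "?Q \<subseteq> K \<longleftrightarrow> G \<subseteq> K \<and> H \<subseteq> K" if "K \<in> \<G>" for K
    using cl_subset_iff[OF building_fl[OF that] sub] by simp
  let ?R = "{K \<in> \<G>. G \<subseteq> K \<and> \<not> H \<subseteq> K}"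
  have "{K \<in> \<G>. G \<subseteq> K} = {K \<in> \<G>. ?Q \<subseteq> K} \<union> ?R" using Q by auto
  moreover have "{K \<in> \<G>. ?Q \<subseteq> K} \<inter> ?R = {}" using Q by auto
  ultimately have "hvar G = hvar ?Q + (\<Sum>K\<in>?R. var K)"
    unfolding hvar_def using finite_building by (simp add: sum.union_disjoint)
  then have "var H * hvar G - var H * hvar ?Q = (\<Sum>K\<in>?R. var H * var K)"
    by (simp add: distrib_left sum_distrib_left)
  also have "\<dots> \<in> ideal"
  proof (rule ideal_sum)
    fix K assume K: "K \<in> ?R"
    have "\<not> nst {H, K}" by (rule not_nested_pair[of H K]) (use K G in auto)
    moreover have "H \<noteq> K" using K by auto
    ultimately show "var H * var K \<in> ideal" using nonnested_in_ideal[of "{H, K}"] K G by auto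
  qed
  finally have 1: "var H * hvar G - var H * hvar ?Q \<in> ideal" .
  have "var H * hvar G ^ Suc k - var H * hvar ?Q ^ Suc k =
      hvar G * (var H * hvar G ^ k - var H * hvar ?Q ^ k)
      + hvar ?Q ^ k * (var H * hvar G - var H * hvar ?Q)"
    by (simp add: algebra_simps)
  also have "\<dots> \<in> ideal"
    using Suc 1 by (intro ideal_add ideal_mult poly_ring_power hvar_in_poly_ring)
  finally show ?case .
qed (simp add: ideal_zero)

text \<open>One factor h_G is traded, via the relation at an atom inside G, for variables x_H with H
  not above G. Multiplying by x_H turns the remaining factors into powers of h at the join of G and
  H, where the rank gap is within the smaller exponent.\<close>

lemma prod_hvar_in_ideal:
  assumes "S \<subseteq> \<G>" "\<And>X. X \<in> S \<Longrightarrow> X \<subset> G" "G \<in> \<G>" "rk G \<le> rk (\<Union>S) + d"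
  shows "(\<Prod>X\<in>S. var X) * hvar G ^ d \<in> ideal"
  using assms
proof (induction d arbitrary: S G)
  case 0
  \<comment> \<open>A nested \<open>S\<close> whose union has the rank of \<open>G\<close> would
    have union \<open>G\<close>, and then \<open>G\<close> would lie below one of its members, all
    of which are proper subsets of \<open>G\<close>.\<close>
  have "\<not> nst S"
  proof
    assume n: "nst S"
    have "\<Union>S \<subseteq> G" using 0 by blast
    then have "G = \<Union>S"
      using fl_eq_of_rk[of "\<Union>S" G] nested_comps(2)[OF n subset_refl] building_subset_E[OF 0(3)] 0(4)
      by simp
    then obtain X where "X \<in> S" "G \<subseteq> X" using nested_below_Union[OF n subset_refl 0(3)] by blast
    then show False using 0(2) by blast
  qed
  then show ?case using nonnested_in_ideal 0 by simp
next
  case (Suc d)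
  have US: "\<Union>S \<subseteq> G" using Suc.prems(2) by blast
  have GE: "G \<subseteq> E" using building_subset_E Suc.prems by blast
  show ?case
  proof (cases "rk G \<le> rk (\<Union>S) + d")
    case True
    have "hvar G * ((\<Prod>X\<in>S. var X) * hvar G ^ d) \<in> ideal"
      by (rule ideal_mult[OF Suc.IH[OF Suc.prems(1-3) True] hvar_in_poly_ring])
    then show ?thesis by (simp add: algebra_simps)
  next
    case False
    have SE: "\<Union>S \<subseteq> E" using US GE by blast
    have "\<not> G \<subseteq> cl (\<Union>S)" using False rk_mono[of G "cl (\<Union>S)"] rk_cl[OF SE] by auto
    \<comment> \<open>Any \<open>e\<close> that is independent of the union of \<open>S\<close> will
      do: it has to raise the rank in the submodular estimate for \<open>?Q\<close>.\<close>
    then obtain e where e: "e \<in> G" "e \<notin> cl (\<Union>S)" by blast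
    have eE: "e \<in> E" using e GE by blast
    have eS: "e \<notin> \<Union>S" using subset_cl[OF SE] e by blast
    have re: "rk (insert e (\<Union>S)) = rk (\<Union>S) + 1"
      using e(2) eE rk_insert_le[of e "\<Union>S"] rk_mono[of "\<Union>S" "insert e (\<Union>S)", OF subset_insertI]
      unfolding in_cl_iff by auto
    let ?x = "\<Prod>X\<in>S. var X"
    let ?U = "{H \<in> \<G>. e \<in> H \<and> \<not> G \<subseteq> H}"
    have ce: "cl {e} \<subseteq> H \<longleftrightarrow> e \<in> H" if "H \<in> \<G>" for H
      using cl_subset_iff[OF building_fl[OF that], of "{e}"] eE by simp
    have "{H \<in> \<G>. cl {e} \<subseteq> H} = {H \<in> \<G>. G \<subseteq> H} \<union> ?U" using ce e by auto
    then have "hvar (cl {e}) = hvar G + (\<Sum>H\<in>?U. var H)"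
      unfolding hvar_def using finite_building by (subst sum.union_disjoint[symmetric]) auto
    then have eq: "?x * hvar G ^ Suc d =
        (?x * hvar G ^ d) * hvar (cl {e}) - (\<Sum>H\<in>?U. (?x * hvar G ^ d) * var H)"
      by (simp add: algebra_simps sum_distrib_left)
    have A: "(?x * hvar G ^ d) * var H \<in> ideal" if H: "H \<in> ?U" for H
    proof -
      let ?Q = "cl (G \<union> H)"
      have HE: "G \<union> H \<subseteq> E" using GE building_subset_E H by auto
      have GQ: "G \<subseteq> ?Q" "H \<subseteq> ?Q" using subset_cl[OF HE] by auto
      have Q: "?Q \<in> \<G>" using building_join[of G H] Suc.prems H e by auto
      have HS: "H \<notin> S" using eS H by auto
      have finS: "finite S" using Suc.prems(1) finite_building finite_subset by blast
      \<comment> \<open>The intersection with \<open>G\<close> contains both the old union and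
        \<open>e\<close>, so its rank is one larger than before. This extra 1 pays for the factor
        h_G that was used up.\<close>
      have "rk (\<Union>(insert H S) \<union> G) + rk (\<Union>(insert H S) \<inter> G) \<le> rk (\<Union>(insert H S)) + rk G"
        by (rule rk_submodular)
      moreover have "\<Union>(insert H S) \<union> G = G \<union> H" using US by auto
      moreover have "rk (G \<union> H) = rk ?Q" using rk_cl[OF HE] by simp
      moreover have "rk (insert e (\<Union>S)) \<le> rk (\<Union>(insert H S) \<inter> G)"
        by (rule rk_mono) (use H e US in auto)
      ultimately have rQ: "rk ?Q \<le> rk (\<Union>(insert H S)) + d" using re Suc.prems(4) by simp
      have "(\<Prod>X\<in>insert H S. var X) * hvar ?Q ^ d \<in> ideal"
        by (rule Suc.IH[OF _ _ Q rQ]) (use Suc.prems H GQ in blast)+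
      then have "?x * (var H * hvar ?Q ^ d) \<in> ideal" using HS finS by (simp add: algebra_simps)
      moreover have "?x * (var H * hvar G ^ d - var H * hvar ?Q ^ d) \<in> ideal"
        using Suc.prems H e
        by (intro ideal_mult var_hvar_cong poly_ring_prod poly_ring_var) auto
      ultimately have "?x * (var H * hvar G ^ d - var H * hvar ?Q ^ d) + ?x * (var H * hvar ?Q ^ d) \<in> ideal"
        by (intro ideal_add)
      then show ?thesis by (simp add: algebra_simps)
    qed
    have B: "(?x * hvar G ^ d) * hvar (cl {e}) \<in> ideal"
      using Suc.prems eE
      by (intro ideal_mult hvar_atom_in_ideal poly_ring_mult poly_ring_prod poly_ring_var
          poly_ring_power hvar_in_poly_ring) auto
    show ?thesis unfolding eq by (intro ideal_diff ideal_sum A B)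
  qed
qed

text \<open>The bound on the exponent is written additively to avoid truncated subtraction of
  ranks.\<close>

definition FY :: "('a set \<Rightarrow>\<^sub>0 nat) set" where
  "FY = {m. nst (keys m) \<and>
    (\<forall>G\<in>keys m. lookup m G + rk (below (keys m) G) < rk G)}"

definition FY_deg :: "nat \<Rightarrow> ('a set \<Rightarrow>\<^sub>0 nat) set" where
  "FY_deg i = {m \<in> FY. mdeg m = i}"

lemma FY_keys: "m \<in> FY \<Longrightarrow> keys m \<subseteq> \<G>"
  unfolding FY_def using nested_subset_building by auto

lemma finite_FY_deg: "finite (FY_deg i)"
  by (rule finite_subset[OF _ finite_monomials[OF finite_building, of i]])
    (use FY_keys in \<open>auto simp: FY_deg_def\<close>)

text \<open>Measured in elements, not in rank. It decreases strictly along proper inclusion, and so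
  serves as a weight of variables and as a termination measure.\<close>

abbreviation codim :: "'a set \<Rightarrow> nat" where "codim G \<equiv> card E - card G"

lemma codim_less: "G \<subset> H \<Longrightarrow> H \<subseteq> E \<Longrightarrow> codim H < codim G"
  using psubset_card_mono[of H G] card_mono[OF finite_E, of H] finite_subset[OF _ finite_E, of H]
  by auto

text \<open>Monomials of degree \<open>j\<close> no heavier than the \<open>j\<close>-th power of
  x_G; the monomials of h_G to the power \<open>j\<close> are of this kind.\<close>

definition light :: "'a set \<Rightarrow> nat \<Rightarrow> ('a set \<Rightarrow>\<^sub>0 nat) set" where
  "light G j = {m. keys m \<subseteq> \<G> \<and> mdeg m = j \<and> wt codim m \<le> j * codim G}"

lemma light_add: "m \<in> light G j \<Longrightarrow> n \<in> light G k \<Longrightarrow> m + n \<in> light G (j + k)"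
  unfolding light_def by (auto simp: keys_add_nat mdeg_add wt_add add_mult_distrib intro: add_mono)

lemma supported_light_mult:
  "p \<in> supported (light G j) \<Longrightarrow> q \<in> supported (light G k) \<Longrightarrow> p * q \<in> supported (light G (j + k))"
  by (rule supported_mult[where M = "light G j" and N = "light G k"]) (auto intro: light_add)

lemma light_power: "p \<in> supported (light G 1) \<Longrightarrow> p ^ j \<in> supported (light G j)"
proof (induction j)
  case 0
  show ?case unfolding supported_def by (auto simp: light_def mdeg_def)
next
  case (Suc j)
  show ?case
    using supported_light_mult[OF Suc.prems Suc.IH[OF Suc.prems]] by simp
qed

lemma hvar_light: "G \<in> \<G> \<Longrightarrow> hvar G \<in> supported (light G 1)"
  unfolding hvar_def var_def
proof (intro supported_sum supported_single)
  fix H assume H: "G \<in> \<G>" "H \<in> {H \<in> \<G>. G \<subseteq> H}"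
  then have "codim H \<le> codim G"
    using card_mono[of H G] finite_subset[OF building_subset_E finite_E] by (auto intro: diff_le_mono2)
  then show "single H 1 \<in> light G 1"
    using H unfolding light_def by (simp add: mdeg_wt)
qed

text \<open>The difference of powers has the factor h_G - x_G, whose variables belong to larger sets
  and are strictly lighter than x_G. The cofactor consists of monomials at most as heavy as the
  corresponding power of x_G.\<close>

lemma hvar_power_diff:
  assumes G: "G \<in> \<G>" and e: "0 < e"
  shows "hvar G ^ e - var G ^ e \<in>
    supported {m. keys m \<subseteq> \<G> \<and> mdeg m = e \<and> wt codim m < e * codim G}"
proof -
  let ?strict = "{m. keys m \<subseteq> \<G> \<and> mdeg m = 1 \<and> wt codim m < codim G}"
  have "{H \<in> \<G>. G \<subseteq> H} = insert G {H \<in> \<G>. G \<subset> H}" using G by auto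
  then have "hvar G - var G = (\<Sum>H\<in>{H \<in> \<G>. G \<subset> H}. var H)"
    unfolding hvar_def using finite_building by simp
  also have "\<dots> \<in> supported ?strict"
    unfolding var_def
  proof (intro supported_sum supported_single)
    fix H assume "H \<in> {H \<in> \<G>. G \<subset> H}"
    then show "single H 1 \<in> ?strict"
      using codim_less[of G H] building_subset_E by (simp add: mdeg_wt)
  qed
  finally have 1: "hvar G - var G \<in> supported ?strict" .
  have v: "var G \<in> supported (light G 1)"
    unfolding var_def by (rule supported_single) (use G in \<open>simp add: light_def mdeg_wt\<close>)
  have "(\<Sum>i<e. var G ^ (e - Suc i) * hvar G ^ i) \<in> supported (light G (e - 1))"
  proof (rule supported_sum)
    fix i assume "i \<in> {..<e}"
    then have "e - Suc i + i = e - 1" by auto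
    then show "var G ^ (e - Suc i) * hvar G ^ i \<in> supported (light G (e - 1))"
      using supported_light_mult[OF light_power[OF v] light_power[OF hvar_light[OF G]],
          of "e - Suc i" i] by simp
  qed
  then have "(hvar G - var G) * (\<Sum>i<e. var G ^ (e - Suc i) * hvar G ^ i) \<in>
      supported {m. keys m \<subseteq> \<G> \<and> mdeg m = e \<and> wt codim m < e * codim G}"
  proof (rule supported_mult[OF 1])
    fix m n assume mn: "m \<in> ?strict" "n \<in> light G (e - 1)"
    obtain e' where e': "e = Suc e'" using e by (cases e) auto
    show "m + n \<in> {m. keys m \<subseteq> \<G> \<and> mdeg m = e \<and> wt codim m < e * codim G}"
      using mn unfolding light_def e' by (auto simp: keys_add_nat mdeg_add wt_add)
  qed
  then show ?thesis by (simp add: power_diff_sumr2)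
qed

abbreviation PD where "PD \<equiv> poly_ring_deg \<G>"

text \<open>Straightening by induction on the weight. If the exponent at some \<open>G\<close> is
  too large, that power of x_G is replaced by the power of h_G, which yields an element of the
  ideal, at the cost of lighter monomials of the same degree.\<close>

lemma monomial_in_span:
  assumes "keys m \<subseteq> \<G>" "mdeg m = i"
  shows "single m 1 \<in>
    cpoly.span ((ideal \<inter> PD i) \<union> (\<lambda>m. single m 1) ` FY_deg i)" (is "_ \<in> ?sp")
  using assms
proof (induction "wt codim m" arbitrary: m rule: less_induct)
  case less
  let ?S = "keys m"
  let ?l = "lookup m"
  have mPD: "single m 1 \<in> PD i"
    unfolding poly_ring_deg_supported using less.prems by (intro supported_single) auto
  have expand: "single m 1 = (\<Prod>X\<in>?S. var X ^ ?l X)"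
    unfolding mon_var[symmetric] mon_def ..
  have split1: "(\<Prod>X\<in>A. var X ^ ?l X) = (\<Prod>X\<in>A. var X) * (\<Prod>X\<in>A. var X ^ (?l X - 1))"
    if "A \<subseteq> ?S" for A
  proof -
    have "var X ^ ?l X = var X * var X ^ (?l X - 1)" if "X \<in> A" for X
      using that \<open>A \<subseteq> ?S\<close> by (cases "?l X") (auto simp: in_keys_iff)
    then show ?thesis by (simp add: prod.distrib[symmetric])
  qed
  show ?case
  proof (cases "nst ?S")
    case False
    have "(\<Prod>X\<in>?S. var X) * (\<Prod>X\<in>?S. var X ^ (?l X - 1)) \<in> ideal"
      using nonnested_in_ideal[OF less.prems(1) False] less.prems(1)
      by (intro ideal_mult_right poly_ring_prod poly_ring_power poly_ring_var) auto
    then have "single m 1 \<in> ideal" using expand split1[of ?S] by simp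
    then show ?thesis using mPD by (intro cpoly.span_base) auto
  next
    case True
    show ?thesis
    proof (cases "m \<in> FY")
      case True
      then show ?thesis using less.prems by (intro cpoly.span_base) (auto simp: FY_deg_def)
    next
      case False
      then obtain G where G: "G \<in> ?S" "rk G \<le> ?l G + rk (below ?S G)"
        unfolding FY_def using True by (auto simp: not_less)
      have GG: "G \<in> \<G>" using G less.prems by auto
      let ?L = "{X \<in> ?S. X \<subset> G}"
      define n where "n = (\<Sum>X\<in>?S - {G}. single X (?l X))"
      let ?q = "single n (1::rat)"
      \<comment> \<open>One factor of every variable below \<open>G\<close> is split off, so that
        \<open>prod_hvar_in_ideal\<close> applies; \<open>?R\<close> is what remains.\<close>
      let ?R = "(\<Prod>X\<in>?L. var X ^ (?l X - 1)) * (\<Prod>X\<in>?S - {G} - ?L. var X ^ ?l X)"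
      have mn: "m = single G (?l G) + n"
        using sum_monomials[of m] sum.remove[of ?S G "\<lambda>X. single X (?l X)"] G(1) unfolding n_def by simp
      have q: "?q = (\<Prod>X\<in>?S - {G}. var X ^ ?l X)"
        unfolding n_def var_power prod_single ..
      have "?q = (\<Prod>X\<in>?L. var X ^ ?l X) * (\<Prod>X\<in>?S - {G} - ?L. var X ^ ?l X)"
        unfolding q by (subst prod.subset_diff[of ?L]) (auto simp: mult.commute)
      then have qLR: "?q = (\<Prod>X\<in>?L. var X) * ?R"
        using split1[of ?L] by (simp add: mult.assoc)
      have "?q * hvar G ^ ?l G = ((\<Prod>X\<in>?L. var X) * hvar G ^ ?l G) * ?R"
        unfolding qLR by (simp add: algebra_simps)
      also have "\<dots> \<in> ideal"
      proof (rule ideal_mult_right)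
        show "(\<Prod>X\<in>?L. var X) * hvar G ^ ?l G \<in> ideal"
          by (rule prod_hvar_in_ideal) (use G less.prems in \<open>auto simp: below_def add.commute\<close>)
        show "?R \<in> poly_ring \<G>"
          using less.prems(1)
          by (intro poly_ring_mult poly_ring_prod poly_ring_power poly_ring_var) auto
      qed
      finally have qi: "?q * hvar G ^ ?l G \<in> ideal" .
      have kn: "keys n \<subseteq> \<G>"
        using less.prems(1) arg_cong[OF mn, of keys] by (simp add: keys_add_nat)
      have dm: "mdeg n + ?l G = i"
        using less.prems(2) arg_cong[OF mn, of mdeg] by (simp add: mdeg_wt wt_add)
      have wm: "wt codim m = ?l G * codim G + wt codim n"
        using arg_cong[OF mn, of "wt codim"] by (simp add: wt_add)
      have "?q * hvar G ^ ?l G \<in> PD i"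
        unfolding poly_ring_deg_supported
        by (rule supported_mult[OF supported_single[of n "{n}"] light_power[OF hvar_light[OF GG]]])
          (use kn dm in \<open>auto simp: light_def keys_add_nat mdeg_add\<close>)
      then have A: "?q * hvar G ^ ?l G \<in> ?sp" using qi by (intro cpoly.span_base) auto
      let ?M = "{m'. keys m' \<subseteq> \<G> \<and> mdeg m' = i \<and> wt codim m' < wt codim m}"
      have "?l G > 0" using G by (simp add: in_keys_iff)
      then have "?q * (hvar G ^ ?l G - var G ^ ?l G) \<in> supported ?M"
        by (intro supported_mult[OF supported_single[of n "{n}"] hvar_power_diff[OF GG]])
          (use kn dm wm in \<open>auto simp: keys_add_nat mdeg_add wt_add\<close>)
      then have "?q * (hvar G ^ ?l G - var G ^ ?l G) \<in>
          cpoly.span ((\<lambda>m. single m 1) ` ?M)"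
        using supported_subset_span by blast
      also have "\<dots> \<subseteq> ?sp"
        using less.hyps by (intro cpoly.span_minimal cpoly.subspace_span) auto
      finally have B: "?q * (hvar G ^ ?l G - var G ^ ?l G) \<in> ?sp" .
      have "single m 1 = ?q * var G ^ ?l G"
        using arg_cong[OF mn, of "\<lambda>m. single m (1::rat)"]
        by (simp add: var_power mult_single add.commute)
      also have "\<dots> = ?q * hvar G ^ ?l G - ?q * (hvar G ^ ?l G - var G ^ ?l G)"
        by (simp add: algebra_simps)
      also have "\<dots> \<in> ?sp" using A B by (rule cpoly.span_diff)
      finally show ?thesis .
    qed
  qed
qed

lemma PD_subset_span:
  "PD i \<subseteq> cpoly.span ((ideal \<inter> PD i) \<union> (\<lambda>m. single m 1) ` FY_deg i)"
proof -
  have "PD i \<subseteq> cpoly.span ((\<lambda>m. single m 1) ` {m. keys m \<subseteq> \<G> \<and> mdeg m = i})"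
    unfolding poly_ring_deg_supported by (rule supported_subset_span)
  also have "\<dots> \<subseteq> cpoly.span ((ideal \<inter> PD i) \<union> (\<lambda>m. single m 1) ` FY_deg i)"
    using monomial_in_span by (intro cpoly.span_minimal cpoly.subspace_span) auto
  finally show ?thesis .
qed

end

section \<open>Functionals on the Chow ring\<close>

text \<open>Inclusion-exclusion for indicators. If \<open>C\<close> and \<open>P\<close> hold then
  so do \<open>k\<close> and the disjunction of \<open>f\<close> and \<open>g\<close>, and the
  identity is [f and g] + 1 = [f] + [g]. Otherwise every term vanishes.\<close>

lemma of_bool_exchange:
  assumes "f \<longrightarrow> P" "g \<longrightarrow> P" "k \<longrightarrow> P" "C \<and> P \<longrightarrow> k" "C \<and> P \<longrightarrow> f \<or> g"
  shows "of_bool (R \<and> f \<and> g \<and> C) + of_bool (R \<and> k \<and> k \<and> C) =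
    of_bool (R \<and> f \<and> k \<and> C) + (of_bool (R \<and> g \<and> k \<and> C) :: rat)"
  using assms by (cases P; cases C; cases R; cases f; cases g; cases k; simp)

context built_matroid
begin

text \<open>From here on \<open>var F\<close> stands for the variable h_F of the maximal building
  set. Mobius inversion over the flats recovers the corresponding x_F.\<close>

function moeb :: "'a set \<Rightarrow> 'a cpoly" where
  "moeb F = var F - (\<Sum>F'\<in>{F'. fl F' \<and> F \<subset> F'}. moeb F')"
  by pat_completeness auto
termination by (relation "measure codim") (simp_all add: codim_less fl_subset_E)

declare moeb.simps [simp del]

lemma moeb_sum: "fl F \<Longrightarrow> (\<Sum>F'\<in>{F'. fl F' \<and> F \<subseteq> F'}. moeb F') = var F"
proof -
  assume F: "fl F"
  have "{F'. fl F' \<and> F \<subseteq> F'} = insert F {F'. fl F' \<and> F \<subset> F'}" using F by auto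
  moreover have "finite {F'. fl F' \<and> F \<subset> F'}" by (rule finite_subset[OF _ finite_flats]) auto
  ultimately show ?thesis by (simp add: moeb.simps[of F])
qed

text \<open>The image of a generator under the inclusion of the Chow ring into the Chow ring of the
  maximal building set.\<close>
definition pull :: "'a set \<Rightarrow> 'a cpoly" where
  "pull G = (\<Sum>F\<in>{F. fl F \<and> G \<in> comps F}. moeb F)"

text \<open>A flat above \<open>G\<close> has exactly one component above \<open>G\<close>, since
  components are disjoint. So the sums over H reassemble into the sum of \<open>moeb\<close> over
  all flats above \<open>G\<close>.\<close>

lemma pull_sum:
  assumes G: "G \<in> \<G>"
  shows "(\<Sum>H\<in>{H \<in> \<G>. G \<subseteq> H}. pull H) = var G"
proof -
  let ?B = "{H \<in> \<G>. G \<subseteq> H}"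
  let ?A = "\<lambda>H. {F. fl F \<and> H \<in> comps F}"
  have "(\<Sum>H\<in>?B. pull H) = (\<Sum>F\<in>(\<Union>H\<in>?B. ?A H). moeb F)"
    unfolding pull_def
  proof (rule sum.UNION_disjoint[symmetric])
    show "finite ?B" using finite_building by simp
    show "\<forall>i\<in>?B. finite (?A i)" by (auto intro: finite_subset[OF _ finite_flats])
    show "\<forall>i\<in>?B. \<forall>j\<in>?B. i \<noteq> j \<longrightarrow> ?A i \<inter> ?A j = {}"
      using comps_disjoint building_nonempty[OF G] by blast
  qed
  also have "(\<Union>H\<in>?B. ?A H) = {F. fl F \<and> G \<subseteq> F}"
  proof (intro set_eqI iffI)
    fix F assume "F \<in> (\<Union>H\<in>?B. ?A H)"
    then show "F \<in> {F. fl F \<and> G \<subseteq> F}" using compsD(2) by blast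
  next
    fix F assume F: "F \<in> {F. fl F \<and> G \<subseteq> F}"
    then obtain C where "C \<in> comps F" "G \<subseteq> C" using in_comps_above[OF G] by blast
    then show "F \<in> (\<Union>H\<in>?B. ?A H)" using F compsD(1)[of C F] by blast
  qed
  finally show ?thesis using moeb_sum[OF building_fl[OF G]] by simp
qed

lemma subst_pull_hvar: "G \<in> \<G> \<Longrightarrow> subst pull (hvar G) = var G"
  unfolding hvar_def by (simp add: subst_sum pull_sum)

lemma subst_pull_mon_hvar:
  assumes "keys m \<subseteq> \<G>"
  shows "subst pull (mon hvar m) = single m 1"
proof -
  have "mon (\<lambda>G. subst pull (hvar G)) m = mon var m"
    unfolding mon_def by (rule prod.cong) (use assms subst_pull_hvar in auto)
  then show ?thesis by (simp add: subst_mon mon_var)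
qed

end

text \<open>For a chain of flats F(0) = {} < F(1) < ... < F(k), this is the product over the intervals
  [F(i), F(i+1)] of the degree functionals in the h-variables, where a monomial has degree one if
  its variables satisfy a dragon marriage condition and zero otherwise. The multiplicities c
  prescribe the degree in each interval; the missing factors are powers of the top element of the
  interval.\<close>
locale flag_functional = built_matroid +
  fixes Fl :: "nat \<Rightarrow> 'a set" and k :: nat and c :: "nat \<Rightarrow> nat"
  assumes Fl_fl: "fl (Fl i)" and Fl_mono: "i \<le> j \<Longrightarrow> Fl i \<subseteq> Fl j" and Fl_0: "Fl 0 = {}"
begin

text \<open>The nonempty flats below \<open>Fl k\<close> are distributed over the levels 0 to
  \<open>k\<close> - 1. The variable of a flat is counted in the interval above \<open>Fl i\<close>,
  where only its join with \<open>Fl i\<close> matters for ranks.\<close>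

definition level :: "nat \<Rightarrow> 'a set set" where
  "level i = {H. fl H \<and> H \<subseteq> Fl (Suc i) \<and> \<not> H \<subseteq> Fl i}"

definition mass :: "('a set \<Rightarrow>\<^sub>0 nat) \<Rightarrow> 'a set set \<Rightarrow> nat" where
  "mass m U = (\<Sum>H\<in>U. lookup m H)"

text \<open>A Hall condition with one unit to spare: in the contraction by \<open>Fl i\<close>, the
  rank of a nonempty family must exceed its total multiplicity.\<close>

definition dragon :: "nat \<Rightarrow> ('a set \<Rightarrow>\<^sub>0 nat) \<Rightarrow> bool" where
  "dragon i m \<longleftrightarrow> (\<forall>U\<subseteq>level i. U \<noteq> {} \<longrightarrow> rk (Fl i) + 1 + mass m U \<le> rk (Fl i \<union> \<Union>U))"

lemma dragonD: "dragon i m \<Longrightarrow> U \<subseteq> level i \<Longrightarrow> U \<noteq> {} \<Longrightarrow> rk (Fl i) + 1 + mass m U \<le> rk (Fl i \<union> \<Union>U)"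
  unfolding dragon_def by simp

definition good :: "nat \<Rightarrow> ('a set \<Rightarrow>\<^sub>0 nat) \<Rightarrow> bool" where
  "good i m \<longleftrightarrow> mass m (level i) = c i \<and> dragon i m"

definition flag_wt :: "('a set \<Rightarrow>\<^sub>0 nat) \<Rightarrow> rat" where
  "flag_wt m = of_bool ((\<forall>H\<in>keys m. H \<subseteq> Fl k) \<and> (\<forall>i<k. good i m))"

abbreviation one_var :: "'a set \<Rightarrow> 'a set \<Rightarrow>\<^sub>0 nat" where
  "one_var A \<equiv> single A (Suc 0)"

lemma finite_level: "finite (level i)"
  by (rule finite_subset[OF _ finite_flats]) (auto simp: level_def)

lemma level_exists:
  assumes "fl H" "H \<noteq> {}" "H \<subseteq> Fl k"
  obtains i where "i < k" "H \<in> level i"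
proof -
  define j where "j = (LEAST j. H \<subseteq> Fl j)"
  have j: "H \<subseteq> Fl j" "j \<le> k" unfolding j_def using assms(3) by (rule LeastI, rule Least_le)
  have "j \<noteq> 0" using j(1) Fl_0 assms(2) by (intro notI) simp
  then obtain i where i: "j = Suc i" by (cases j) auto
  have "\<not> H \<subseteq> Fl i" using not_less_Least[of i "\<lambda>j. H \<subseteq> Fl j"] i unfolding j_def by simp
  then show thesis using that[of i] i j assms(1) unfolding level_def by auto
qed

lemma level_unique: assumes "H \<in> level i" "H \<in> level j" shows "i = j"
proof -
  have *: "\<not> i < j" if "H \<in> level i" "H \<in> level j" for i j
  proof
    assume "i < j"
    then have "H \<subseteq> Fl j" using that(1) Fl_mono[of "Suc i" j] unfolding level_def by auto
    then show False using that(2) unfolding level_def by blast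
  qed
  show ?thesis using *[OF assms] *[OF assms(2,1)] by linarith
qed

lemma level_subset_E: "U \<subseteq> level i \<Longrightarrow> \<Union>U \<subseteq> E"
  unfolding level_def using fl_subset_E by blast

lemma mass_add: "finite U \<Longrightarrow> mass (m + one_var A) U = mass m U + (if A \<in> U then 1 else 0)"
  unfolding mass_def by (simp add: lookup_add sum.distrib lookup_single when_def)

lemma finite_level_subset: "U \<subseteq> level i \<Longrightarrow> finite U"
  using finite_level finite_subset by blast

lemma good_add_other: "A \<notin> level i \<Longrightarrow> good i (m + one_var A) = good i m"
proof -
  assume A: "A \<notin> level i"
  have "mass (m + one_var A) U = mass m U" if "U \<subseteq> level i" for U
    using mass_add[OF finite_level_subset[OF that]] A that by auto
  then show ?thesis unfolding good_def dragon_def by auto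
qed

lemma mass_mono: "finite V \<Longrightarrow> U \<subseteq> V \<Longrightarrow> mass m U \<le> mass m V"
  unfolding mass_def by (rule sum_mono2) auto

text \<open>Only families containing \<open>A\<close> feel the new variable. Here \<open>A\<close>
  enters on the rank side for every \<open>U\<close>, including the empty one, so the extra
  condition depends on \<open>A\<close> only through the closure of \<open>Fl i\<close> with
  \<open>A\<close>.\<close>

lemma dragon_add:
  assumes A: "A \<in> level i"
  shows "dragon i (m + one_var A) \<longleftrightarrow>
    dragon i m \<and> (\<forall>U\<subseteq>level i. rk (Fl i) + 2 + mass m U \<le> rk (Fl i \<union> A \<union> \<Union>U))" (is "?l \<longleftrightarrow> _ \<and> ?r")
proof (intro iffI conjI)
  assume l: ?l
  show "dragon i m"
    unfolding dragon_def
  proof (intro allI impI)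
    fix U assume U: "U \<subseteq> level i" "U \<noteq> {}"
    have "mass m U \<le> mass (m + one_var A) U" using mass_add[OF finite_level_subset[OF U(1)]] by simp
    moreover have "rk (Fl i) + 1 + mass (m + one_var A) U \<le> rk (Fl i \<union> \<Union>U)"
      using dragonD l U by blast
    ultimately show "rk (Fl i) + 1 + mass m U \<le> rk (Fl i \<union> \<Union>U)" by linarith
  qed
  show ?r
  proof (intro allI impI)
    fix U assume U: "U \<subseteq> level i"
    have AU: "insert A U \<subseteq> level i" "insert A U \<noteq> {}" using A U by auto
    have fin: "finite (insert A U)" using finite_level_subset[OF AU(1)] .
    have "rk (Fl i) + 1 + mass (m + one_var A) (insert A U) \<le> rk (Fl i \<union> \<Union>(insert A U))"
      using dragonD[OF l AU] .
    moreover have "mass (m + one_var A) (insert A U) = mass m (insert A U) + 1"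
      using mass_add[OF fin] by simp
    moreover have "mass m U \<le> mass m (insert A U)" using mass_mono[OF fin] by auto
    moreover have "Fl i \<union> \<Union>(insert A U) = Fl i \<union> A \<union> \<Union>U" by auto
    ultimately show "rk (Fl i) + 2 + mass m U \<le> rk (Fl i \<union> A \<union> \<Union>U)" by simp
  qed
next
  assume r: "dragon i m \<and> ?r"
  show ?l
    unfolding dragon_def
  proof (intro allI impI)
    fix U assume U: "U \<subseteq> level i" "U \<noteq> {}"
    show "rk (Fl i) + 1 + mass (m + one_var A) U \<le> rk (Fl i \<union> \<Union>U)"
    proof (cases "A \<in> U")
      case True
      then have "Fl i \<union> A \<union> \<Union>U = Fl i \<union> \<Union>U" by blast
      moreover have "rk (Fl i) + 2 + mass m U \<le> rk (Fl i \<union> A \<union> \<Union>U)" using r U by blast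
      ultimately show ?thesis using True mass_add[OF finite_level_subset[OF U(1)], of m A] by simp
    next
      case False
      then show ?thesis
        using r U mass_add[OF finite_level_subset[OF U(1)], of m A] dragonD[of i m U] by auto
    qed
  qed
qed

text \<open>The third condition sees \<open>A\<close> and \<open>B\<close> only through their join.
  It is therefore the same for all four pairs that occur in the exchange relation.\<close>

lemma dragon_add2:
  assumes A: "A \<in> level i" and B: "B \<in> level i"
  shows "dragon i (m + one_var A + one_var B) \<longleftrightarrow> dragon i (m + one_var A) \<and> dragon i (m + one_var B) \<and>
    (\<forall>U\<subseteq>level i. rk (Fl i) + 3 + mass m U \<le> rk (Fl i \<union> (A \<union> B) \<union> \<Union>U))" (is "_ \<longleftrightarrow> _ \<and> _ \<and> ?r")
proof -
  let ?f = "\<forall>U\<subseteq>level i. rk (Fl i) + 2 + mass m U \<le> rk (Fl i \<union> B \<union> \<Union>U)"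
  let ?g = "\<forall>U\<subseteq>level i. rk (Fl i) + 2 + mass (m + one_var A) U \<le> rk (Fl i \<union> B \<union> \<Union>U)"
  have "?g \<longleftrightarrow> ?f \<and> ?r"
  proof (intro iffI conjI allI impI)
    fix U assume g: ?g and U: "U \<subseteq> level i"
    have "mass m U \<le> mass (m + one_var A) U" using mass_add[OF finite_level_subset[OF U]] by simp
    moreover have "rk (Fl i) + 2 + mass (m + one_var A) U \<le> rk (Fl i \<union> B \<union> \<Union>U)" using g U by blast
    ultimately show "rk (Fl i) + 2 + mass m U \<le> rk (Fl i \<union> B \<union> \<Union>U)" by linarith
  next
    fix U assume g: ?g and U: "U \<subseteq> level i"
    have AU: "insert A U \<subseteq> level i" using A U by auto
    have fin: "finite (insert A U)" using finite_level_subset[OF AU] .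
    have "rk (Fl i) + 2 + mass (m + one_var A) (insert A U) \<le> rk (Fl i \<union> B \<union> \<Union>(insert A U))"
      using g AU by blast
    moreover have "mass (m + one_var A) (insert A U) = mass m (insert A U) + 1"
      using mass_add[OF fin] by simp
    moreover have "mass m U \<le> mass m (insert A U)" using mass_mono[OF fin] by auto
    moreover have "Fl i \<union> B \<union> \<Union>(insert A U) = Fl i \<union> (A \<union> B) \<union> \<Union>U" by auto
    ultimately show "rk (Fl i) + 3 + mass m U \<le> rk (Fl i \<union> (A \<union> B) \<union> \<Union>U)" by simp
  next
    fix U assume fr: "?f \<and> ?r" and U: "U \<subseteq> level i"
    show "rk (Fl i) + 2 + mass (m + one_var A) U \<le> rk (Fl i \<union> B \<union> \<Union>U)"
    proof (cases "A \<in> U")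
      case True
      then have "Fl i \<union> (A \<union> B) \<union> \<Union>U = Fl i \<union> B \<union> \<Union>U" by blast
      moreover have "rk (Fl i) + 3 + mass m U \<le> rk (Fl i \<union> (A \<union> B) \<union> \<Union>U)" using fr U by blast
      ultimately show ?thesis using True mass_add[OF finite_level_subset[OF U], of m A] by simp
    next
      case False
      then show ?thesis using fr U mass_add[OF finite_level_subset[OF U], of m A] by auto
    qed
  qed
  moreover have "dragon i (m + one_var A) \<Longrightarrow> dragon i m" using dragon_add[OF A] by blast
  ultimately show ?thesis
    unfolding dragon_add[OF B, of "m + one_var A"] dragon_add[OF B, of m] by blast
qed

lemma level_join:
  assumes "F \<in> level i" "G \<in> level j" "i \<le> j"
  shows "cl (F \<union> G) \<in> level j"
proof -
  have FG: "F \<union> G \<subseteq> E" using assms fl_subset_E unfolding level_def by blast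
  have "F \<union> G \<subseteq> Fl (Suc j)" using assms Fl_mono[of "Suc i" "Suc j"] unfolding level_def by auto
  then have "cl (F \<union> G) \<subseteq> Fl (Suc j)" using cl_least[OF Fl_fl] by blast
  moreover have "\<not> cl (F \<union> G) \<subseteq> Fl j"
    using cl_subset_iff[OF Fl_fl FG] assms unfolding level_def by auto
  ultimately show ?thesis using fl_cl[OF FG] unfolding level_def by auto
qed

lemma rk_cl_cong: "X \<subseteq> E \<Longrightarrow> Y \<subseteq> E \<Longrightarrow> Z \<subseteq> E \<Longrightarrow> cl X = cl Y \<Longrightarrow> rk (X \<union> Z) = rk (Y \<union> Z)"
  by (intro rk_eq_of_cl) (simp_all add: cl_Un_cl[symmetric, of X Z] cl_Un_cl[symmetric, of Y Z])

text \<open>The condition in \<open>dragon_add\<close> involves the new variable only through ranks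
  of unions with \<open>Fl i\<close>, and these depend on the closure alone.\<close>

lemma good_add_cong:
  assumes "G \<in> level i" "K \<in> level i" "cl (Fl i \<union> G) = cl (Fl i \<union> K)"
  shows "good i (m + one_var G) \<longleftrightarrow> good i (m + one_var K)"
proof -
  have GK: "Fl i \<union> G \<subseteq> E" "Fl i \<union> K \<subseteq> E"
    using assms fl_subset_E[OF Fl_fl] fl_subset_E unfolding level_def by auto
  have "rk (Fl i \<union> G \<union> \<Union>U) = rk (Fl i \<union> K \<union> \<Union>U)" if "U \<subseteq> level i" for U
    using rk_cl_cong[OF GK level_subset_E[OF that] assms(3)] .
  then have "dragon i (m + one_var G) \<longleftrightarrow> dragon i (m + one_var K)"
    unfolding dragon_add[OF assms(1)] dragon_add[OF assms(2)] by auto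
  then show ?thesis
    unfolding good_def mass_add[OF finite_level] using assms by simp
qed

text \<open>If both extensions failed, submodularity would contradict the condition for the join.\<close>
lemma dragon_exchange:
  assumes FG: "F \<in> level i" "G \<in> level i" and d: "dragon i m"
    and C: "\<And>U. U \<subseteq> level i \<Longrightarrow> rk (Fl i) + 3 + mass m U \<le> rk (Fl i \<union> (F \<union> G) \<union> \<Union>U)"
  shows "dragon i (m + one_var F) \<or> dragon i (m + one_var G)"
proof (rule ccontr)
  assume "\<not> ?thesis"
  then obtain U V where U: "U \<subseteq> level i" "rk (Fl i \<union> F \<union> \<Union>U) \<le> rk (Fl i) + 1 + mass m U"
    and V: "V \<subseteq> level i" "rk (Fl i \<union> G \<union> \<Union>V) \<le> rk (Fl i) + 1 + mass m V"
    using d unfolding dragon_add[OF FG(1)] dragon_add[OF FG(2)] not_le not_all not_imp de_Morgan_conj de_Morgan_disj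
    by (auto simp: not_le)
  let ?X = "Fl i \<union> F \<union> \<Union>U" and ?Y = "Fl i \<union> G \<union> \<Union>V"
  have fin: "finite U" "finite V" using U V finite_level_subset by auto
  have "?X \<union> ?Y = Fl i \<union> (F \<union> G) \<union> \<Union>(U \<union> V)" by auto
  then have "rk (Fl i \<union> (F \<union> G) \<union> \<Union>(U \<union> V)) + rk (?X \<inter> ?Y) \<le> rk ?X + rk ?Y"
    using rk_submodular[of ?X ?Y] by simp
  moreover have "rk (Fl i) + 3 + mass m (U \<union> V) \<le> rk (Fl i \<union> (F \<union> G) \<union> \<Union>(U \<union> V))"
    using C[of "U \<union> V"] U V by simp
  moreover have "mass m (U \<union> V) + mass m (U \<inter> V) = mass m U + mass m V"
    unfolding mass_def using sum.union_inter[OF fin] .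
  moreover have "rk (Fl i) + mass m (U \<inter> V) \<le> rk (?X \<inter> ?Y)"
  proof (cases "U \<inter> V = {}")
    case True
    then show ?thesis using rk_mono[of "Fl i" "?X \<inter> ?Y"] by (auto simp: mass_def)
  next
    case False
    then have "rk (Fl i) + 1 + mass m (U \<inter> V) \<le> rk (Fl i \<union> \<Union>(U \<inter> V))"
      using U by (intro dragonD[OF d]) auto
    also have "\<dots> \<le> rk (?X \<inter> ?Y)" by (rule rk_mono) auto
    finally show ?thesis by simp
  qed
  ultimately show False using U V by linarith
qed

section \<open>The relations in the h-variables\<close>

lemma keys_add_one: "keys (m + one_var A) = insert A (keys m)"
  by (auto simp: keys_add_nat)

lemma flag_wt_outside: "H \<in> keys m \<Longrightarrow> \<not> H \<subseteq> Fl k \<Longrightarrow> flag_wt m = 0"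
  unfolding flag_wt_def by auto

lemma flag_wt_atom:
  assumes a: "atom E indep a"
  shows "flag_wt (m + one_var a) = 0"
proof (cases "a \<subseteq> Fl k")
  case False
  then show ?thesis by (intro flag_wt_outside[of a]) (auto simp: keys_add_one)
next
  case True
  have "fl a" "a \<noteq> {}" using a unfolding atom_def by simp_all
  then obtain i where i: "i < k" "a \<in> level i" by (rule level_exists[OF _ _ True])
  \<comment> \<open>The empty family already violates \<open>dragon_add\<close>: an atom adds at
    most 1 to the rank where 2 is required.\<close>
  have "rk (Fl i \<union> a \<union> \<Union>{}) \<le> rk (Fl i) + 1"
    using rk_Un_le[of "Fl i" a] atom_rk[OF a] by simp
  then have "\<not> dragon i (m + one_var a)"
    unfolding dragon_add[OF i(2)] by (auto intro!: exI[of _ "{}"])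
  then show ?thesis using i unfolding flag_wt_def good_def by auto
qed

lemma flag_wt_cong:
  assumes "keys m - {G, K} = keys m' - {G, K}" "G \<subseteq> Fl k" "K \<subseteq> Fl k"
    and "\<And>i. i < k \<Longrightarrow> good i m \<longleftrightarrow> good i m'"
  shows "flag_wt m = flag_wt m'"
proof -
  have "(\<forall>H\<in>keys m. H \<subseteq> Fl k) \<longleftrightarrow> (\<forall>H\<in>keys m - {G, K}. H \<subseteq> Fl k)"
    "(\<forall>H\<in>keys m'. H \<subseteq> Fl k) \<longleftrightarrow> (\<forall>H\<in>keys m' - {G, K}. H \<subseteq> Fl k)"
    using assms(2,3) by auto
  then have "(\<forall>H\<in>keys m. H \<subseteq> Fl k) \<longleftrightarrow> (\<forall>H\<in>keys m'. H \<subseteq> Fl k)"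
    unfolding assms(1) by simp
  then show ?thesis unfolding flag_wt_def using assms(4) by auto
qed

text \<open>A flat of a lower level is contained in \<open>Fl j\<close>, so \<open>G\<close> and its
  join with \<open>F\<close> become equal after joining with \<open>Fl j\<close>.\<close>

lemma flag_wt_swap:
  assumes F: "F \<in> level i" and G: "G \<in> level j" and ij: "i < j" "j < k"
  shows "flag_wt (m + one_var G) = flag_wt (m + one_var (cl (F \<union> G)))"
proof -
  let ?K = "cl (F \<union> G)"
  have K: "?K \<in> level j" using level_join[OF F G] ij by simp
  have FE: "F \<subseteq> E" "G \<subseteq> E" "Fl j \<subseteq> E"
    using F G fl_subset_E Fl_fl unfolding level_def by auto
  have "F \<subseteq> Fl j" using F Fl_mono[of "Suc i" j] ij unfolding level_def by auto
  then have "(F \<union> G) \<union> Fl j = Fl j \<union> G" by auto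
  then have eq: "cl (Fl j \<union> G) = cl (Fl j \<union> ?K)"
    using cl_Un_cl[of "F \<union> G" "Fl j"] FE by (simp add: Un_commute)
  have good: "good l (m + one_var G) \<longleftrightarrow> good l (m + one_var ?K)" if "l < k" for l
  proof (cases "l = j")
    case True
    then show ?thesis using good_add_cong[OF G K eq] by simp
  next
    case False
    then have "G \<notin> level l" "?K \<notin> level l" using G K level_unique by blast+
    then show ?thesis by (simp add: good_add_other)
  qed
  have "G \<subseteq> Fl k" "?K \<subseteq> Fl k" using G K Fl_mono[of "Suc j" k] ij unfolding level_def by auto
  then show ?thesis
    using good by (intro flag_wt_cong[of _ G ?K]) (auto simp: keys_add_one)
qed

text \<open>By \<open>dragon_add2\<close> each of the four values is an indicator of two
  one-variable conditions and a common condition \<open>?C\<close>. With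
  \<open>dragon_exchange\<close> the identity becomes inclusion-exclusion.\<close>

lemma flag_wt_same_level:
  assumes F: "F \<in> level i" and G: "G \<in> level i" and i: "i < k" and ne: "\<not> F \<subseteq> G" "\<not> G \<subseteq> F"
  shows "flag_wt (m + one_var F + one_var G) + flag_wt (m + one_var (cl (F \<union> G)) + one_var (cl (F \<union> G)))
    = flag_wt (m + one_var F + one_var (cl (F \<union> G))) + flag_wt (m + one_var G + one_var (cl (F \<union> G)))"
proof -
  let ?K = "cl (F \<union> G)"
  have K: "?K \<in> level i" using level_join[OF F G] by simp
  have FE: "F \<union> G \<subseteq> E" "Fl i \<subseteq> E" using F G fl_subset_E Fl_fl unfolding level_def by auto
  have FK: "F \<subseteq> ?K" "G \<subseteq> ?K" using subset_cl[OF FE(1)] by auto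
  have sub: "A \<subseteq> Fl k" if "A \<in> level i" for A
    using that Fl_mono[of "Suc i" k] i unfolding level_def by auto
  \<comment> \<open>What the four monomials have in common; the two added variables account for the
    2 in the degree.\<close>
  let ?rest = "(\<forall>H\<in>keys m. H \<subseteq> Fl k) \<and> (\<forall>l<k. l \<noteq> i \<longrightarrow> good l m) \<and> mass m (level i) + 2 = c i"
  let ?C = "\<forall>U\<subseteq>level i. rk (Fl i) + 3 + mass m U \<le> rk (Fl i \<union> ?K \<union> \<Union>U)"
  have wt: "flag_wt (m + one_var A + one_var B) = of_bool (?rest \<and> dragon i (m + one_var A + one_var B))"
    if A: "A \<in> level i" "B \<in> level i" for A B
  proof -
    have "good l (m + one_var A + one_var B) = good l m" if "l \<noteq> i" for l
    proof -
      have "A \<notin> level l" "B \<notin> level l" using A that level_unique by blast+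
      then show ?thesis by (simp add: good_add_other)
    qed
    then have "(\<forall>l<k. good l (m + one_var A + one_var B)) \<longleftrightarrow>
        (\<forall>l<k. l \<noteq> i \<longrightarrow> good l m) \<and> good i (m + one_var A + one_var B)"
      using i by metis
    moreover have "mass (m + one_var A + one_var B) (level i) = mass m (level i) + 2"
      using A by (simp add: mass_add[OF finite_level])
    ultimately show ?thesis
      unfolding flag_wt_def good_def[of i] keys_add_one using sub[OF A(1)] sub[OF A(2)] by auto
  qed
  have rk_K: "rk (Fl i \<union> (A \<union> B) \<union> \<Union>U) = rk (Fl i \<union> ?K \<union> \<Union>U)"
    if "cl (A \<union> B) = ?K" "A \<union> B \<subseteq> E" "U \<subseteq> level i" for A B U
  proof -
    have "rk ((A \<union> B) \<union> (Fl i \<union> \<Union>U)) = rk (?K \<union> (Fl i \<union> \<Union>U))"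
      using that FE level_subset_E[OF that(3)] cl_subset_E
      by (intro rk_cl_cong) (auto simp: cl_idem)
    then show ?thesis by (simp add: Un_ac)
  qed
  have d: "dragon i (m + one_var A + one_var B) \<longleftrightarrow> dragon i (m + one_var A) \<and> dragon i (m + one_var B) \<and> ?C"
    if "A \<in> level i" "B \<in> level i" "cl (A \<union> B) = ?K" for A B
  proof -
    have "A \<union> B \<subseteq> E" using that(1,2) fl_subset_E unfolding level_def by auto
    then show ?thesis unfolding dragon_add2[OF that(1,2)] using rk_K[OF that(3)] by auto
  qed
  have clK: "cl (F \<union> ?K) = ?K" "cl (G \<union> ?K) = ?K" "cl (?K \<union> ?K) = ?K"
    using FK cl_idem[OF FE(1)] by (auto simp: Un_absorb1)
  have CK: "dragon i (m + one_var ?K)" if "?C" "dragon i m"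
    unfolding dragon_add[OF K]
  proof (intro conjI allI impI that(2))
    fix U assume "U \<subseteq> level i"
    then have "rk (Fl i) + 3 + mass m U \<le> rk (Fl i \<union> ?K \<union> \<Union>U)" using that(1) by blast
    then show "rk (Fl i) + 2 + mass m U \<le> rk (Fl i \<union> ?K \<union> \<Union>U)" by linarith
  qed
  have ex: "dragon i (m + one_var F) \<or> dragon i (m + one_var G)" if "?C" "dragon i m"
    by (rule dragon_exchange[OF F G that(2)]) (simp add: rk_K[OF refl FE(1)] that(1))
  have dm: "dragon i (m + one_var A) \<Longrightarrow> dragon i m" if "A \<in> level i" for A
    using dragon_add[OF that] by blast
  show ?thesis
    unfolding wt[OF F G] wt[OF K K] wt[OF F K] wt[OF G K]
      d[OF F G refl] d[OF K K clK(3)] d[OF F K clK(1)] d[OF G K clK(2)]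
    by (rule of_bool_exchange[of _ "dragon i m"]; rule impI; (elim conjE)?;
        rule dm[OF F] dm[OF G] dm[OF K] CK ex; assumption)
qed

text \<open>The functional kills all multiples of (h_F - h_K)(h_G - h_K), where K is the join. In
  different levels K may replace the factor of the higher level, and the four terms cancel in pairs.
  If \<open>F\<close> or \<open>G\<close> is not below \<open>Fl k\<close> then K is not either, and
  all terms vanish.\<close>

lemma flag_wt_exchange:
  assumes fl: "fl F" "fl G" and ne: "\<not> F \<subseteq> G" "\<not> G \<subseteq> F"
  shows "flag_wt (m + one_var F + one_var G) + flag_wt (m + one_var (cl (F \<union> G)) + one_var (cl (F \<union> G)))
    = flag_wt (m + one_var F + one_var (cl (F \<union> G))) + flag_wt (m + one_var G + one_var (cl (F \<union> G)))"
proof -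
  let ?K = "cl (F \<union> G)"
  have FE: "F \<union> G \<subseteq> E" using fl fl_subset_E by auto
  have K: "F \<subseteq> ?K" "G \<subseteq> ?K" using subset_cl[OF FE] by auto
  show ?thesis
  proof (cases "F \<subseteq> Fl k \<and> G \<subseteq> Fl k")
    case False
    then have "\<not> ?K \<subseteq> Fl k" using K by auto
    then have out: "flag_wt n = 0" if "?K \<in> keys n" for n by (rule flag_wt_outside[OF that])
    have "flag_wt (m + one_var F + one_var G) = 0"
      using False flag_wt_outside[of F "m + one_var F + one_var G"]
        flag_wt_outside[of G "m + one_var F + one_var G"] unfolding keys_add_one by blast
    then show ?thesis by (simp add: out keys_add_one)
  next
    case True
    have "F \<noteq> {}" "G \<noteq> {}" using ne by auto
    obtain i where i: "i < k" "F \<in> level i" by (rule level_exists[OF fl(1) \<open>F \<noteq> {}\<close>]) (use True in auto)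
    obtain j where j: "j < k" "G \<in> level j" by (rule level_exists[OF fl(2) \<open>G \<noteq> {}\<close>]) (use True in auto)
    consider "i = j" | "i < j" | "j < i" by linarith
    then show ?thesis
    proof cases
      case 1
      then show ?thesis using flag_wt_same_level[OF i(2) _ i(1) ne] j(2) by simp
    next
      case 2
      show ?thesis
        using flag_wt_swap[OF i(2) j(2) 2 j(1), of "m + one_var F"]
          flag_wt_swap[OF i(2) j(2) 2 j(1), of "m + one_var ?K"] by (simp add: add.assoc add.commute add.left_commute)
    next
      case 3
      show ?thesis
        using flag_wt_swap[OF j(2) i(2) 3 i(1), of "m + one_var G"]
          flag_wt_swap[OF j(2) i(2) 3 i(1), of "m + one_var ?K"]
        by (simp add: Un_commute[of G F] add.assoc add.commute add.left_commute)
    qed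
  qed
qed

text \<open>The largest ideal inside the kernel of the functional. Unlike the kernel, it can be
  checked on generators.\<close>

definition annih :: "'a cpoly set" where
  "annih = {p. \<forall>q. lin flag_wt (p * q) = 0}"

lemma annihI: assumes "\<And>m. lin flag_wt (p * single m 1) = 0" shows "p \<in> annih"
  unfolding annih_def
proof (intro CollectI allI)
  fix q :: "'a cpoly"
  have "p * q = (\<Sum>m\<in>keys q. cscale (lookup q m) (p * single m 1))"
    by (subst cpoly_expand[of q]) (simp add: sum_distrib_left cscale_mult_right)
  then show "lin flag_wt (p * q) = 0" using assms by (simp add: lin_sum lin_cscale)
qed

lemma annih_add: "p \<in> annih \<Longrightarrow> q \<in> annih \<Longrightarrow> p + q \<in> annih"
  unfolding annih_def by (simp add: distrib_right lin_add)

lemma annih_diff: "p \<in> annih \<Longrightarrow> q \<in> annih \<Longrightarrow> p - q \<in> annih"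
  unfolding annih_def by (simp add: left_diff_distrib lin_diff)

lemma annih_sum: "(\<And>x. x \<in> A \<Longrightarrow> f x \<in> annih) \<Longrightarrow> sum f A \<in> annih"
  by (induction A rule: infinite_finite_induct) (auto simp: annih_add, auto simp: annih_def)

lemma annih_mult: "p \<in> annih \<Longrightarrow> p * q \<in> annih"
  unfolding annih_def by (simp add: mult.assoc)

lemma var_atom_annih: "atom E indep a \<Longrightarrow> var a \<in> annih"
  using flag_wt_atom by (intro annihI) (simp add: var_def mult_single add.commute)

lemma var_exchange_annih:
  assumes "fl F" "fl G" "\<not> F \<subseteq> G" "\<not> G \<subseteq> F"
  shows "(var F - var (cl (F \<union> G))) * (var G - var (cl (F \<union> G))) \<in> annih"
proof (rule annihI)
  fix m
  let ?K = "cl (F \<union> G)"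
  have s: "var A * var B * single m 1 = single (m + one_var A + one_var B) 1" for A B
    by (simp add: var_def mult_single add.assoc add.commute add.left_commute)
  have "(var F - var ?K) * (var G - var ?K) * single m 1 =
      var F * var G * single m 1 + var ?K * var ?K * single m 1
      - (var F * var ?K * single m 1 + var G * var ?K * single m 1)"
    by (simp add: algebra_simps)
  then show "lin flag_wt ((var F - var ?K) * (var G - var ?K) * single m 1) = 0"
    unfolding s using flag_wt_exchange[OF assms, of m] by (simp add: lin_add lin_diff)
qed

text \<open>Both factors of the exchange relation are sums of \<open>moeb\<close>, over flats above
  one of F, G and not above the other. Any flat of the first sum is incomparable to any flat of the
  second, so all products except the one for F and G are settled by induction.\<close>

lemma moeb_mult_annih:
  assumes "fl F" "fl G" "\<not> F \<subseteq> G" "\<not> G \<subseteq> F"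
  shows "moeb F * moeb G \<in> annih"
  using assms
proof (induction "codim F + codim G" arbitrary: F G rule: less_induct)
  case less
  let ?K = "cl (F \<union> G)"
  have FE: "F \<union> G \<subseteq> E" using less.prems fl_subset_E by auto
  have diff: "var A - var ?K = (\<Sum>F'\<in>{F'. fl F' \<and> A \<subseteq> F' \<and> \<not> B \<subseteq> F'}. moeb F')"
    if "fl A" "A \<union> B = F \<union> G" for A B
  proof -
    let ?R = "{F'. fl F' \<and> A \<subseteq> F' \<and> \<not> B \<subseteq> F'}"
    have sub: "?K \<subseteq> F' \<longleftrightarrow> A \<subseteq> F' \<and> B \<subseteq> F'" if "fl F'" for F'
      using cl_subset_iff[OF that FE] \<open>A \<union> B = F \<union> G\<close> by auto
    have fin: "finite {F'. fl F' \<and> P F'}" for P by (rule finite_subset[OF _ finite_flats]) auto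
    have "{F'. fl F' \<and> A \<subseteq> F'} = ?R \<union> {F'. fl F' \<and> ?K \<subseteq> F'}" "?R \<inter> {F'. fl F' \<and> ?K \<subseteq> F'} = {}"
      using sub by auto
    then have "var A = sum moeb ?R + var ?K"
      using moeb_sum[OF that(1)] moeb_sum[OF fl_cl[OF FE]] fin
      by (simp add: sum.union_disjoint)
    then show ?thesis by simp
  qed
  let ?A = "{F'. fl F' \<and> F \<subseteq> F' \<and> \<not> G \<subseteq> F'}"
  let ?B = "{G'. fl G' \<and> G \<subseteq> G' \<and> \<not> F \<subseteq> G'}"
  have "(var F - var ?K) * (var G - var ?K) = (\<Sum>F'\<in>?A. moeb F') * (\<Sum>G'\<in>?B. moeb G')"
    using diff[OF less.prems(1), of G] diff[OF less.prems(2), of F] by (simp add: Un_commute)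
  also have "\<dots> = (\<Sum>(F', G')\<in>?A \<times> ?B. moeb F' * moeb G')"
    by (simp add: sum_product sum.cartesian_product)
  also have "\<dots> = moeb F * moeb G + (\<Sum>(F', G')\<in>?A \<times> ?B - {(F, G)}. moeb F' * moeb G')"
  proof -
    have "finite ?A" "finite ?B" by (auto intro: finite_subset[OF _ finite_flats])
    then have "finite (?A \<times> ?B)" by simp
    moreover have "(F, G) \<in> ?A \<times> ?B" using less.prems by auto
    ultimately show ?thesis by (subst sum.remove) auto
  qed
  finally have "moeb F * moeb G = (var F - var ?K) * (var G - var ?K)
      - (\<Sum>(F', G')\<in>?A \<times> ?B - {(F, G)}. moeb F' * moeb G')" by simp
  also have "\<dots> \<in> annih"
  proof (intro annih_diff annih_sum)
    show "(var F - var ?K) * (var G - var ?K) \<in> annih" by (rule var_exchange_annih[OF less.prems])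
    fix x assume x: "x \<in> ?A \<times> ?B - {(F, G)}"
    obtain F' G' where x': "x = (F', G')" by (cases x)
    have le: "codim F' \<le> codim F" "codim G' \<le> codim G"
      using x x' card_mono[of F' F] card_mono[of G' G] fl_finite by (auto intro: diff_le_mono2)
    have "codim F' < codim F \<or> codim G' < codim G"
    proof (cases "F' = F")
      case True
      then have "G \<subset> G'" using x x' by auto
      then show ?thesis using codim_less[of G G'] x x' fl_subset_E by auto
    next
      case False
      then have "F \<subset> F'" using x x' by auto
      then show ?thesis using codim_less[of F F'] x x' fl_subset_E by auto
    qed
    then have "codim F' + codim G' < codim F + codim G" using le by linarith
    then have "moeb F' * moeb G' \<in> annih" using x x' by (intro less.hyps) auto
    then show "(case x of (F', G') \<Rightarrow> moeb F' * moeb G') \<in> annih" using x' by simp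
  qed
  finally show ?case .
qed

text \<open>If an antichain had its join in the building set, all its members would lie in the
  largest of their flats, of which some member \<open>G\<close> is a component. The join contains
  \<open>G\<close>, hence equals \<open>G\<close>, and the antichain is just
  {\<open>G\<close>}.\<close>

lemma chain_nested:
  assumes S: "S \<subseteq> \<G>" and f: "\<And>G. G \<in> S \<Longrightarrow> fl (f G) \<and> G \<in> comps (f G)"
    and chain: "\<And>G H. G \<in> S \<Longrightarrow> H \<in> S \<Longrightarrow> f G \<subseteq> f H \<or> f H \<subseteq> f G"
  shows "nst S"
proof (rule nestedI[OF S])
  fix A assume A: "A \<subseteq> S" "antichain A" "2 \<le> card A" "cl (\<Union>A) \<in> \<G>"
  have finA: "finite (f ` A)" "f ` A \<noteq> {}" using A(3) card.infinite[of A] by fastforce+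
  obtain M where M: "M \<in> f ` A" "\<And>X. X \<in> f ` A \<Longrightarrow> M \<subseteq> X \<Longrightarrow> M = X"
    using finite_has_maximal[OF finA] by blast
  obtain G where G: "G \<in> A" "M = f G" using M(1) by blast
  have GS: "G \<in> S" using G A by blast
  have below: "H \<subseteq> f G" if "H \<in> A" for H
  proof -
    have "f H \<subseteq> f G" using chain[of H G] M(2)[of "f H"] that A G by blast
    then show ?thesis using compsD(2)[of H "f H"] f[of H] that A by blast
  qed
  have UE: "\<Union>A \<subseteq> E" using A S building_subset_E by blast
  have "cl (\<Union>A) \<subseteq> f G" using f[OF GS] below by (intro cl_least) auto
  moreover have "G \<subseteq> cl (\<Union>A)" using subset_cl[OF UE] G by blast
  ultimately have "cl (\<Union>A) = G" using comps_maximal[of G "f G"] f[OF GS] A(4) by blast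
  then have "H \<subseteq> G" if "H \<in> A" for H using subset_cl[OF UE] that by blast
  then have "A \<subseteq> {G}" using A(2) G by blast
  then have "card A \<le> 1" using card_mono[of "{G}" A] by simp
  then show False using A(3) by simp
qed

text \<open>Each factor is a sum over the flats having G as a component. As \<open>S\<close> is not
  nested, \<open>chain_nested\<close> supplies two incomparable flats in every term of the expanded
  product.\<close>

lemma nonnested_annih:
  assumes S: "S \<subseteq> \<G>" "\<not> nst S"
  shows "(\<Prod>G\<in>S. pull G) \<in> annih"
proof -
  let ?T = "\<lambda>G. {F. fl F \<and> G \<in> comps F}"
  have finS: "finite S" using S(1) finite_building finite_subset by blast
  have "(\<Prod>G\<in>S. pull G) = (\<Sum>f\<in>PiE S ?T. \<Prod>G\<in>S. moeb (f G))"
    unfolding pull_def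
    by (rule prod_sum_PiE[OF finS]) (auto intro: finite_subset[OF _ finite_flats])
  also have "\<dots> \<in> annih"
  proof (rule annih_sum)
    fix f assume f: "f \<in> PiE S ?T"
    have fG: "fl (f G) \<and> G \<in> comps (f G)" if "G \<in> S" for G using PiE_mem[OF f that] by simp
    obtain G H where GH: "G \<in> S" "H \<in> S" "\<not> f G \<subseteq> f H" "\<not> f H \<subseteq> f G"
      using chain_nested[OF S(1) fG] S(2) by blast
    have "G \<noteq> H" using GH by auto
    then have "(\<Prod>G\<in>S. moeb (f G)) = moeb (f G) * moeb (f H) * (\<Prod>G\<in>S - {G} - {H}. moeb (f G))"
      using finS GH by (simp add: prod.remove[of S G] prod.remove[of "S - {G}" H] mult.assoc)
    also have "\<dots> \<in> annih" using fG GH by (intro annih_mult moeb_mult_annih) auto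
    finally show "(\<Prod>G\<in>S. moeb (f G)) \<in> annih" .
  qed
  finally show ?thesis .
qed

lemma gens_annih: "g \<in> gens \<Longrightarrow> subst pull g \<in> annih"
proof -
  assume "g \<in> gens"
  then consider S where "g = (\<Prod>G\<in>S. var G)" "S \<subseteq> \<G>" "\<not> nst S"
    | a where "g = (\<Sum>G\<in>{G \<in> \<G>. a \<subseteq> G}. var G)" "atom E indep a"
    unfolding chow_gens_def by blast
  then show ?thesis
  proof cases
    case 1
    then show ?thesis using nonnested_annih by (simp add: subst_prod)
  next
    case 2
    then have "subst pull g = var a"
      using subst_pull_hvar[OF atom_in_building[OF 2(2)]] unfolding hvar_def by simp
    then show ?thesis using var_atom_annih[OF 2(2)] by simp
  qed
qed

lemma ideal_annih:
  assumes "p \<in> ideal"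
  shows "lin flag_wt (subst pull p) = 0"
proof -
  obtain Gs r where p: "p = (\<Sum>g\<in>Gs. r g * g)" "finite Gs" "Gs \<subseteq> gens"
    "\<And>g. g \<in> Gs \<Longrightarrow> r g \<in> poly_ring \<G>" by (rule idealE[OF assms]) (rule that)
  have "subst pull (g * r g) \<in> annih" if "g \<in> Gs" for g
    unfolding subst_mult using p(3) that by (intro annih_mult gens_annih) auto
  then have "(\<Sum>g\<in>Gs. subst pull (g * r g)) \<in> annih" by (rule annih_sum)
  then have "subst pull p \<in> annih" unfolding p(1) by (simp add: subst_sum mult.commute)
  then have "lin flag_wt (subst pull p * 1) = 0" unfolding annih_def by blast
  then show ?thesis by simp
qed

end

section \<open>The dimension of the graded pieces\<close>

context built_matroid
begin

text \<open>The chain adds the support of \<open>m\<close> one element at a time and prescribes the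
  exponents of \<open>m\<close> as degrees. A nonzero value at \<open>m'\<close> forces a variable
  of \<open>m'\<close> into every level, hence a support at least as large. With equal sizes each
  level contains exactly one, contained in the matching element of the support of \<open>m\<close>.
  These two comparisons order the system triangularly.\<close>

lemma FY_functional:
  assumes m: "m \<in> FY"
  obtains l where
    "\<And>p q. l (p + q) = l p + l q" "\<And>a p. l (cscale a p) = a * l p" "\<And>p. p \<in> ideal \<Longrightarrow> l p = 0"
    "l (mon hvar m) \<noteq> 0"
    "\<And>m'. keys m' \<subseteq> \<G> \<Longrightarrow> l (mon hvar m') \<noteq> 0 \<Longrightarrow>
      card (keys m) \<le> card (keys m')"
    "\<And>m'. keys m' \<subseteq> \<G> \<Longrightarrow> l (mon hvar m') \<noteq> 0 \<Longrightarrow>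
      card (keys m) = card (keys m') \<Longrightarrow> m' \<noteq> m \<Longrightarrow>
      (\<Sum>H\<in>keys m'. card H) < (\<Sum>H\<in>keys m. card H)"
proof -
  let ?S = "keys m"
  have S: "nst ?S" using m unfolding FY_def by simp
  have SG: "?S \<subseteq> \<G>" using FY_keys[OF m] .
  obtain ys where ys: "set ys = ?S" "distinct ys" using finite_distinct_list[of ?S] by auto
  define xs where "xs = sort_key card ys"
  define k where "k = length xs"
  have xs: "set xs = ?S" "distinct xs" unfolding xs_def using ys by auto
  have kS: "k = card ?S" using distinct_card[OF xs(2)] xs(1) k_def by simp
  define K where "K i = xs ! i" for i
  have KS: "K i \<in> ?S" if "i < k" for i using that xs(1) nth_mem unfolding K_def k_def by metis
  have KG: "K i \<in> \<G>" if "i < k" for i using KS[OF that] SG by blast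
  have Kfin: "finite (K i)" if "i < k" for i using fl_finite[OF building_fl[OF KG[OF that]]] .
  have Kcard: "card (K i) \<le> card (K j)" if "i \<le> j" "j < k" for i j
    using sorted_nth_mono[OF sorted_sort_key, of i j card ys] that
    unfolding K_def k_def xs_def by simp
  have Kinj: "i = j" if "K i = K j" "i < k" "j < k" for i j
    using that xs(2) nth_eq_iff_index_eq unfolding K_def k_def by blast
  have Kle: "i \<le> j" if "K i \<subseteq> K j" "i < k" "j < k" for i j
  proof (rule ccontr)
    assume "\<not> i \<le> j"
    then have "card (K j) \<le> card (K i)" using Kcard[of j i] that by simp
    then have "K i = K j" using card_seteq[OF Kfin[OF that(3)] that(1)] by simp
    then show False using Kinj[OF _ that(2,3)] \<open>\<not> i \<le> j\<close> by simp
  qed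
  have Kex: "\<exists>i<k. X = K i" if "X \<in> ?S" for X
    using that xs(1) unfolding K_def k_def by (metis in_set_conv_nth)
  \<comment> \<open>The chain is constant from index \<open>k\<close> on, because the locale makes
    its assumptions for all indices.\<close>
  define Fl where "Fl i = \<Union>(K ` {j. j < i \<and> j < k})" for i
  define c where "c i = lookup m (K i)" for i
  have sub: "K ` {j. j < i \<and> j < k} \<subseteq> ?S" for i using KS by auto
  have Fl_below: "\<exists>j. j < i \<and> j < k \<and> H \<subseteq> K j" if H: "H \<in> \<G>" "H \<subseteq> Fl i" for H i
  proof -
    obtain X where "X \<in> K ` {j. j < i \<and> j < k}" "H \<subseteq> X"
      using nested_below_Union[OF S sub H(1)] H(2) unfolding Fl_def by blast
    then show ?thesis by blast
  qed
  interpret flag_functional E indep \<G> Fl k c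
  proof unfold_locales
    show "fl (Fl i)" for i unfolding Fl_def by (rule nested_comps(2)[OF S sub])
    show "Fl i \<subseteq> Fl j" if "i \<le> j" for i j unfolding Fl_def using that by force
    show "Fl 0 = {}" unfolding Fl_def by simp
  qed
  have KFl: "K j \<subseteq> Fl i" if "j < i" "j < k" for i j unfolding Fl_def using that by auto
  have K_level: "K j \<in> level i \<longleftrightarrow> j = i" if ji: "j < k" "i < k" for i j
  proof
    assume "j = i"
    moreover have "\<not> K i \<subseteq> Fl i"
    proof
      assume "K i \<subseteq> Fl i"
      then obtain l where "l < i" "l < k" "K i \<subseteq> K l" using Fl_below[OF KG[OF ji(2)]] by blast
      then show False using Kle[of i l] ji by simp
    qed
    ultimately show "K j \<in> level i"
      unfolding level_def using KFl[of i "Suc i"] that building_fl[OF KG[OF that(2)]] by simp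
  next
    assume l: "K j \<in> level i"
    then have "\<not> j < i" using KFl[of j i] that unfolding level_def by auto
    moreover obtain j' where "j' < Suc i" "j' < k" "K j \<subseteq> K j'"
      using l Fl_below[OF KG[OF ji(1)], of "Suc i"] unfolding level_def by blast
    ultimately show "j = i" using Kle[of j j'] that by simp
  qed
  \<comment> \<open>By \<open>rk_remove_maximal\<close> the rank grows by the rank of
    \<open>K i\<close> minus that of the elements of the support below it, so the bound in
    \<open>FY\<close> is what the dragon condition asks for.\<close>
  have rank_step: "rk (Fl i) + 1 + c i \<le> rk (Fl (Suc i))" if i: "i < k" for i
  proof -
    let ?A = "K ` {j. j < Suc i \<and> j < k}"
    have KiA: "K i \<in> ?A" using i by blast
    have "rk (\<Union>?A) + rk (below ?S (K i)) = rk (K i) + rk (\<Union>(?A - {K i}))"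
    proof (rule rk_remove_maximal[OF S sub KiA])
      fix X assume X: "X \<in> ?A" "K i \<subseteq> X"
      then obtain j where j: "j < Suc i" "j < k" "X = K j" by blast
      then have "j = i" using Kle[of i j] X i by simp
      then show "X = K i" using j by simp
    next
      show "{X \<in> ?S. X \<subset> K i} \<subseteq> ?A"
      proof
        fix X assume X: "X \<in> {X \<in> ?S. X \<subset> K i}"
        then obtain j where j: "j < k" "X = K j" using Kex by blast
        then have "j \<le> i" using Kle[of j i] X i by blast
        then show "X \<in> ?A" using j by auto
      qed
    qed
    moreover have "?A - {K i} = K ` {j. j < i \<and> j < k}"
    proof (intro set_eqI iffI)
      fix X assume "X \<in> ?A - {K i}"
      then obtain j where "j < Suc i" "j < k" "X = K j" "j \<noteq> i" by blast
      then show "X \<in> K ` {j. j < i \<and> j < k}" by (intro image_eqI[of _ _ j]) auto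
    next
      fix X assume "X \<in> K ` {j. j < i \<and> j < k}"
      then obtain j where "j < i" "j < k" "X = K j" by blast
      then show "X \<in> ?A - {K i}" using Kinj[of j i] i by auto
    qed
    moreover have "c i + rk (below ?S (K i)) < rk (K i)" using m KS[OF i] unfolding FY_def c_def by blast
    ultimately show ?thesis unfolding Fl_def by simp
  qed
  have diag: "flag_wt m = 1"
  proof -
    have 1: "H \<subseteq> Fl k" if "H \<in> ?S" for H using Kex[OF that] KFl by blast
    have lev: "level i \<inter> ?S = {K i}" if "i < k" for i
      using Kex K_level[OF _ that] KS[OF that] that by blast
    have mass: "mass m U = (if K i \<in> U then c i else 0)" if i: "i < k" and U: "U \<subseteq> level i" for i U
    proof -
      have "mass m U = (\<Sum>H\<in>U \<inter> {K i}. lookup m H)"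
        unfolding mass_def using lev[OF i] U
        by (intro sum.mono_neutral_right finite_level_subset[OF U]) (auto simp: in_keys_iff)
      then show ?thesis unfolding c_def by simp
    qed
    have "good i m" if i: "i < k" for i
      unfolding good_def dragon_def
    proof (intro conjI allI impI)
      show "mass m (level i) = c i" using mass[OF i subset_refl] K_level[OF i i] by simp
      fix U assume U: "U \<subseteq> level i" "U \<noteq> {}"
      show "rk (Fl i) + 1 + mass m U \<le> rk (Fl i \<union> \<Union>U)"
      proof (cases "K i \<in> U")
        case True
        have "Fl (Suc i) \<subseteq> Fl i \<union> K i" unfolding Fl_def using less_Suc_eq by auto
        then have "rk (Fl (Suc i)) \<le> rk (Fl i \<union> \<Union>U)" using True by (intro rk_mono) auto
        then show ?thesis using mass[OF i U(1)] True rank_step[OF i] by simp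
      next
        case False
        obtain H where H: "H \<in> U" "\<not> H \<subseteq> Fl i" using U unfolding level_def by blast
        have "rk (Fl i) < rk (Fl i \<union> \<Union>U)"
          using rk_less_of_not_subset[OF Fl_fl[of i], of "Fl i \<union> \<Union>U"] H fl_subset_E[OF Fl_fl[of i]]
            level_subset_E[OF U(1)] by blast
        then show ?thesis using mass[OF i U(1)] False by simp
      qed
    qed
    then show ?thesis unfolding flag_wt_def using 1 by simp
  qed
  have off: "\<exists>h. (\<forall>i<k. h i \<in> keys m' \<and> h i \<in> level i) \<and> inj_on h {..<k} \<and>
      (\<forall>i<k. mass m' (level i) = c i)"
    if "flag_wt m' \<noteq> 0" for m'
  proof -
    have good: "mass m' (level i) = c i" if "i < k" for i
      using \<open>flag_wt m' \<noteq> 0\<close> that unfolding flag_wt_def good_def by (auto split: if_splits)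
    have "\<exists>H. H \<in> keys m' \<and> H \<in> level i" if "i < k" for i
    proof (rule ccontr)
      assume "\<not> ?thesis"
      then have "mass m' (level i) = 0" unfolding mass_def
        by (intro sum.neutral) (auto simp: in_keys_iff)
      moreover have "c i \<noteq> 0" using KS[OF that] unfolding c_def by (simp add: in_keys_iff)
      ultimately show False using good[OF that] by simp
    qed
    then obtain h where h: "\<And>i. i < k \<Longrightarrow> h i \<in> keys m' \<and> h i \<in> level i" by metis
    have "inj_on h {..<k}" using h level_unique by (intro inj_onI) (metis lessThan_iff)
    then show ?thesis using h good by blast
  qed
  define l where "l p = lin flag_wt (subst pull p)" for p
  have lmon: "l (mon hvar m') = flag_wt m'" if "keys m' \<subseteq> \<G>" for m'
    unfolding l_def subst_pull_mon_hvar[OF that] by simp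
  show thesis
  proof (rule that[of l])
    show "l (p + q) = l p + l q" for p q unfolding l_def by (simp add: subst_add lin_add)
    show "l (cscale a p) = a * l p" for a p unfolding l_def by (simp add: subst_cscale lin_cscale)
    show "l p = 0" if "p \<in> ideal" for p unfolding l_def using ideal_annih[OF that] .
    show "l (mon hvar m) \<noteq> 0" using lmon[OF SG] diag by simp
    fix m' assume m': "keys m' \<subseteq> \<G>" "l (mon hvar m') \<noteq> 0"
    then obtain h where h: "\<And>i. i < k \<Longrightarrow> h i \<in> keys m'" "\<And>i. i < k \<Longrightarrow> h i \<in> level i"
      "inj_on h {..<k}" "\<And>i. i < k \<Longrightarrow> mass m' (level i) = c i"
      using off[of m'] lmon by auto
    have img: "h ` {..<k} \<subseteq> keys m'" using h(1) by auto
    have ch: "card (h ` {..<k}) = k" using card_image[OF h(3)] by simp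
    show "card ?S \<le> card (keys m')"
      using card_mono[OF _ img] ch kS by simp
    assume eq: "card ?S = card (keys m')" and ne: "m' \<noteq> m"
    have keys: "keys m' = h ` {..<k}"
      using card_subset_eq[OF _ img] ch kS eq by simp
    \<comment> \<open>A building element inside the union of the first K's lies in a single
      \<open>K j\<close>. It cannot be an earlier one, for then it would already lie in
      \<open>Fl i\<close>.\<close>
    have hK: "h i \<subseteq> K i" if i: "i < k" for i
    proof -
      have "h i \<in> \<G>" "h i \<subseteq> Fl (Suc i)" "\<not> h i \<subseteq> Fl i"
        using h(1,2)[OF i] m' unfolding level_def by auto
      moreover then obtain j where j: "j < Suc i" "j < k" "h i \<subseteq> K j" using Fl_below by blast
      ultimately have "\<not> j < i" using KFl[of j i] by blast
      then show ?thesis using j by (simp add: less_Suc_eq)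
    qed
    have lookup: "lookup m' (h i) = c i" if i: "i < k" for i
    proof -
      have "lookup m' H = 0" if "H \<in> level i - {h i}" for H
      proof (rule ccontr)
        assume "lookup m' H \<noteq> 0"
        then have "H \<in> h ` {..<k}" unfolding keys[symmetric] by (simp add: in_keys_iff)
        then obtain j where j: "j < k" "H = h j" by auto
        then have "j = i" using level_unique[of H j i] h(2)[of j] that by auto
        then show False using j that by simp
      qed
      then have "mass m' (level i) = (\<Sum>H\<in>{h i}. lookup m' H)"
        unfolding mass_def using h(2)[OF i] by (intro sum.mono_neutral_right finite_level) auto
      then show ?thesis using h(4)[OF i] by simp
    qed
    have "\<exists>i<k. h i \<noteq> K i"
    proof (rule ccontr)
      assume "\<not> ?thesis"
      then have hKe: "h i = K i" if "i < k" for i using that by blast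
      have "?S = K ` {..<k}" using Kex KS by blast
      then have kk: "keys m' = ?S" using keys hKe by simp
      have "lookup m' H = lookup m H" for H
      proof (cases "H \<in> ?S")
        case True
        then obtain i where "i < k" "H = K i" using Kex by blast
        then show ?thesis using lookup[of i] hKe[of i] unfolding c_def by simp
      next
        case False
        then have "H \<notin> keys m'" using kk by simp
        then show ?thesis using False by (simp add: in_keys_iff)
      qed
      then have "m' = m" by (rule poly_mapping_eqI)
      then show False using ne by simp
    qed
    then obtain i where i: "i < k" "h i \<subset> K i" using hK by blast
    have "(\<Sum>H\<in>keys m'. card H) = (\<Sum>i<k. card (h i))"
      unfolding keys by (simp add: sum.reindex[OF h(3)])
    also have "\<dots> < (\<Sum>i<k. card (K i))"
    proof (rule sum_strict_mono_ex1)
      show "\<forall>i\<in>{..<k}. card (h i) \<le> card (K i)" using hK Kfin card_mono by blast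
      show "\<exists>i\<in>{..<k}. card (h i) < card (K i)" using i Kfin psubset_card_mono by blast
    qed simp
    also have "\<dots> = (\<Sum>H\<in>?S. card H)"
    proof -
      have "inj_on K {..<k}" using Kinj by (intro inj_onI) auto
      moreover have "?S = K ` {..<k}" using Kex KS by blast
      ultimately show ?thesis by (simp add: sum.reindex)
    qed
    finally show "(\<Sum>H\<in>keys m'. card H) < (\<Sum>H\<in>?S. card H)" .
  qed
qed

lemma mon_hvar_deg:
  assumes "keys m \<subseteq> \<G>"
  shows "mon hvar m \<in> PD (mdeg m)"
proof -
  have h: "hvar G \<in> PD 1" for G
    unfolding hvar_def var_def poly_ring_deg_supported
    by (intro supported_sum supported_single) (auto simp: mdeg_wt)
  have mult: "p * q \<in> PD (i + j)" if "p \<in> PD i" "q \<in> PD j" for p q i j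
    using that unfolding poly_ring_deg_supported
    by (rule supported_mult) (auto simp: keys_add_nat mdeg_add)
  have one: "1 \<in> PD 0"
    using supported_single[of 0 "{m. keys m \<subseteq> \<G> \<and> mdeg m = 0}" 1]
    unfolding poly_ring_deg_supported by (simp add: mdeg_wt)
  have pow: "hvar G ^ j \<in> PD j" for G j
    using one mult[OF h] by (induction j) auto
  have "(\<Prod>G\<in>A. hvar G ^ lookup m G) \<in> PD (\<Sum>G\<in>A. lookup m G)" for A
    using one mult[OF pow] by (induction A rule: infinite_finite_induct) auto
  then show ?thesis unfolding mon_def mdeg_def .
qed

text \<open>The upper bound uses the x-monomials, the lower bound the h-monomials. Both families are
  indexed by \<open>FY_deg i\<close>, so the bounds agree.\<close>

lemma chow_dim_FY: "chow_dim E indep \<G> i = card (FY_deg i)"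
proof -
  let ?J = "ideal \<inter> PD i"
  let ?N = "(\<lambda>m. single m (1::rat)) ` FY_deg i"
  let ?M = "(\<lambda>m. single m (1::rat)) ` {m. keys m \<subseteq> \<G> \<and> mdeg m = i}"
  have finM: "finite ?M" using finite_monomials[OF finite_building] by simp
  have PDM: "PD i \<subseteq> cpoly.span ?M"
    unfolding poly_ring_deg_supported by (rule supported_subset_span)
  obtain B where B: "B \<subseteq> ?J" "cpoly.independent B" "?J \<subseteq> cpoly.span B" "card B = cpoly.dim ?J"
    using cpoly.basis_exists[of ?J] by blast
  obtain C where C: "C \<subseteq> PD i" "cpoly.independent C" "PD i \<subseteq> cpoly.span C" "card C = cpoly.dim (PD i)"
    using cpoly.basis_exists[of "PD i"] by blast
  have "B \<subseteq> cpoly.span ?M" using B(1) PDM by blast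
  then have finB: "finite B" using cpoly.independent_span_bound[OF finM B(2)] by simp
  have "C \<subseteq> cpoly.span ?M" using C(1) PDM by blast
  then have finC: "finite C" using cpoly.independent_span_bound[OF finM C(2)] by simp
  have upper: "card C \<le> card B + card (FY_deg i)"
  proof -
    have "?J \<union> ?N \<subseteq> cpoly.span (B \<union> ?N)"
      using B(3) cpoly.span_mono[of B "B \<union> ?N"] cpoly.span_superset[of "B \<union> ?N"] by auto
    then have "cpoly.span (?J \<union> ?N) \<subseteq> cpoly.span (B \<union> ?N)"
      by (intro cpoly.span_minimal cpoly.subspace_span)
    then have "C \<subseteq> cpoly.span (B \<union> ?N)" using C(1) PD_subset_span[of i] by blast
    then have "card C \<le> card (B \<union> ?N)"
      using cpoly.independent_span_bound[of "B \<union> ?N" C] finB finite_FY_deg C(2) by simp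
    also have "\<dots> \<le> card B + card ?N" by (rule card_Un_le)
    also have "\<dots> \<le> card B + card (FY_deg i)" using card_image_le[OF finite_FY_deg] by simp
    finally show ?thesis .
  qed
  have lower: "card B + card (FY_deg i) \<le> card C"
  proof -
    define L where "L m l \<longleftrightarrow> (\<forall>p q. l (p + q) = l p + l q) \<and> (\<forall>a p. l (cscale a p) = a * l p) \<and>
      (\<forall>p\<in>ideal. l p = 0) \<and> l (mon hvar m) \<noteq> 0 \<and>
      (\<forall>m'. keys m' \<subseteq> \<G> \<longrightarrow> l (mon hvar m') \<noteq> 0 \<longrightarrow>
        card (keys m) \<le> card (keys m') \<and>
        (card (keys m) = card (keys m') \<longrightarrow> m' \<noteq> m \<longrightarrow>
          (\<Sum>H\<in>keys m'. card H) < (\<Sum>H\<in>keys m. card H)))"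
      for m and l :: "'a cpoly \<Rightarrow> rat"
    have "\<exists>l. L m l" if "m \<in> FY_deg i" for m
    proof -
      have "m \<in> FY" using that unfolding FY_deg_def by simp
      then obtain l where "L m l" unfolding L_def by (rule FY_functional) blast
      then show ?thesis by blast
    qed
    then obtain l where l: "\<And>m. m \<in> FY_deg i \<Longrightarrow> L m (l m)" by metis
    \<comment> \<open>\<open>independent_by_functionals\<close> asks for linearity at every index,
      hence the zero functional outside \<open>FY_deg i\<close>.\<close>
    define l' where "l' m = (if m \<in> FY_deg i then l m else (\<lambda>_. 0))" for m
    have l': "L m (l' m)" if "m \<in> FY_deg i" for m using l[OF that] that unfolding l'_def by simp
    have "cpoly.independent (B \<union> mon hvar ` FY_deg i) \<and>
        card (B \<union> mon hvar ` FY_deg i) = card B + card (FY_deg i)"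
    proof (rule independent_by_functionals[where l = l'])
      show "finite (FY_deg i)" by (rule finite_FY_deg)
      show "cpoly.independent B" "finite B" by fact+
      show "l' m b = 0" if "m \<in> FY_deg i" "b \<in> B" for m b
        using l'[OF that(1)] B(1) that(2) unfolding L_def by blast
      show "l' m (p + q) = l' m p + l' m q" for m p q
        using l' unfolding L_def by (cases "m \<in> FY_deg i") (auto simp: l'_def)
      show "l' m (cscale a p) = a * l' m p" for m a p
        using l' unfolding L_def by (cases "m \<in> FY_deg i") (auto simp: l'_def)
      show "l' m (mon hvar m) \<noteq> 0" if "m \<in> FY_deg i" for m
        using l'[OF that] unfolding L_def by blast
      fix J assume J: "J \<subseteq> FY_deg i" "J \<noteq> {}"
      have finJ: "finite J" using J finite_FY_deg finite_subset by blast
      let ?n = "\<lambda>m :: 'a set \<Rightarrow>\<^sub>0 nat. card (keys m)"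
      let ?s = "\<lambda>m :: 'a set \<Rightarrow>\<^sub>0 nat. \<Sum>H\<in>keys m. card H"
      \<comment> \<open>The peeled index has the largest support size and, among these, the smallest
        total cardinality. A nonzero value elsewhere would have to beat it in one of the
        two.\<close>
      define J' where "J' = {m \<in> J. ?n m = Max (?n ` J)}"
      have "Max (?n ` J) \<in> ?n ` J" using finJ J(2) by (intro Max_in) auto
      then have "J' \<noteq> {}" unfolding J'_def by auto
      moreover have "finite J'" using finJ unfolding J'_def by simp
      ultimately have "Min (?s ` J') \<in> ?s ` J'" by (intro Min_in) auto
      then obtain m where m: "m \<in> J'" "?s m = Min (?s ` J')" by auto
      have mJ: "m \<in> J" "?n m = Max (?n ` J)" using m(1) unfolding J'_def by auto
      have "l' m (mon hvar m') = 0" if m': "m' \<in> J" "m' \<noteq> m" for m'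
      proof (rule ccontr)
        assume nz: "l' m (mon hvar m') \<noteq> 0"
        have "keys m' \<subseteq> \<G>" using FY_keys m' J unfolding FY_deg_def by blast
        then have *: "?n m \<le> ?n m'" "?n m = ?n m' \<Longrightarrow> ?s m' < ?s m"
          using l'[of m] nz m'(2) mJ(1) J(1) unfolding L_def by blast+
        have "?n m' \<le> Max (?n ` J)" using finJ m'(1) by (intro Max_ge) auto
        then have eq: "?n m = ?n m'" using *(1) mJ(2) by linarith
        then have "m' \<in> J'" using m'(1) mJ(2) unfolding J'_def by simp
        then have "?s m \<le> ?s m'" using \<open>finite J'\<close> m(2) by simp
        then show False using *(2)[OF eq] by simp
      qed
      then show "\<exists>m\<in>J. \<forall>m'\<in>J. m' \<noteq> m \<longrightarrow> l' m (mon hvar m') = 0" using mJ(1) by blast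
    qed
    moreover have "B \<union> mon hvar ` FY_deg i \<subseteq> cpoly.span C"
    proof -
      have "mon hvar m \<in> PD i" if "m \<in> FY_deg i" for m
        using mon_hvar_deg[of m] FY_keys[of m] that unfolding FY_deg_def by auto
      then show ?thesis using B(1) C(3) by blast
    qed
    ultimately show ?thesis using cpoly.independent_span_bound[OF finC] by metis
  qed
  show ?thesis unfolding chow_dim_def using upper lower B(4) C(4) by simp
qed

end

section \<open>Markings of a disjoint union of paths\<close>

text \<open>The partial injection c decomposes T into paths; it leaves T exactly at their ends.\<close>
locale path_system =
  fixes T :: "'b set" and c :: "'b \<Rightarrow> 'b" and D :: "'b set" and ht :: "'b \<Rightarrow> nat"
  assumes finite_T: "finite T"
    and out: "x \<notin> T \<Longrightarrow> c x \<notin> T"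
    and inj: "c x \<in> T \<Longrightarrow> c x = c y \<Longrightarrow> x = y"
    and ht: "c x \<in> T \<Longrightarrow> ht (c x) < ht x"
    and D_sub: "D \<subseteq> T" and D_top: "D \<inter> c ` T = {}"
begin

text \<open>Each support element owns the stretch of its path following it, of length its exponent.
  For trees, \<open>admissible_iff_FY\<close> identifies these with basis monomials.\<close>

definition admissible :: "('b \<Rightarrow>\<^sub>0 nat) \<Rightarrow> bool" where
  "admissible m \<longleftrightarrow> keys m \<subseteq> T \<and> D \<subseteq> keys m \<and>
    (\<forall>G\<in>keys m. \<forall>j. 1 \<le> j \<longrightarrow> j \<le> lookup m G \<longrightarrow>
      (c ^^ j) G \<in> T \<and> (c ^^ j) G \<notin> keys m)"

text \<open>An element of the support is recovered from the marks as the predecessor of a maximal run of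
  marked elements, and its exponent as the length of the run.\<close>
definition marks :: "('b \<Rightarrow>\<^sub>0 nat) \<Rightarrow> 'b set" where
  "marks m = (\<lambda>(G, j). (c ^^ j) G) ` (SIGMA G:keys m. {1..lookup m G})"

lemma in_marks: "x \<in> marks m \<longleftrightarrow>
    (\<exists>G\<in>keys m. \<exists>j. 1 \<le> j \<and> j \<le> lookup m G \<and> x = (c ^^ j) G)"
  unfolding marks_def by fastforce

lemma marks_iterate: "G \<in> keys m \<Longrightarrow> 1 \<le> j \<Longrightarrow> j \<le> lookup m G \<Longrightarrow> (c ^^ j) G \<in> marks m"
  using in_marks by blast

lemma marksE:
  assumes "x \<in> marks m"
  obtains G j where "G \<in> keys m" "1 \<le> j" "j \<le> lookup m G" "x = (c ^^ j) G"
  using assms in_marks by blast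

lemma admissibleD:
  assumes "admissible m"
  shows "keys m \<subseteq> T" "D \<subseteq> keys m"
    and "G \<in> keys m \<Longrightarrow> 1 \<le> j \<Longrightarrow> j \<le> lookup m G \<Longrightarrow> (c ^^ j) G \<in> T"
    and "G \<in> keys m \<Longrightarrow> 1 \<le> j \<Longrightarrow> j \<le> lookup m G \<Longrightarrow> (c ^^ j) G \<notin> keys m"
  using assms unfolding admissible_def by simp_all

lemma iterate_cancel: "(c ^^ (n + i)) x = (c ^^ i) y \<Longrightarrow> (c ^^ i) y \<in> T \<Longrightarrow> (c ^^ n) x = y"
proof (induction i)
  case (Suc i)
  have "c ((c ^^ (n + i)) x) = c ((c ^^ i) y)" "c ((c ^^ i) y) \<in> T" using Suc.prems by simp_all
  then have "(c ^^ (n + i)) x = (c ^^ i) y" using inj by metis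
  moreover have "(c ^^ i) y \<in> T" using Suc.prems(2) out by auto
  ultimately show ?case using Suc.IH by simp
qed simp

text \<open>Otherwise injectivity of \<open>c\<close> allows both iterates to be traced back until
  the start of one stretch lies inside the other, where no support element is allowed.\<close>

lemma marks_inj:
  assumes m: "admissible m" and G: "G \<in> keys m" "1 \<le> i" "i \<le> lookup m G"
    and H: "H \<in> keys m" "1 \<le> j" and eq: "(c ^^ i) G = (c ^^ j) H"
    and le: "j \<le> i"
  shows "G = H \<and> i = j"
proof -
  have "(c ^^ j) H \<in> T" using admissibleD(3)[OF m G] eq by simp
  then have *: "(c ^^ (i - j)) G = H" using iterate_cancel[of "i - j" j G H] eq le by simp
  have "i = j"
  proof (rule ccontr)
    assume "i \<noteq> j"
    then have "1 \<le> i - j" "i - j \<le> lookup m G" using le G by auto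
    then have "(c ^^ (i - j)) G \<notin> keys m" by (rule admissibleD(4)[OF m G(1)])
    then show False using * H(1) by simp
  qed
  then show ?thesis using * by simp
qed

lemma card_marks:
  assumes m: "admissible m"
  shows "card (marks m) = (\<Sum>G\<in>keys m. lookup m G)"
proof -
  let ?P = "SIGMA G:keys m. {1..lookup m G}"
  have "inj_on (\<lambda>(G, j). (c ^^ j) G) ?P"
  proof (rule inj_onI)
    fix x y assume xy: "x \<in> ?P" "y \<in> ?P" "(\<lambda>(G, j). (c ^^ j) G) x = (\<lambda>(G, j). (c ^^ j) G) y"
    obtain G i H j where e: "x = (G, i)" "y = (H, j)" by (cases x, cases y)
    show "x = y"
      using xy e marks_inj[OF m, of G i H j] marks_inj[OF m, of H j G i] by (cases "j \<le> i") auto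
  qed
  then have "card (marks m) = card ?P" unfolding marks_def by (rule card_image)
  then show ?thesis by simp
qed

lemma marks_sub: assumes m: "admissible m" shows "marks m \<subseteq> T \<inter> c ` T" and "c ` D \<subseteq> marks m"
proof -
  show "marks m \<subseteq> T \<inter> c ` T"
  proof
    fix x assume "x \<in> marks m"
    then obtain G j where G: "G \<in> keys m" "1 \<le> j" "j \<le> lookup m G" "x = (c ^^ j) G"
      by (rule marksE)
    then have x: "x \<in> T" using admissibleD(3)[OF m] by simp
    obtain j' where "j = Suc j'" using G(2) by (cases j) auto
    then have e: "x = c ((c ^^ j') G)" using G(4) by simp
    then have "(c ^^ j') G \<in> T" using out x by metis
    then show "x \<in> T \<inter> c ` T" using x e by blast
  qed
  show "c ` D \<subseteq> marks m"
  proof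
    fix x assume "x \<in> c ` D"
    then obtain G where G: "G \<in> D" "x = (c ^^ 1) G" by auto
    then have "G \<in> keys m" using admissibleD(2)[OF m] by blast
    moreover from this have "1 \<le> lookup m G" by (simp add: in_keys_iff Suc_le_eq)
    ultimately show "x \<in> marks m" using marks_iterate[of G m 1] G(2) by simp
  qed
qed

lemma keys_from_marks:
  assumes m: "admissible m"
  shows "keys m = {G \<in> T. G \<notin> marks m \<and> c G \<in> marks m}"
proof (intro set_eqI iffI)
  fix G assume G: "G \<in> keys m"
  then have "1 \<le> lookup m G" by (simp add: in_keys_iff Suc_le_eq)
  then have "c G \<in> marks m" using marks_iterate[OF G, of 1] by simp
  moreover have "G \<notin> marks m"
  proof
    assume "G \<in> marks m"
    then obtain H j where "H \<in> keys m" "1 \<le> j" "j \<le> lookup m H" "G = (c ^^ j) H"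
      by (rule marksE)
    then show False using admissibleD(4)[OF m] G by simp
  qed
  ultimately show "G \<in> {G \<in> T. G \<notin> marks m \<and> c G \<in> marks m}" using admissibleD(1)[OF m] G by blast
next
  fix G assume "G \<in> {G \<in> T. G \<notin> marks m \<and> c G \<in> marks m}"
  then have G: "G \<notin> marks m" "c G \<in> marks m" by auto
  obtain H j where H: "H \<in> keys m" "1 \<le> j" "j \<le> lookup m H" "c G = (c ^^ j) H"
    using G(2) by (rule marksE)
  obtain i where i: "j = Suc i" using H(2) by (cases j) auto
  have "c G \<in> T" using marks_sub(1)[OF m] G by blast
  then have e: "G = (c ^^ i) H" using H(4) i inj[of G "(c ^^ i) H"] by simp
  have "i = 0"
  proof (rule ccontr)
    assume "i \<noteq> 0"
    then have "G \<in> marks m" using marks_iterate[OF H(1), of i] H(3) i e by simp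
    then show False using G by simp
  qed
  then show "G \<in> keys m" using e H by simp
qed

text \<open>If the first element after the stretch of \<open>G\<close> were marked from some H,
  tracing back would place \<open>G\<close> or H inside the stretch of the other, or exceed the
  exponent of \<open>G\<close> itself.\<close>

lemma marks_end:
  assumes m: "admissible m" and G: "G \<in> keys m"
  shows "(c ^^ Suc (lookup m G)) G \<notin> marks m"
proof
  let ?l = "Suc (lookup m G)"
  assume "(c ^^ ?l) G \<in> marks m"
  then obtain H i where H: "H \<in> keys m" "1 \<le> i" "i \<le> lookup m H" "(c ^^ ?l) G = (c ^^ i) H"
    by (rule marksE)
  show False
  proof (cases "?l \<le> i")
    case True
    then show False using marks_inj[OF m H(1-3) G _ H(4)[symmetric]] H(3) by auto
  next
    case False
    have "(c ^^ i) H \<in> T" using admissibleD(3)[OF m H(1-3)] .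
    then have "(c ^^ (?l - i)) G = H" using iterate_cancel[of "?l - i" i G H] H(4) False by simp
    moreover have "1 \<le> ?l - i" "?l - i \<le> lookup m G" using False H(2) by auto
    ultimately show False using admissibleD(4)[OF m G] H(1) by metis
  qed
qed

lemma marks_inject:
  assumes m: "admissible m" and n: "admissible n" and eq: "marks m = marks n"
  shows "m = n"
proof (rule poly_mapping_eqI)
  have keys: "keys m = keys n" using keys_from_marks m n eq by simp
  fix G
  have le: "\<not> lookup m G < lookup n G"
    if "admissible m" "admissible n" "marks m = marks n" "G \<in> keys m" "G \<in> keys n" for m n
  proof
    assume "lookup m G < lookup n G"
    then have "(c ^^ Suc (lookup m G)) G \<in> marks n"
      by (intro marks_iterate[OF that(5)]) auto
    then show False using marks_end[OF that(1,4)] that(3) by simp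
  qed
  show "lookup m G = lookup n G"
  proof (cases "G \<in> keys m")
    case True
    then show ?thesis using le[OF m n eq] le[OF n m eq[symmetric]] keys by simp
  next
    case False
    then have "G \<notin> keys n" using keys by simp
    then show ?thesis using False by (simp add: in_keys_iff)
  qed
qed

lemma marks_surj:
  assumes Y: "Y \<subseteq> T \<inter> c ` T" "c ` D \<subseteq> Y"
  shows "\<exists>m. admissible m \<and> marks m = Y"
proof -
  define K where "K = {G \<in> T. G \<notin> Y \<and> c G \<in> Y}"
  define l where "l G = (LEAST l. (c ^^ Suc l) G \<notin> Y)" for G
  \<comment> \<open>The height falls at every step within \<open>Y\<close>, so a run cannot go on
    forever and \<open>l\<close> is well defined.\<close>
  have bound: "(\<And>i. i \<le> j \<Longrightarrow> (c ^^ Suc i) G \<in> Y) \<Longrightarrow> ht ((c ^^ Suc j) G) + Suc j \<le> ht G" for j G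
  proof (induction j)
    case 0
    then have "c G \<in> T" using Y(1) by force
    then show ?case using ht[of G] by simp
  next
    case (Suc j)
    have "(c ^^ Suc (Suc j)) G \<in> T" using Suc.prems[of "Suc j"] Y(1) by blast
    then have "ht ((c ^^ Suc (Suc j)) G) < ht ((c ^^ Suc j) G)" using ht[of "(c ^^ Suc j) G"] by simp
    moreover have "ht ((c ^^ Suc j) G) + Suc j \<le> ht G" using Suc.IH Suc.prems by simp
    ultimately show ?case by linarith
  qed
  have "\<exists>j. (c ^^ Suc j) G \<notin> Y" for G
    using bound[of "ht G" G] by fastforce
  then have l_end: "(c ^^ Suc (l G)) G \<notin> Y" for G unfolding l_def by (rule LeastI_ex)
  have l_run: "(c ^^ j) G \<in> Y" if "1 \<le> j" "j \<le> l G" for G j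
    using not_less_Least[of "j - 1" "\<lambda>l. (c ^^ Suc l) G \<notin> Y"] that unfolding l_def[symmetric] by simp
  have l_pos: "0 < l G" if "G \<in> K" for G
    using l_end[of G] that unfolding K_def by (cases "l G") auto
  have finK: "finite K" unfolding K_def using finite_T by simp
  define m where "m = (\<Sum>G\<in>K. single G (l G))"
  have look: "lookup m G = (if G \<in> K then l G else 0)" for G
    unfolding m_def using finK by (simp add: lookup_sum lookup_single when_def)
  have keys: "keys m = K" using l_pos by (auto simp: in_keys_iff look split: if_splits)
  have adm: "admissible m"
    unfolding admissible_def
  proof (intro conjI ballI allI impI)
    show "keys m \<subseteq> T" unfolding keys K_def by auto
    \<comment> \<open>Elements of \<open>D\<close> are not values of \<open>c\<close> on
      \<open>T\<close>, hence not in \<open>Y\<close>, while their successors are: each opens a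
      run.\<close>
    show "D \<subseteq> keys m" unfolding keys K_def using D_sub D_top Y by blast
    fix G j assume G: "G \<in> keys m" "1 \<le> j" "j \<le> lookup m G"
    then have "(c ^^ j) G \<in> Y" using l_run[of j G] keys look by simp
    then show "(c ^^ j) G \<in> T" "(c ^^ j) G \<notin> keys m" unfolding keys K_def using Y(1) by auto
  qed
  have "marks m \<subseteq> Y" using l_run by (auto simp: in_marks keys look)
  moreover have "Y \<subseteq> marks m"
  proof
    fix y assume "y \<in> Y"
    then show "y \<in> marks m"
    \<comment> \<open>Induction up the path: the predecessor of \<open>y\<close> either opens the
      run or is itself marked, and then \<open>y\<close> is the next mark.\<close>
    proof (induction "Max (ht ` T) - ht y" arbitrary: y rule: less_induct)
      case less
      obtain x where x: "x \<in> T" "y = c x" using less.prems Y(1) by blast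
      show ?case
      proof (cases "x \<in> Y")
        case False
        then have xK: "x \<in> K" using x less.prems unfolding K_def by simp
        then have "(c ^^ 1) x \<in> marks m" using l_pos[OF xK] by (intro marks_iterate) (auto simp: keys look)
        then show ?thesis using x by simp
      next
        case True
        have "ht y < ht x" using ht[of x] x less.prems Y(1) by blast
        moreover have "ht x \<le> Max (ht ` T)" using finite_T x by simp
        ultimately have "x \<in> marks m" using less.hyps[of x] True by simp
        then obtain G j where G: "G \<in> K" "1 \<le> j" "j \<le> l G" "x = (c ^^ j) G"
          by (rule marksE) (auto simp: keys look)
        have "j \<noteq> l G" using l_end[of G] G(4) x less.prems by auto
        then have "(c ^^ Suc j) G \<in> marks m" using G by (intro marks_iterate) (auto simp: keys look)
        then show ?thesis using G(4) x by simp
      qed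
    qed
  qed
  ultimately show ?thesis using adm by blast
qed

lemma card_admissible:
  "card {m. admissible m \<and> (\<Sum>G\<in>keys m. lookup m G) = i} =
    card {Y. c ` D \<subseteq> Y \<and> Y \<subseteq> T \<inter> c ` T \<and> card Y = i}"
proof (rule bij_betw_same_card[of marks], rule bij_betw_imageI)
  show "inj_on marks {m. admissible m \<and> (\<Sum>G\<in>keys m. lookup m G) = i}"
    using marks_inject by (intro inj_onI) auto
  show "marks ` {m. admissible m \<and> (\<Sum>G\<in>keys m. lookup m G) = i} =
      {Y. c ` D \<subseteq> Y \<and> Y \<subseteq> T \<inter> c ` T \<and> card Y = i}"
  proof (intro set_eqI iffI)
    fix Y assume "Y \<in> marks ` {m. admissible m \<and> (\<Sum>G\<in>keys m. lookup m G) = i}"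
    then show "Y \<in> {Y. c ` D \<subseteq> Y \<and> Y \<subseteq> T \<inter> c ` T \<and> card Y = i}"
      by (auto simp: card_marks dest: marks_sub(1) intro: set_mp[OF marks_sub(2)])
  next
    fix Y assume Y: "Y \<in> {Y. c ` D \<subseteq> Y \<and> Y \<subseteq> T \<inter> c ` T \<and> card Y = i}"
    then obtain m where m: "admissible m" "marks m = Y" using marks_surj[of Y] by auto
    then have "(\<Sum>G\<in>keys m. lookup m G) = i" using card_marks[OF m(1)] Y by simp
    then show "Y \<in> marks ` {m. admissible m \<and> (\<Sum>G\<in>keys m. lookup m G) = i}"
      using m by (intro image_eqI[of _ _ m]) auto
  qed
qed

end

lemma card_between:
  assumes "finite A" "B \<subseteq> A"
  shows "card {Y. B \<subseteq> Y \<and> Y \<subseteq> A \<and> card Y = i} =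
    (if i < card B then 0 else (card A - card B) choose (i - card B))"
proof (cases "i < card B")
  case True
  have "card B \<le> card Y" if "B \<subseteq> Y" "Y \<subseteq> A" for Y
    using card_mono[OF finite_subset[OF that(2) assms(1)] that(1)] .
  then have empty: "{Y. B \<subseteq> Y \<and> Y \<subseteq> A \<and> card Y = i} = {}" using True by (auto simp: not_le[symmetric])
  show ?thesis unfolding empty using True by simp
next
  case False
  have finB: "finite B" using assms finite_subset by blast
  have "bij_betw (\<lambda>Z. B \<union> Z) {Z. Z \<subseteq> A - B \<and> card Z = i - card B} {Y. B \<subseteq> Y \<and> Y \<subseteq> A \<and> card Y = i}"
  proof (rule bij_betw_imageI)
    show "inj_on (\<lambda>Z. B \<union> Z) {Z. Z \<subseteq> A - B \<and> card Z = i - card B}" by (rule inj_onI) blast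
    show "(\<lambda>Z. B \<union> Z) ` {Z. Z \<subseteq> A - B \<and> card Z = i - card B} = {Y. B \<subseteq> Y \<and> Y \<subseteq> A \<and> card Y = i}"
    proof (intro set_eqI iffI)
      fix Y assume "Y \<in> (\<lambda>Z. B \<union> Z) ` {Z. Z \<subseteq> A - B \<and> card Z = i - card B}"
      then obtain Z where Z: "Z \<subseteq> A - B" "card Z = i - card B" "Y = B \<union> Z" by blast
      have "finite Z" "B \<inter> Z = {}" using Z(1) assms(1) finite_subset[of Z A] by auto
      then have "card Y = i" using Z False finB by (simp add: card_Un_disjoint)
      then show "Y \<in> {Y. B \<subseteq> Y \<and> Y \<subseteq> A \<and> card Y = i}" using Z assms(2) by blast
    next
      fix Y assume Y: "Y \<in> {Y. B \<subseteq> Y \<and> Y \<subseteq> A \<and> card Y = i}"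
      then have "card (Y - B) = i - card B" using finB by (simp add: card_Diff_subset)
      moreover have "Y = B \<union> (Y - B)" "Y - B \<subseteq> A - B" using Y by auto
      ultimately show "Y \<in> (\<lambda>Z. B \<union> Z) ` {Z. Z \<subseteq> A - B \<and> card Z = i - card B}"
        by (intro image_eqI[of _ _ "Y - B"]) auto
    qed
  qed
  then have "card {Y. B \<subseteq> Y \<and> Y \<subseteq> A \<and> card Y = i} = card {Z. Z \<subseteq> A - B \<and> card Z = i - card B}"
    by (rule bij_betw_same_card[symmetric])
  also have "\<dots> = card (A - B) choose (i - card B)" using assms(1) by (intro n_subsets) simp
  also have "card (A - B) = card A - card B" using finB assms(2) by (rule card_Diff_subset)
  finally show ?thesis using False by simp
qed

lemma coeff_one_plus_X_power: "coeff ([:1, 1:] ^ n) i = (of_nat (n choose i) :: rat)"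
proof (induction n arbitrary: i)
  case 0
  show ?case by (cases i) auto
next
  case (Suc n)
  show ?case by (cases i) (auto simp: Suc.IH coeff_pCons)
qed

lemma coeff_gamma_term:
  "coeff ([:0, 1:] ^ d * [:1, 1:] ^ n) i = (if i < d then 0 else of_nat (n choose (i - d)) :: rat)"
proof -
  have "[:0, 1 :: rat:] ^ d = monom 1 d" by (simp add: monom_altdef)
  then show ?thesis by (simp add: coeff_monom_mult coeff_one_plus_X_power)
qed

section \<open>Maximal nested sets and descents\<close>

text \<open>The total order is encoded by an injective position function.\<close>
locale complete_built = built_matroid +
  fixes pos :: "'a \<Rightarrow> nat"
  assumes pos_inj: "inj_on pos E"
    and pos_complete: "fl F \<Longrightarrow> G \<in> \<G> \<Longrightarrow> F \<subseteq> G \<Longrightarrow> cl (F \<union> {e \<in> G. pos e < n}) \<noteq> F \<Longrightarrow>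
      \<exists>H\<in>\<G>. cl (F \<union> {e \<in> G. pos e < n}) = cl (F \<union> H)"

context built_matroid
begin

lemma complete_position:
  assumes "complete E indep \<G>"
  obtains pos where "complete_built E indep \<G> pos"
proof -
  obtain es where *: "distinct es \<and> set es = E \<and> (\<forall>F G. fl F \<and> G \<in> \<G> \<and> F \<subseteq> G \<longrightarrow>
      chain_C E indep es F G \<subseteq> G_F_G E indep \<G> F G \<union> {F})"
    using assms unfolding complete_def by (elim exE)
  then have es: "distinct es" "set es = E" by simp_all
  have chain: "chain_C E indep es F G \<subseteq> G_F_G E indep \<G> F G \<union> {F}"
    if "fl F" "G \<in> \<G>" "F \<subseteq> G" for F G
    using * that by simp
  define pos where "pos = inv_into {..<length es} (nth es)"
  have bij: "bij_betw (nth es) {..<length es} E" using bij_betw_nth[OF es(1)] es(2) by simp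
  have pos_nth: "pos (es ! i) = i" if "i < length es" for i
    unfolding pos_def using bij that by (simp add: bij_betw_def)
  have take: "{e \<in> E. pos e < n} = set (take n es)" for n
  proof (intro set_eqI iffI)
    fix e assume e: "e \<in> {e \<in> E. pos e < n}"
    then obtain i where i: "i < length es" "e = es ! i" using es(2) by (auto simp: in_set_conv_nth)
    then have "i < n" using e pos_nth[of i] by simp
    then show "e \<in> set (take n es)" using i by (auto simp: in_set_conv_nth)
  next
    fix e assume e: "e \<in> set (take n es)"
    then obtain i where "i < n" "i < length es" "e = es ! i" by (auto simp: in_set_conv_nth)
    then show "e \<in> {e \<in> E. pos e < n}" using pos_nth[of i] es(2) nth_mem[of i es] by simp
  qed
  have "complete_built E indep \<G> pos"
  proof unfold_locales
    show "inj_on pos E" unfolding pos_def using bij by (simp add: bij_betw_def inj_on_inv_into)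
    fix F G n assume FG: "fl F" "G \<in> \<G>" "F \<subseteq> G" and ne: "cl (F \<union> {e \<in> G. pos e < n}) \<noteq> F"
    let ?P = "\<lambda>e. e \<in> G - F"
    \<comment> \<open>The elements of \<open>G\<close> outside \<open>F\<close> at positions below
      \<open>n\<close> form an initial segment of this list; those inside \<open>F\<close> do not
      change the closure.\<close>
    let ?l = "filter ?P es"
    have pre: "?l = filter ?P (take n es) @ filter ?P (drop n es)"
      by (metis append_take_drop_id filter_append)
    let ?i = "length (filter ?P (take n es))"
    have "take ?i ?l = filter ?P (take n es)" using pre by simp
    then have "set (take ?i ?l) = {e \<in> G - F. e \<in> set (take n es)}" by auto
    also have "\<dots> = {e \<in> G - F. pos e < n}"
      using take building_subset_E[OF FG(2)] by blast
    finally have "F \<union> set (take ?i ?l) = F \<union> {e \<in> G. pos e < n}" by auto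
    moreover have "?i \<le> length ?l" using pre by (metis le_add1 length_append)
    ultimately have "cl (F \<union> {e \<in> G. pos e < n}) \<in> chain_C E indep es F G"
      unfolding chain_C_def Let_def by (intro CollectI exI[of _ ?i]) auto
    then have "cl (F \<union> {e \<in> G. pos e < n}) \<in> G_F E indep \<G> F"
      using chain[OF FG] ne unfolding G_F_G_def by blast
    then show "\<exists>H\<in>\<G>. cl (F \<union> {e \<in> G. pos e < n}) = cl (F \<union> H)"
      unfolding G_F_def mjoin_def by auto
  qed
  then show thesis by (rule that)
qed

end

context complete_built
begin

text \<open>Maximal nested sets, seen as forests whose roots are the components of E. Maximality is
  expressed by rank steps of 1, which is the form used to recover an element from those below
  it.\<close>

definition tree :: "'a set set \<Rightarrow> bool" where
  "tree T \<longleftrightarrow> nst T \<and> comps E \<subseteq> T \<and> (\<forall>K\<in>T. rk K = rk (below T K) + 1)"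

definition lab :: "'a set set \<Rightarrow> 'a set \<Rightarrow> nat" where
  "lab T K = Min (pos ` (K - below T K))"

text \<open>\<open>P\<close> is the parent of \<open>K\<close>. Lying below every other strict
  superset makes it unique.\<close>

definition cov :: "'a set set \<Rightarrow> 'a set \<Rightarrow> 'a set \<Rightarrow> bool" where
  "cov T K P \<longleftrightarrow> K \<in> T \<and> P \<in> T \<and> K \<subset> P \<and> (\<forall>Q\<in>T. K \<subset> Q \<longrightarrow> P \<subseteq> Q)"

definition Asc :: "'a set set \<Rightarrow> 'a set set" where
  "Asc T = {K. \<exists>P. cov T K P \<and> lab T K < lab T P}"

definition Des :: "'a set set \<Rightarrow> 'a set set" where
  "Des T = {K. \<exists>P. cov T K P \<and> lab T P < lab T K}"

lemma tree_nst: "tree T \<Longrightarrow> nst T"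
  and tree_comps: "tree T \<Longrightarrow> comps E \<subseteq> T"
  and tree_rk: "tree T \<Longrightarrow> K \<in> T \<Longrightarrow> rk K = rk (below T K) + 1"
  unfolding tree_def by auto

lemma tree_building: "tree T \<Longrightarrow> K \<in> T \<Longrightarrow> K \<in> \<G>"
  using nested_subset_building tree_nst by blast

lemma tree_fl: "tree T \<Longrightarrow> K \<in> T \<Longrightarrow> fl K"
  using tree_building building_fl by blast

lemma finite_trees: "finite {T. tree T}"
  by (rule finite_subset[of _ "Pow \<G>"]) (use tree_building finite_building in auto)

lemma cov_unique: "cov T K P \<Longrightarrow> cov T K Q \<Longrightarrow> P = Q"
  unfolding cov_def by (simp add: subset_antisym)

lemma covD: "cov T K P \<Longrightarrow> K \<in> T" "cov T K P \<Longrightarrow> P \<in> T" "cov T K P \<Longrightarrow> K \<subset> P"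
    "cov T K P \<Longrightarrow> Q \<in> T \<Longrightarrow> K \<subset> Q \<Longrightarrow> P \<subseteq> Q"
  unfolding cov_def by simp_all

lemma cov_exists:
  assumes T: "nst T" and K: "K \<in> T" "X \<in> T" "K \<subset> X"
  obtains P where "cov T K P" "P \<subseteq> X"
proof -
  let ?U = "{Q \<in> T. K \<subset> Q}"
  have fin: "finite ?U" using nested_finite[OF T] by simp
  obtain P where P: "P \<in> ?U" "\<forall>Q\<in>?U. Q \<subseteq> P \<longrightarrow> P = Q"
    using finite_has_minimal[OF fin] K by auto
  have least: "P \<subseteq> Q" if "Q \<in> T" "K \<subset> Q" for Q
  proof -
    have "K \<noteq> {}" using K(1) nested_subset_building[OF T] building_nonempty by blast
    then have "P \<inter> Q \<noteq> {}" using P(1) that by blast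
    then have "P \<subseteq> Q \<or> Q \<subseteq> P" using nested_comparable[OF T, of P Q] P(1) that by blast
    then show ?thesis using P(2) that by blast
  qed
  have "cov T K P" unfolding cov_def using least P(1) K(1) by blast
  then show thesis using that least K by blast
qed

lemma lab_elem:
  assumes T: "nst T" and K: "K \<in> T"
  obtains e where "e \<in> K" "e \<notin> below T K" "pos e = lab T K"
proof -
  have KG: "K \<in> \<G>" using nested_subset_building[OF T] K by blast
  have "K - below T K \<noteq> {}" using below_neq[OF T KG] below_subset[of T K] by blast
  moreover have "finite (K - below T K)" using fl_finite[OF building_fl[OF KG]] by simp
  ultimately have "lab T K \<in> pos ` (K - below T K)" unfolding lab_def by (intro Min_in) auto
  then show thesis using that by auto
qed

lemma lab_le:
  assumes "nst T" "K \<in> T" "e \<in> K" "e \<notin> below T K"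
  shows "lab T K \<le> pos e"
proof -
  have "K \<in> \<G>" using nested_subset_building assms by blast
  then have "finite K" using fl_finite[OF building_fl] by blast
  then show ?thesis unfolding lab_def using assms by (intro Min_le) auto
qed

lemma tree_generate:
  assumes T: "tree T" and K: "K \<in> T" and e: "e \<in> K" "e \<notin> below T K"
  shows "cl (insert e (below T K)) = K"
proof (rule cl_eq_of_rk)
  show "insert e (below T K) \<subseteq> K" using e below_subset[of T K] by auto
  show "fl K" by (rule tree_fl[OF T K])
  have "e \<in> E" using e fl_subset_E[OF tree_fl[OF T K]] by blast
  then show "rk K \<le> rk (insert e (below T K))"
    using rk_insert_fl[OF fl_below[OF tree_nst[OF T]] _ e(2)] tree_rk[OF T K] by simp
qed

text \<open>The element attaining the label of \<open>P\<close> lies outside everything below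
  \<open>P\<close>, in particular outside \<open>K\<close>, and positions are injective.\<close>

lemma lab_cov_neq:
  assumes T: "nst T" and c: "cov T K P"
  shows "lab T K \<noteq> lab T P"
proof
  assume eq: "lab T K = lab T P"
  obtain e where e: "e \<in> K" "e \<notin> below T K" "pos e = lab T K" by (rule lab_elem[OF T covD(1)[OF c]])
  obtain f where f: "f \<in> P" "f \<notin> below T P" "pos f = lab T P" by (rule lab_elem[OF T covD(2)[OF c]])
  have TG: "T \<subseteq> \<G>" by (rule nested_subset_building[OF T])
  have "K \<subseteq> E" "P \<subseteq> E" using covD(1,2)[OF c] TG building_subset_E by auto
  then have "e = f" using inj_onD[OF pos_inj, of e f] e f eq by auto
  moreover have "K \<subseteq> below T P" unfolding below_def using covD[OF c] by blast
  ultimately show False using e f by blast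
qed

lemma Asc_sub: "Asc T \<subseteq> T" and Des_sub: "Des T \<subseteq> T"
  unfolding Asc_def Des_def using covD(1) by blast+

lemma Asc_Des_disjoint: "Asc T \<inter> Des T = {}"
proof -
  have False if K: "K \<in> Asc T" "K \<in> Des T" for K
  proof -
    obtain P where P: "cov T K P" "lab T K < lab T P" using K(1) unfolding Asc_def by blast
    obtain Q where Q: "cov T K Q" "lab T Q < lab T K" using K(2) unfolding Des_def by blast
    show False using cov_unique[OF P(1) Q(1)] P Q by simp
  qed
  then show ?thesis by blast
qed

lemma comps_not_cov: "C \<in> comps E \<Longrightarrow> T \<subseteq> \<G> \<Longrightarrow> \<not> cov T C P"
  using comps_maximal[of C E P] covD(2)[of T C P] covD(3)[of T C P] building_subset_E by blast

lemma tree_partition: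
  assumes T: "tree T"
  shows "T = Asc T \<union> Des T \<union> comps E" "(Asc T \<union> Des T) \<inter> comps E = {}"
proof -
  have TG: "T \<subseteq> \<G>" using tree_building[OF T] by blast
  show "(Asc T \<union> Des T) \<inter> comps E = {}"
    unfolding Asc_def Des_def using comps_not_cov[OF _ TG] by blast
  have "K \<in> Asc T \<union> Des T \<union> comps E" if K: "K \<in> T" for K
  proof -
    have "K \<in> \<G>" using K TG by blast
    then obtain C where C: "C \<in> comps E" "K \<subseteq> C" using in_comps_above building_subset_E by metis
    show ?thesis
    proof (cases "K = C")
      case True then show ?thesis using C by simp
    next
      case False
      then have "K \<subset> C" "C \<in> T" using C tree_comps[OF T] by auto
      then obtain P where P: "cov T K P" using cov_exists[OF tree_nst[OF T] K] by blast
      have "lab T K < lab T P \<or> lab T P < lab T K" using lab_cov_neq[OF tree_nst[OF T] P] by linarith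
      then show ?thesis using P unfolding Asc_def Des_def by blast
    qed
  qed
  then show "T = Asc T \<union> Des T \<union> comps E"
    using Asc_sub[of T] Des_sub[of T] tree_comps[OF T] by blast
qed

text \<open>Removing a maximal element lowers the rank of the union by its rank step, which is 1 in
  a tree.\<close>

lemma tree_rk_downset:
  assumes T: "tree T" and A: "A \<subseteq> T" "\<And>K. K \<in> A \<Longrightarrow> {X \<in> T. X \<subset> K} \<subseteq> A"
  shows "rk (\<Union>A) = card A"
  using A
proof (induction "card A" arbitrary: A)
  case 0
  have "finite A" using finite_subset[OF 0(2) nested_finite[OF tree_nst[OF T]]] .
  then show ?case using 0 by simp
next
  case (Suc n)
  have finA: "finite A" using finite_subset[OF Suc.prems(1) nested_finite[OF tree_nst[OF T]]] .
  have "A \<noteq> {}" using Suc.hyps(2) by auto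
  then obtain K where K: "K \<in> A" "\<And>X. X \<in> A \<Longrightarrow> K \<subseteq> X \<Longrightarrow> X = K"
    using finite_has_maximal[OF finA] by auto
  have KT: "K \<in> T" using K Suc.prems(1) by blast
  have "rk (\<Union>A) + rk (below T K) = rk K + rk (\<Union>(A - {K}))"
    by (rule rk_remove_maximal[OF tree_nst[OF T] Suc.prems(1) K Suc.prems(2)[OF K(1)]])
  moreover have "rk (\<Union>(A - {K})) = card (A - {K})"
  proof (rule Suc.hyps(1))
    show "n = card (A - {K})" using Suc.hyps(2) finA K(1) by simp
    show "A - {K} \<subseteq> T" using Suc.prems(1) by blast
    show "{X \<in> T. X \<subset> L} \<subseteq> A - {K}" if L: "L \<in> A - {K}" for L
    proof -
      have "\<not> K \<subset> L" using K(2)[of L] L by blast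
      then show ?thesis using Suc.prems(2)[of L] L by blast
    qed
  qed
  ultimately show ?case using tree_rk[OF T KT] Suc.hyps(2) finA K(1) by simp
qed

lemma card_tree: "tree T \<Longrightarrow> card T = rk E"
proof -
  assume T: "tree T"
  have "\<Union>T = E"
    using tree_comps[OF T] Union_comps[OF fl_E] tree_fl[OF T] fl_subset_E by blast
  then show ?thesis using tree_rk_downset[OF T subset_refl] by simp
qed

section \<open>Enlarging a nested set without new descents\<close>

lemma nested_insert_comp:
  assumes S: "nst S" and C: "C \<in> comps E"
  shows "nst (insert C S)"
proof (rule nestedI)
  show SG: "insert C S \<subseteq> \<G>" using nested_subset_building[OF S] compsD(1)[OF C] by blast
  fix A assume A: "A \<subseteq> insert C S" "antichain A" "2 \<le> card A" "cl (\<Union>A) \<in> \<G>"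
  have "C \<in> A" using nestedD[OF S _ A(2,3)] A(1,4) by blast
  have UE: "\<Union>A \<subseteq> E" using A(1) SG building_subset_E by blast
  have "C \<subseteq> cl (\<Union>A)" using subset_cl[OF UE] \<open>C \<in> A\<close> by blast
  then have "cl (\<Union>A) = C" using comps_maximal[OF C A(4) cl_subset_E] by simp
  then have "X = C" if "X \<in> A" for X using that subset_cl[OF UE] A(2) \<open>C \<in> A\<close> by blast
  then have "A \<subseteq> {C}" by blast
  then show False using card_mono[of "{C}" A] A(3) by simp
qed

text \<open>A violating antichain contains \<open>K\<close>. If a member leaves \<open>G\<close>,
  the members inside \<open>G\<close> can be replaced by \<open>G\<close>, which contradicts
  nestedness of \<open>S\<close>. Otherwise all members lie in \<open>Z\<close>, so their join is a
  building element between \<open>K\<close> and \<open>Z\<close>, hence equal to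
  \<open>K\<close>.\<close>

lemma nested_insert_below:
  assumes S: "nst S" and G: "G \<in> S" and Z: "fl Z" "below S G \<subseteq> Z"
    and K: "K \<in> comps Z" "K \<subset> G"
  shows "nst (insert K S)"
proof (rule nestedI)
  show SG: "insert K S \<subseteq> \<G>" using nested_subset_building[OF S] compsD(1)[OF K(1)] by blast
  fix A assume A: "A \<subseteq> insert K S" "antichain A" "2 \<le> card A" "cl (\<Union>A) \<in> \<G>"
  have KA: "K \<in> A" using nestedD[OF S _ A(2,3)] A(1,4) by blast
  have Kne: "K \<noteq> {}" using building_nonempty compsD(1)[OF K(1)] by blast
  have UE: "\<Union>A \<subseteq> E" using A(1) SG building_subset_E by blast
  have GG: "G \<in> \<G>" using G SG by blast
  have sJ: "X \<subseteq> cl (\<Union>A)" if "X \<in> A" for X using subset_cl[OF UE] that by blast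
  show False
  proof (cases "\<exists>X\<in>A. \<not> X \<subseteq> G")
    case True
    then obtain X where X: "X \<in> A" "\<not> X \<subseteq> G" by blast
    define A' where "A' = insert G {X \<in> A. \<not> X \<subseteq> G}"
    have incomp: "\<not> G \<subseteq> Y" if "Y \<in> A" for Y
    proof
      assume "G \<subseteq> Y"
      then have "K \<subset> Y" using K(2) by blast
      then show False using A(2) KA that by blast
    qed
    have A'S: "A' \<subseteq> S" using A(1) G K(2) unfolding A'_def by blast
    have anti: "antichain A'" unfolding A'_def using incomp A(2) by blast
    have "X \<noteq> G" using X by blast
    then have "card {X, G} = 2" by simp
    moreover have "{X, G} \<subseteq> A'" using X unfolding A'_def by blast
    moreover have "finite A'" using A'S nested_finite[OF S] finite_subset by blast
    ultimately have c: "2 \<le> card A'" using card_mono by metis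
    have "cl (\<Union>A) \<inter> G \<noteq> {}" using sJ[OF KA] K(2) Kne by blast
    then have "cl (cl (\<Union>A) \<union> G) \<in> \<G>" by (rule building_join[OF A(4) GG])
    then have "cl (\<Union>A \<union> G) \<in> \<G>" using cl_Un_cl[OF UE building_subset_E[OF GG]] by simp
    moreover have "\<Union>A \<union> G = \<Union>A'" unfolding A'_def by blast
    ultimately show False using nestedD[OF S A'S anti c] by simp
  next
    case False
    have "X \<subseteq> Z" if X: "X \<in> A" for X
    proof (cases "X = K")
      case True then show ?thesis using compsD(2)[OF K(1)] by simp
    next
      case False
      then have XS: "X \<in> S" using X A(1) by blast
      have "X \<noteq> G" using A(2) X KA K(2) by blast
      then have "X \<subset> G" using \<open>\<not> (\<exists>X\<in>A. \<not> X \<subseteq> G)\<close> X by blast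
      then have "X \<subseteq> below S G" using XS unfolding below_def by blast
      then show ?thesis using Z(2) by blast
    qed
    then have "cl (\<Union>A) \<subseteq> Z" by (intro cl_least[OF Z(1)]) blast
    then have "cl (\<Union>A) = K" using comps_maximal[OF K(1) A(4)] sJ[OF KA] by simp
    then have "X = K" if "X \<in> A" for X using sJ[OF that] A(2) KA that by blast
    then have "A \<subseteq> {K}" by blast
    then show False using card_mono[of "{K}" A] A(3) by simp
  qed
qed

lemma tree_below_eq:
  assumes T: "tree T" and G: "G \<in> T" and Z: "fl Z" "Z \<subseteq> below T G" "rk G = rk Z + 1"
  shows "below T G = Z"
  using fl_eq_of_rk[OF Z(1,2)] tree_rk[OF T G] Z(3) fl_subset_E[OF fl_below[OF tree_nst[OF T]]] by simp

text \<open>Elements of \<open>G\<close> are added to \<open>F\<close> in order until they generate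
  \<open>G\<close>. Each step raises the rank by at most 1, so the last proper stage is a
  hyperplane, and the rank gap keeps it different from \<open>F\<close>. Completeness makes it the
  join of \<open>F\<close> with one building element, and K is the component containing that
  element.\<close>

lemma greedy_hyperplane:
  assumes F: "fl F" "F \<subset> G" "rk F + 1 < rk G" and G: "G \<in> \<G>"
  obtains n K where "cl (F \<union> {e \<in> G. pos e < n}) \<subset> G"
    "rk G = rk (cl (F \<union> {e \<in> G. pos e < n})) + 1"
    "K \<in> comps (cl (F \<union> {e \<in> G. pos e < n}))" "\<not> K \<subseteq> F"
    "cl (F \<union> K) = cl (F \<union> {e \<in> G. pos e < n})"
proof -
  define Z where "Z n = cl (F \<union> {e \<in> G. pos e < n})" for n
  have FE: "F \<union> {e \<in> G. pos e < n} \<subseteq> G" for n using F by auto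
  have GE: "G \<subseteq> E" using building_subset_E[OF G] .
  have FnE: "F \<union> {e \<in> G. pos e < n} \<subseteq> E" for n using FE GE by blast
  have ZG: "Z n \<subseteq> G" for n unfolding Z_def using cl_least[OF building_fl[OF G] FE] .
  have flZ: "fl (Z n)" for n unfolding Z_def using fl_cl[OF FnE] .
  have sZ: "F \<union> {e \<in> G. pos e < n} \<subseteq> Z n" for n unfolding Z_def using subset_cl[OF FnE] .
  have "finite G" using fl_finite[OF building_fl[OF G]] .
  then have "pos e < Suc (Max (pos ` G))" if "e \<in> G" for e
    using that by (simp add: less_Suc_eq_le)
  then have "G \<subseteq> Z (Suc (Max (pos ` G)))" using sZ[of "Suc (Max (pos ` G))"] by blast
  then have ex: "\<exists>n. Z n = G" using ZG by blast
  \<comment> \<open>The least threshold at which \<open>G\<close> is generated; its predecessor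
    \<open>n\<close> gives the hyperplane.\<close>
  define N where "N = (LEAST n. Z n = G)"
  have ZN: "Z N = G" unfolding N_def using LeastI_ex[OF ex] .
  have "Z 0 = F" unfolding Z_def using fl_cl_eq[OF F(1)] by simp
  then have "N \<noteq> 0" using ZN F(2) by (intro notI) simp
  then obtain n where n: "N = Suc n" by (cases N) auto
  have Zn: "Z n \<noteq> G" using not_less_Least[of n "\<lambda>n. Z n = G"] n unfolding N_def by simp
  have "rk (Z N) \<le> rk (Z n) + 1"
  proof (cases "\<exists>e\<in>G. pos e = n")
    case True
    then obtain e0 where e0: "e0 \<in> G" "pos e0 = n" by blast
    have "{e \<in> G. pos e < Suc n} \<subseteq> insert e0 {e \<in> G. pos e < n}"
    proof
      fix e assume e: "e \<in> {e \<in> G. pos e < Suc n}"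
      show "e \<in> insert e0 {e \<in> G. pos e < n}"
      proof (cases "pos e = n")
        case True
        then have "e = e0" using pos_inj e0 e GE unfolding inj_on_def by blast
        then show ?thesis by simp
      next
        case False then show ?thesis using e by auto
      qed
    qed
    then have "F \<union> {e \<in> G. pos e < Suc n} \<subseteq> insert e0 (F \<union> {e \<in> G. pos e < n})" by blast
    then have "rk (F \<union> {e \<in> G. pos e < Suc n}) \<le> rk (F \<union> {e \<in> G. pos e < n}) + 1"
      using rk_mono rk_insert_le order_trans by blast
    then show ?thesis unfolding Z_def n by (simp add: rk_cl[OF FnE])
  next
    case False
    then have "{e \<in> G. pos e < Suc n} = {e \<in> G. pos e < n}" by (auto simp: less_Suc_eq)
    then show ?thesis unfolding Z_def n by simp
  qed
  moreover have "rk (Z n) < rk G"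
    using rk_less_of_not_subset[OF flZ ZG GE] Zn ZG[of n] by blast
  ultimately have rZ: "rk G = rk (Z n) + 1" unfolding ZN by simp
  then have "Z n \<noteq> F" using F(3) by auto
  then obtain H where H: "H \<in> \<G>" "Z n = cl (F \<union> H)"
    using pos_complete[OF F(1) G, of n] F(2) unfolding Z_def by blast
  have HE: "F \<union> H \<subseteq> E" using fl_subset_E[OF F(1)] building_subset_E[OF H(1)] by blast
  have HZ: "H \<subseteq> Z n" using subset_cl[OF HE] H(2) by blast
  obtain K where K: "K \<in> comps (Z n)" "H \<subseteq> K" by (rule in_comps_above[OF H(1) HZ])
  have "\<not> K \<subseteq> F"
  proof
    assume "K \<subseteq> F"
    then have "F \<union> H = F" using K(2) by blast
    then show False using H(2) \<open>Z n \<noteq> F\<close> fl_cl_eq[OF F(1)] by simp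
  qed
  moreover have "cl (F \<union> K) = Z n"
  proof
    have "F \<subseteq> Z n" using sZ by blast
    then show "cl (F \<union> K) \<subseteq> Z n" using compsD(2)[OF K(1)] by (intro cl_least[OF flZ]) blast
    show "Z n \<subseteq> cl (F \<union> K)" unfolding H(2) using K(2) by (intro cl_mono) blast
  qed
  ultimately show thesis using that[of n K] ZG[of n] Zn rZ K(1) unfolding Z_def by blast
qed

text \<open>The threshold \<open>n\<close> separates the labels. The parent of \<open>K\<close> is
  \<open>G\<close>, with label at least \<open>n\<close> because \<open>Z\<close> has absorbed all
  earlier elements of \<open>G\<close>. The label of \<open>K\<close> is below \<open>n\<close>,
  since otherwise the generators of \<open>Z\<close> inside \<open>K\<close> would lie in
  \<open>below T K\<close>, whose rank is too small.\<close>

lemma greedy_not_descent: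
  assumes T: "tree T" and S: "S \<subseteq> T" and G: "G \<in> S" and K: "K \<in> T" "K \<notin> S"
    and Z: "Z = cl (below S G \<union> {e \<in> G. pos e < n})" "Z \<subset> G" "rk G = rk Z + 1"
    and KZ: "K \<in> comps Z" "\<not> K \<subseteq> below S G" "cl (below S G \<union> K) = Z"
  shows "K \<notin> Des T"
proof
  assume "K \<in> Des T"
  then obtain P where P: "cov T K P" "lab T P < lab T K" unfolding Des_def by blast
  have nT: "nst T" by (rule tree_nst[OF T])
  have GT: "G \<in> T" using G S by blast
  have GG: "G \<in> \<G>" by (rule tree_building[OF T GT])
  have GE: "G \<subseteq> E" by (rule building_subset_E[OF GG])
  have sub: "below S G \<union> {e \<in> G. pos e < n} \<subseteq> G" using below_subset[of S G] by auto
  then have subE: "below S G \<union> {e \<in> G. pos e < n} \<subseteq> E" using GE by blast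
  have flZ: "fl Z" unfolding Z(1) by (rule fl_cl[OF subE])
  have sZ: "below S G \<union> {e \<in> G. pos e < n} \<subseteq> Z" unfolding Z(1) by (rule subset_cl[OF subE])
  have KG: "K \<subset> G" using compsD(2)[OF KZ(1)] Z(2) by blast
  have "K \<subseteq> below T G" unfolding below_def using KG K(1) by blast
  moreover have "below S G \<subseteq> below T G" by (rule below_mono[OF S])
  ultimately have "cl (below S G \<union> K) \<subseteq> below T G" by (intro cl_least[OF fl_below[OF nT]]) blast
  \<comment> \<open>\<open>Z\<close> is generated by sets below \<open>G\<close> in \<open>T\<close>
    and has rank one less than \<open>G\<close>, which is the rank of
    \<open>below T G\<close>.\<close>
  then have bT: "below T G = Z" using tree_below_eq[OF T GT flZ _ Z(3)] KZ(3) by simp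
  have PG: "P = G"
  proof (rule ccontr)
    assume "P \<noteq> G"
    then have "P \<subset> G" using covD(4)[OF P(1) GT KG] by blast
    then have "P \<subseteq> Z" using bT covD(2)[OF P(1)] unfolding below_def by blast
    then have "P = K"
      using comps_maximal[OF KZ(1) tree_building[OF T covD(2)[OF P(1)]]] covD(3)[OF P(1)] by blast
    then show False using covD(3)[OF P(1)] by blast
  qed
  have "n \<le> lab T G"
  proof (rule ccontr)
    assume "\<not> n \<le> lab T G"
    moreover obtain e where e: "e \<in> G" "e \<notin> below T G" "pos e = lab T G" by (rule lab_elem[OF nT GT])
    ultimately have "e \<in> Z" using sZ by auto
    then show False using e bT by simp
  qed
  moreover have "lab T K < n"
  proof (rule ccontr)
    assume "\<not> lab T K < n"
    then have big: "n \<le> pos e" if "e \<in> K" "e \<notin> below T K" for e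
      using lab_le[OF nT K(1) that] by linarith
    let ?R = "below T K"
    have "below S G \<union> {e \<in> G. pos e < n} \<subseteq> ?R \<union> (Z - K)"
    proof
      fix e assume e: "e \<in> below S G \<union> {e \<in> G. pos e < n}"
      show "e \<in> ?R \<union> (Z - K)"
      proof (cases "e \<in> K")
        case False
        then show ?thesis using e sZ by blast
      next
        case True
        show ?thesis
        proof (cases "e \<in> below S G")
          case True
          then obtain X where X: "X \<in> S" "X \<subset> G" "e \<in> X" unfolding below_def by blast
          have "X \<subseteq> K \<or> K \<subseteq> X"
            using nested_comparable[OF nT, of X K] X \<open>e \<in> K\<close> S K(1) by blast
          moreover have "\<not> K \<subseteq> X" using KZ(2) X unfolding below_def by blast
          ultimately have "X \<subset> K" by blast
          then show ?thesis using X S unfolding below_def by blast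
        next
          case False
          then have "pos e < n" using e by blast
          then show ?thesis using big[OF \<open>e \<in> K\<close>] by force
        qed
      qed
    qed
    then have "rk Z \<le> rk (?R \<union> (Z - K))"
      unfolding Z(1) rk_cl[OF subE] by (rule rk_mono)
    also have "\<dots> = rk ?R + rk (Z - K)"
      by (rule comps_split[OF flZ KZ(1) below_subset]) simp
    also have "\<dots> < rk K + rk (Z - K)" using tree_rk[OF T K(1)] by simp
    also have "\<dots> = rk (K \<union> (Z - K))"
      by (rule comps_split[OF flZ KZ(1), symmetric]) auto
    also have "K \<union> (Z - K) = Z" using compsD(2)[OF KZ(1)] by blast
    finally show False by simp
  qed
  ultimately show False using P(2) PG by simp
qed

text \<open>Elements are added that are not descents in any tree containing the enlarged set: a
  missing component of E, or the greedy component below some G with rank step greater than 1. The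
  claim covers all such trees because the final one is known only at the end.\<close>

lemma tree_exists: "nst S \<Longrightarrow> \<exists>T. tree T \<and> S \<subseteq> T \<and> Des T \<subseteq> S"
proof (induction "card \<G> - card S" arbitrary: S rule: less_induct)
  case less
  note S = less.prems
  have step: "\<exists>T. tree T \<and> S \<subseteq> T \<and> Des T \<subseteq> S"
    if K: "K \<notin> S" "nst (insert K S)" and notDes: "\<And>T. tree T \<Longrightarrow> insert K S \<subseteq> T \<Longrightarrow> K \<notin> Des T" for K
  proof -
    have "card (insert K S) \<le> card \<G>"
      using nested_subset_building[OF K(2)] finite_building by (rule card_mono[rotated])
    then have "card \<G> - card (insert K S) < card \<G> - card S"
      using K(1) nested_finite[OF S] by simp
    then obtain T where "tree T" "insert K S \<subseteq> T" "Des T \<subseteq> insert K S" using less.hyps K(2) by blast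
    then show ?thesis using notDes[of T] by blast
  qed
  show ?case
  proof (cases "comps E \<subseteq> S")
    case False
    then obtain C where C: "C \<in> comps E" "C \<notin> S" by blast
    show ?thesis
    proof (rule step[OF C(2) nested_insert_comp[OF S C(1)]])
      fix T assume "tree T"
      then show "C \<notin> Des T" using tree_partition(2) C(1) by blast
    qed
  next
    case True
    show ?thesis
    proof (cases "tree S")
      case True
      then show ?thesis using Des_sub by blast
    next
      case False
      then obtain G where G: "G \<in> S" "rk G \<noteq> rk (below S G) + 1"
        unfolding tree_def using S True by blast
      have GG: "G \<in> \<G>" using nested_subset_building[OF S] G(1) by blast
      have F: "fl (below S G)" "below S G \<subset> G" "rk (below S G) + 1 < rk G"
        using fl_below[OF S] below_subset[of S G] below_neq[OF S GG] rk_below_less[OF S GG] G(2) by auto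
      obtain n K where Z: "cl (below S G \<union> {e \<in> G. pos e < n}) \<subset> G"
          "rk G = rk (cl (below S G \<union> {e \<in> G. pos e < n})) + 1"
        and K: "K \<in> comps (cl (below S G \<union> {e \<in> G. pos e < n}))" "\<not> K \<subseteq> below S G"
          "cl (below S G \<union> K) = cl (below S G \<union> {e \<in> G. pos e < n})"
        by (rule greedy_hyperplane[OF F GG])
      have subE: "below S G \<union> {e \<in> G. pos e < n} \<subseteq> E"
        using F(2) building_subset_E[OF GG] by blast
      have KG: "K \<subset> G" using compsD(2)[OF K(1)] Z(1) by blast
      have "K \<notin> S" using K(2) KG unfolding below_def by blast
      then show ?thesis
      proof (rule step)
        show "nst (insert K S)"
          by (rule nested_insert_below[OF S G(1) fl_cl[OF subE] _ K(1) KG]) (use subset_cl[OF subE] in blast)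
        fix T assume T: "tree T" "insert K S \<subseteq> T"
        show "K \<notin> Des T"
          by (rule greedy_not_descent[OF T(1) _ G(1) _ \<open>K \<notin> S\<close> refl Z K]) (use T(2) in auto)
      qed
    qed
  qed
qed

text \<open>An element of \<open>T\<close> below \<open>P\<close>, but not under an element of
  \<open>S\<close> below \<open>P\<close>, reaches \<open>P\<close> through ascents alone, since
  descents belong to \<open>S\<close>. So its label is smaller than that of \<open>P\<close>, and it
  is generated by its label element and what is below it. Given \<open>S\<close> and
  \<open>P\<close>, only one number depends on \<open>T\<close>.\<close>

lemma tree_below_greedy:
  assumes T: "tree T" and S: "S \<subseteq> T" "Des T \<subseteq> S" and P: "P \<in> T"
  shows "below T P = cl (below S P \<union> {e \<in> P. pos e < lab T P})" (is "_ = ?R")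
proof
  have nT: "nst T" by (rule tree_nst[OF T])
  have PE: "P \<subseteq> E" by (rule fl_subset_E[OF tree_fl[OF T P]])
  have subE: "below S P \<union> {e \<in> P. pos e < lab T P} \<subseteq> E" using below_subset[of S P] PE by auto
  have flR: "fl ?R" by (rule fl_cl[OF subE])
  have sR: "below S P \<union> {e \<in> P. pos e < lab T P} \<subseteq> ?R" by (rule subset_cl[OF subE])
  \<comment> \<open>Induction up the tree: the parent of \<open>K\<close> is again not under an
    element of \<open>S\<close> below \<open>P\<close>, unless it is \<open>P\<close>
    itself.\<close>
  have small: "lab T K < lab T P" if "K \<in> T" "K \<subset> P" "\<not> (\<exists>X\<in>S. K \<subseteq> X \<and> X \<subset> P)" for K
    using that
  proof (induction "card P - card K" arbitrary: K rule: less_induct)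
    case less
    obtain Q where Q: "cov T K Q" "Q \<subseteq> P" by (rule cov_exists[OF nT less.prems(1) P less.prems(2)])
    have "K \<notin> Des T" using less.prems S by blast
    then have KQ: "lab T K < lab T Q" using Q(1) lab_cov_neq[OF nT Q(1)] unfolding Des_def by force
    show ?case
    proof (cases "Q = P")
      case True then show ?thesis using KQ by simp
    next
      case False
      then have QP: "Q \<subset> P" using Q(2) by blast
      have fin: "finite Q" "finite P" using fl_finite tree_fl[OF T] covD(2)[OF Q(1)] P by auto
      have "card K < card Q" "card Q < card P"
        using psubset_card_mono fin covD(3)[OF Q(1)] QP by auto
      then have "card P - card Q < card P - card K" by linarith
      moreover have "\<not> (\<exists>X\<in>S. Q \<subseteq> X \<and> X \<subset> P)" using less.prems(3) covD(3)[OF Q(1)] by blast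
      ultimately have "lab T Q < lab T P" using less.hyps[of Q] covD(2)[OF Q(1)] QP by blast
      then show ?thesis using KQ by simp
    qed
  qed
  have "K \<subseteq> ?R" if "K \<in> T" "K \<subset> P" for K
    using that
  proof (induction "card K" arbitrary: K rule: less_induct)
    case less
    show ?case
    proof (cases "\<exists>X\<in>S. K \<subseteq> X \<and> X \<subset> P")
      case True
      then have "K \<subseteq> below S P" unfolding below_def by blast
      then show ?thesis using sR by blast
    next
      case False
      obtain e where e: "e \<in> K" "e \<notin> below T K" "pos e = lab T K" by (rule lab_elem[OF nT less.prems(1)])
      have "e \<in> ?R" using small[OF less.prems False] e less.prems(2) sR by auto
      moreover have "X \<subseteq> ?R" if X: "X \<in> T" "X \<subset> K" for X
      proof (rule less.hyps)
        show "card X < card K" using psubset_card_mono[OF fl_finite[OF tree_fl[OF T less.prems(1)]] X(2)] .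
        show "X \<in> T" "X \<subset> P" using X less.prems by auto
      qed
      ultimately have "insert e (below T K) \<subseteq> ?R" unfolding below_def by blast
      then show ?thesis using cl_least[OF flR] tree_generate[OF T less.prems(1) e(1,2)] by blast
    qed
  qed
  then show "below T P \<subseteq> ?R" unfolding below_def by blast
  have "e \<in> below T P" if "e \<in> P" "pos e < lab T P" for e
    using lab_le[OF nT P that(1)] that(2) by linarith
  then show "?R \<subseteq> below T P"
    using below_mono[OF S(1), of P] by (intro cl_least[OF fl_below[OF nT]]) blast
qed

text \<open>By \<open>tree_below_greedy\<close> the two flats differ only in a threshold, so one
  contains the other. Both have rank one less than \<open>P\<close>, hence they are equal.\<close>

lemma tree_below_unique:
  assumes T: "tree T" "S \<subseteq> T" "Des T \<subseteq> S" and T': "tree T'" "S \<subseteq> T'" "Des T' \<subseteq> S"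
    and P: "P \<in> T" "P \<in> T'"
  shows "below T P = below T' P"
proof -
  have *: "below T P = below T' P"
    if T: "tree T" "S \<subseteq> T" "Des T \<subseteq> S" and T': "tree T'" "S \<subseteq> T'" "Des T' \<subseteq> S"
    and P: "P \<in> T" "P \<in> T'" and le: "lab T P \<le> lab T' P" for T T'
  proof -
    have "below T P \<subseteq> below T' P"
      unfolding tree_below_greedy[OF T P(1)] tree_below_greedy[OF T' P(2)] using le by (intro cl_mono) auto
    then show ?thesis
      using tree_below_eq[OF T'(1) P(2) fl_below[OF tree_nst[OF T(1)]] _ tree_rk[OF T(1) P(1)]] by simp
  qed
  show ?thesis
  proof (cases "lab T P \<le> lab T' P")
    case True then show ?thesis by (rule *[OF T T' P])
  next
    case False
    then show ?thesis by (intro *[OF T' T P(2,1), symmetric]) simp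
  qed
qed

text \<open>The trees agree from the roots downwards: a child of P is a component of
  \<open>below T P\<close>, and this flat is the same for both.\<close>

lemma tree_unique:
  assumes T: "tree T" "S \<subseteq> T" "Des T \<subseteq> S" and T': "tree T'" "S \<subseteq> T'" "Des T' \<subseteq> S"
  shows "T = T'"
proof -
  have *: "K \<in> T'"
    if T: "tree T" "S \<subseteq> T" "Des T \<subseteq> S" and T': "tree T'" "S \<subseteq> T'" "Des T' \<subseteq> S" and K: "K \<in> T" for T T' K
    using K
  proof (induction "card E - card K" arbitrary: K rule: less_induct)
    case less
    have nT: "nst T" by (rule tree_nst[OF T(1)])
    show ?case
    proof (cases "K \<in> comps E")
      case True then show ?thesis using tree_comps[OF T'(1)] by blast
    next
      case False
      then have "K \<in> Asc T \<union> Des T" using tree_partition(1)[OF T(1)] less.prems by blast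
      then obtain P where P: "cov T K P" unfolding Asc_def Des_def by blast
      have PE: "P \<subseteq> E" by (rule fl_subset_E[OF tree_fl[OF T(1) covD(2)[OF P]]])
      have "card P \<le> card E" using PE finite_E by (rule card_mono[rotated])
      moreover have "card K < card P"
        using psubset_card_mono[OF finite_subset[OF PE finite_E] covD(3)[OF P]] .
      ultimately have "P \<in> T'" using less.hyps[of P] covD(2)[OF P] by simp
      then have eq: "below T P = below T' P" by (rule tree_below_unique[OF T T' covD(2)[OF P]])
      have "K \<in> comps (below T P)"
        unfolding comps_below[OF nT] using covD[OF P] by blast
      then show ?thesis unfolding eq comps_below[OF tree_nst[OF T'(1)]] by blast
    qed
  qed
  show ?thesis using *[OF T T'] *[OF T' T] by blast
qed

text \<open>Two ascending children would both be generated from \<open>?F0\<close> by elements of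
  \<open>P\<close> before its label. By completeness a single building element then suffices to
  generate them, and it lies below one member of the tree. That member differs from \<open>K\<close>
  or from \<open>L\<close>, which is thus covered by the others.\<close>

lemma asc_child_unique:
  assumes T: "tree T" and c: "cov T K P" "cov T L P" and asc: "lab T K < lab T P" "lab T L < lab T P"
  shows "K = L"
proof (rule ccontr)
  assume KL: "K \<noteq> L"
  have nT: "nst T" by (rule tree_nst[OF T])
  let ?C = "{X \<in> T. X \<subset> P}"
  \<comment> \<open>Only \<open>K\<close> and \<open>L\<close> themselves are left out; their
    descendants remain, so one further element generates each of them.\<close>
  let ?F0 = "\<Union>(?C - {K, L})"
  have PT: "P \<in> T" by (rule covD(2)[OF c(1)])
  have PG: "P \<in> \<G>" by (rule tree_building[OF T PT])
  have PE: "P \<subseteq> E" by (rule building_subset_E[OF PG])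
  have miss: "\<not> M \<subseteq> \<Union>(?C - {M})" if M: "cov T M P" for M
  proof
    assume "M \<subseteq> \<Union>(?C - {M})"
    then obtain X where X: "X \<in> ?C - {M}" "M \<subseteq> X"
      using nested_below_Union[OF nT _ tree_building[OF T covD(1)[OF M]], of "?C - {M}"] by blast
    then have "P \<subseteq> X" using covD(4)[OF M, of X] by blast
    then show False using X by blast
  qed
  have flU: "fl (\<Union>A)" if "A \<subseteq> T" for A by (rule nested_comps(2)[OF nT that])
  have flF0: "fl ?F0" by (rule flU) blast
  let ?Z = "cl (?F0 \<union> {e \<in> P. pos e < lab T P})"
  have subE: "?F0 \<union> {e \<in> P. pos e < lab T P} \<subseteq> E" using PE by blast
  have sZ: "?F0 \<union> {e \<in> P. pos e < lab T P} \<subseteq> ?Z" by (rule subset_cl[OF subE])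
  have Z_sub: "?Z \<subseteq> below T P"
  proof (rule cl_least[OF fl_below[OF nT]])
    have "e \<in> below T P" if "e \<in> P" "pos e < lab T P" for e
      using lab_le[OF nT PT that(1)] that(2) by linarith
    then show "?F0 \<union> {e \<in> P. pos e < lab T P} \<subseteq> below T P" unfolding below_def by blast
  qed
  have child: "M \<subseteq> ?Z" if M: "cov T M P" "lab T M < lab T P" "M \<in> {K, L}" for M
  proof -
    obtain e where e: "e \<in> M" "e \<notin> below T M" "pos e = lab T M" by (rule lab_elem[OF nT covD(1)[OF M(1)]])
    have "e \<in> ?Z" using sZ e M(2) covD(3)[OF M(1)] by auto
    moreover have "X \<subseteq> ?Z" if X: "X \<in> T" "X \<subset> M" for X
    proof -
      have "X \<subset> P" using X covD(3)[OF M(1)] by blast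
      moreover have "X \<noteq> K" using covD(4)[OF c(1), of M] covD(1,3)[OF M(1)] X by blast
      moreover have "X \<noteq> L" using covD(4)[OF c(2), of M] covD(1,3)[OF M(1)] X by blast
      ultimately show ?thesis using X(1) sZ by blast
    qed
    ultimately have "insert e (below T M) \<subseteq> ?Z" unfolding below_def by blast
    then show ?thesis
      using cl_least[OF fl_cl[OF subE]] tree_generate[OF T covD(1)[OF M(1)] e(1,2)] by blast
  qed
  have KZ: "K \<subseteq> ?Z" and LZ: "L \<subseteq> ?Z" using child c asc by auto
  have "X \<subseteq> ?Z" if X: "X \<in> ?C" for X
    using KZ LZ sZ X by (cases "X = K \<or> X = L") blast+
  then have all: "below T P \<subseteq> ?Z" unfolding below_def by blast
  have sub1: "?F0 \<subseteq> \<Union>(?C - {M})" if "M \<in> {K, L}" for M using that by blast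
  have no: "\<not> ?Z \<subseteq> \<Union>(?C - {M})" if "M \<in> {K, L}" for M
    using miss[of M] KZ LZ that c by blast
  have ne: "?Z \<noteq> ?F0"
  proof
    assume "?Z = ?F0"
    then have "?Z \<subseteq> \<Union>(?C - {K})" using sub1[of K] by simp
    then show False using no[of K] by simp
  qed
  have "?F0 \<subseteq> P" by blast
  then have "\<exists>H\<in>\<G>. ?Z = cl (?F0 \<union> H)" using ne by (rule pos_complete[OF flF0 PG])
  then obtain H where H: "H \<in> \<G>" "?Z = cl (?F0 \<union> H)" by (elim bexE)
  have HE: "?F0 \<union> H \<subseteq> E" using fl_subset_E[OF flF0] building_subset_E[OF H(1)] by blast
  have "H \<subseteq> cl (?F0 \<union> H)" using subset_cl[OF HE] by simp
  then have "H \<subseteq> below T P" using Z_sub unfolding H(2) by (rule order_trans)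
  then have HC: "H \<subseteq> \<Union>?C" unfolding below_def .
  have "?C \<subseteq> T" by blast
  then obtain X where X: "X \<in> ?C" "H \<subseteq> X" using HC by (rule nested_below_Union[OF nT _ H(1)])
  obtain M where M: "M \<in> {K, L}" "X \<noteq> M" using KL by blast
  have "?F0 \<union> H \<subseteq> \<Union>(?C - {M})" using sub1[OF M(1)] X M(2) by blast
  then have "?Z \<subseteq> \<Union>(?C - {M})" unfolding H(2) by (intro cl_least flU) auto
  then show False using no[OF M(1)] by blast
qed

end

section \<open>The gamma expansion\<close>

context complete_built
begin

text \<open>The empty set serves as the value outside the tree.\<close>
definition child :: "'a set set \<Rightarrow> 'a set \<Rightarrow> 'a set" where
  "child T P = (if \<exists>K. K \<in> Asc T \<and> cov T K P then SOME K. K \<in> Asc T \<and> cov T K P else {})"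

lemma Asc_lab: "K \<in> Asc T \<Longrightarrow> cov T K P \<Longrightarrow> lab T K < lab T P"
  unfolding Asc_def using cov_unique by blast

lemma child_eq:
  assumes "tree T" "K \<in> Asc T" "cov T K P"
  shows "child T P = K"
proof -
  have ex: "\<exists>K. K \<in> Asc T \<and> cov T K P" using assms by blast
  then have "child T P \<in> Asc T \<and> cov T (child T P) P"
    unfolding child_def by (simp add: someI_ex[OF ex])
  then show ?thesis using asc_child_unique[OF assms(1) _ assms(3)] Asc_lab assms by blast
qed

lemma child_in:
  assumes "tree T" "child T P \<in> T"
  shows "child T P \<in> Asc T" "cov T (child T P) P"
proof -
  have "{} \<notin> T" using tree_building[OF assms(1)] building_nonempty by blast
  then have ex: "\<exists>K. K \<in> Asc T \<and> cov T K P" using assms(2) unfolding child_def by (auto split: if_splits)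
  then show "child T P \<in> Asc T" "cov T (child T P) P"
    unfolding child_def using someI_ex[OF ex] by simp_all
qed

text \<open>Values of the child map inside the tree are ascents, so descents are never values.
  Injectivity is uniqueness of the parent.\<close>

lemma child_path_system: assumes T: "tree T" shows "path_system T (child T) (Des T) card"
proof
  show "finite T" by (rule nested_finite[OF tree_nst[OF T]])
  show "child T x \<notin> T" if "x \<notin> T" for x
    using child_in(2)[OF T, of x] covD(2)[of T "child T x" x] that by blast
  show "x = y" if "child T x \<in> T" "child T x = child T y" for x y
    using child_in(2)[OF T, of x] child_in(2)[OF T, of y] that cov_unique by metis
  show "card (child T x) < card x" if "child T x \<in> T" for x
  proof (rule psubset_card_mono)
    have c: "cov T (child T x) x" by (rule child_in(2)[OF T that])
    then show "finite x" using fl_finite[OF tree_fl[OF T covD(2)]] by blast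
    show "child T x \<subset> x" by (rule covD(3)[OF c])
  qed
  show "Des T \<subseteq> T" by (rule Des_sub)
  show "Des T \<inter> child T ` T = {}"
  proof (rule ccontr)
    assume "Des T \<inter> child T ` T \<noteq> {}"
    then obtain x where "child T x \<in> Des T" by blast
    then have "child T x \<in> Asc T" using child_in(1)[OF T] Des_sub by blast
    then show False using \<open>child T x \<in> Des T\<close> Asc_Des_disjoint by blast
  qed
qed

lemma child_image: assumes T: "tree T" shows "T \<inter> child T ` T = Asc T"
proof
  show "T \<inter> child T ` T \<subseteq> Asc T" using child_in(1)[OF T] by blast
  show "Asc T \<subseteq> T \<inter> child T ` T"
  proof
    fix K assume K: "K \<in> Asc T"
    then obtain P where P: "cov T K P" unfolding Asc_def by blast
    then have "K = child T P" "P \<in> T" using child_eq[OF T K P] covD(2)[OF P] by simp_all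
    then show "K \<in> T \<inter> child T ` T" using K Asc_sub by blast
  qed
qed

text \<open>The rank gap at \<open>G\<close> counts the elements of \<open>T\<close> under
  \<open>G\<close> that are not under a smaller element of \<open>S\<close>. Apart from
  \<open>G\<close> these are outside \<open>S\<close>, hence not descents, so each is the ascending
  child of its parent. They form one path starting at \<open>G\<close>, and the bound says that
  \<open>l\<close> further steps stay on it.\<close>

lemma run_length:
  assumes T: "tree T" and S: "S \<subseteq> T" "Des T \<subseteq> S" and G: "G \<in> S"
  shows "l + rk (below S G) < rk G \<longleftrightarrow>
    (\<forall>j. 1 \<le> j \<longrightarrow> j \<le> l \<longrightarrow> (child T ^^ j) G \<in> T \<and> (child T ^^ j) G \<notin> S)"
proof -
  interpret path_system T "child T" "Des T" card by (rule child_path_system[OF T])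
  let ?c = "child T"
  let ?g = "\<lambda>l. \<forall>j. 1 \<le> j \<longrightarrow> j \<le> l \<longrightarrow> (?c ^^ j) G \<in> T \<and> (?c ^^ j) G \<notin> S"
  \<comment> \<open>\<open>G\<close> itself is counted, which is why \<open>l\<close> iterates
    correspond to the strict inequality \<open>l < card ?B\<close>.\<close>
  let ?B = "{K \<in> T. K \<subseteq> G \<and> \<not> (\<exists>X\<in>S. X \<subset> G \<and> K \<subseteq> X)}"
  let ?U = "{K \<in> T. K \<subseteq> G}"
  let ?L = "{K \<in> T. \<exists>X\<in>S. X \<subset> G \<and> K \<subseteq> X}"
  have GT: "G \<in> T" using S G by blast
  have nT: "nst T" by (rule tree_nst[OF T])
  have step: "?c x \<subset> x" if "?c x \<in> T" for x using covD(3)[OF child_in(2)[OF T that]] .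
  have up: "x \<in> T" if "?c x \<in> T" for x using covD(2)[OF child_in(2)[OF T that]] .
  have iter: "(?c ^^ i) G \<in> T \<and> (?c ^^ (i + d)) G \<subseteq> (?c ^^ i) G" if "(?c ^^ (i + d)) G \<in> T" for i d
    using that
  proof (induction d)
    case (Suc d)
    then have c: "?c ((?c ^^ (i + d)) G) \<in> T" by simp
    then have "(?c ^^ (i + d)) G \<in> T" by (rule up)
    then show ?case using Suc.IH step[OF c] by auto
  qed simp
  have iter_less: "(?c ^^ j) G \<subset> (?c ^^ i) G" if "i < j" "(?c ^^ j) G \<in> T" for i j
  proof -
    have "j \<noteq> 0" using that(1) by simp
    then obtain j' where j: "j = Suc j'" by (cases j) auto
    have c: "?c ((?c ^^ j') G) \<in> T" using that(2) j by simp
    have "(?c ^^ (i + (j' - i))) G \<in> T" using up[OF c] that(1) j by simp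
    then have "(?c ^^ j') G \<subseteq> (?c ^^ i) G" using iter[of i "j' - i"] that(1) j by simp
    then show ?thesis using step[OF c] j by auto
  qed
  have Un1: "\<Union>?U = G" using GT by blast
  have Un2: "\<Union>?L = below S G" unfolding below_def using S(1) by blast
  have r1: "rk G = card ?U" using tree_rk_downset[OF T, of ?U] Un1 by auto
  have r2: "rk (below S G) = card ?L" unfolding Un2[symmetric]
  proof (rule tree_rk_downset[OF T])
    show "{X \<in> T. X \<subset> K} \<subseteq> ?L" if "K \<in> ?L" for K using that by auto
  qed blast
  have "?U = ?B \<union> ?L" "?B \<inter> ?L = {}" by blast+
  then have "card ?U = card ?B + card ?L" using finite_T by (simp add: card_Un_disjoint)
  then have lt: "l + rk (below S G) < rk G \<longleftrightarrow> l < card ?B" using r1 r2 by linarith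
  have GB: "G \<in> ?B" using GT by blast
  have g_B: "(?c ^^ j) G \<in> ?B" if "?g j" for j
    using that
  proof (induction j)
    case 0 then show ?case using GB by simp
  next
    case (Suc j)
    let ?Q = "(?c ^^ j) G"
    have IH: "?Q \<in> ?B" using Suc by simp
    have c: "?c ?Q \<in> T" "?c ?Q \<notin> S" using Suc.prems[rule_format, of "Suc j"] by simp_all
    have cQ: "cov T (?c ?Q) ?Q" by (rule child_in(2)[OF T c(1)])
    have "\<not> ?c ?Q \<subseteq> X" if X: "X \<in> S" "X \<subset> G" for X
    proof
      assume "?c ?Q \<subseteq> X"
      then have "?c ?Q \<subset> X" using X(1) c(2) by blast
      then have "?Q \<subseteq> X" using covD(4)[OF cQ] X(1) S(1) by blast
      then show False using IH X by blast
    qed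
    then show ?case using c(1) covD(3)[OF cQ] IH by auto
  qed
  have B_g: "?g j" if B: "(?c ^^ j) G \<in> ?B" for j
  proof (intro allI impI)
    fix i assume i: "1 \<le> i" "i \<le> j"
    have "(?c ^^ i) G \<in> T \<and> (?c ^^ j) G \<subseteq> (?c ^^ i) G" using iter[of i "j - i"] B i by simp
    moreover from this have "(?c ^^ i) G \<subset> G" using iter_less[of 0 i] i by simp
    ultimately show "(?c ^^ i) G \<in> T \<and> (?c ^^ i) G \<notin> S" using B by blast
  qed
  have reach: "\<exists>j. K = (?c ^^ j) G" if "K \<in> ?B" for K
    using that
  proof (induction "card G - card K" arbitrary: K rule: less_induct)
    case less
    show ?case
    proof (cases "K = G")
      case True then show ?thesis by (intro exI[of _ 0]) simp
    next
      case False
      then have KG: "K \<in> T" "K \<subset> G" using less.prems by auto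
      have "K \<notin> S" using less.prems KG by blast
      obtain P where P: "cov T K P" "P \<subseteq> G" by (rule cov_exists[OF nT KG(1) GT KG(2)])
      have "K \<notin> Des T" using \<open>K \<notin> S\<close> S(2) by blast
      then have "K \<in> Asc T" using P lab_cov_neq[OF nT P(1)] unfolding Asc_def Des_def by force
      then have cP: "?c P = K" using child_eq[OF T _ P(1)] by simp
      have "P \<in> ?B" using covD(2,3)[OF P(1)] P(2) less.prems by blast
      moreover have "card G - card P < card G - card K"
      proof -
        have "finite G" "finite P" using fl_finite[OF tree_fl[OF T]] GT covD(2)[OF P(1)] by auto
        then have "card K < card P" "card P \<le> card G"
          using psubset_card_mono covD(3)[OF P(1)] card_mono P(2) by auto
        then show ?thesis by linarith
      qed
      ultimately obtain j where "P = (?c ^^ j) G" using less.hyps by blast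
      then have "K = (?c ^^ Suc j) G" using cP by simp
      then show ?thesis by blast
    qed
  qed
  have finB: "finite ?B" using finite_T by simp
  show ?thesis
    unfolding lt
  proof
    assume l: "l < card ?B"
    show "?g l"
    proof (rule ccontr)
      assume ng: "\<not> ?g l"
      have "?B \<subseteq> (\<lambda>j. (?c ^^ j) G) ` {..<l}"
      proof
        fix K assume K: "K \<in> ?B"
        from reach[OF K] obtain j where j: "K = (?c ^^ j) G" by (elim exE)
        have gj: "?g j" by (rule B_g) (rule K[unfolded j])
        have "j < l"
        proof (rule ccontr)
          assume "\<not> j < l"
          then have "?g l" using gj by simp
          then show False using ng by simp
        qed
        then show "K \<in> (\<lambda>j. (?c ^^ j) G) ` {..<l}" using j by simp
      qed
      then have "card ?B \<le> card ((\<lambda>j. (?c ^^ j) G) ` {..<l})" by (intro card_mono) auto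
      also have "\<dots> \<le> l" using card_image_le[of "{..<l}"] by simp
      finally show False using l by simp
    qed
  next
    assume g: "?g l"
    have sub: "(\<lambda>j. (?c ^^ j) G) ` {..l} \<subseteq> ?B" proof
      fix K assume "K \<in> (\<lambda>j. (?c ^^ j) G) ` {..l}"
      then obtain j where j: "j \<le> l" "K = (?c ^^ j) G" by auto
      have "?g j" using g j(1) by simp
      then show "K \<in> ?B" unfolding j(2) by (rule g_B)
    qed
    have "inj_on (\<lambda>j. (?c ^^ j) G) {..l}"
    proof (rule linorder_inj_onI)
      fix i j assume ij: "i < j" "i \<in> {..l}" "j \<in> {..l}"
      have "(?c ^^ j) G \<in> T" using subsetD[OF sub imageI[OF ij(3)]] by simp
      then show "(?c ^^ i) G \<noteq> (?c ^^ j) G" using iter_less[OF ij(1)] by blast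
    qed auto
    then have "card ((\<lambda>j. (?c ^^ j) G) ` {..l}) = Suc l" by (simp add: card_image)
    then show "l < card ?B" using card_mono[OF finB sub] by simp
  qed
qed

lemma admissible_iff_FY:
  assumes T: "tree T"
  shows "path_system.admissible T (child T) (Des T) m \<longleftrightarrow>
    m \<in> FY \<and> keys m \<subseteq> T \<and> Des T \<subseteq> keys m"
proof -
  have "nst (keys m)" if "keys m \<subseteq> T"
    using nested_subset[OF tree_nst[OF T] that] .
  then show ?thesis
    unfolding path_system.admissible_def[OF child_path_system[OF T]] FY_def
    using run_length[OF T, of "keys m"] by auto
qed

definition fibre :: "'a set set \<Rightarrow> nat \<Rightarrow> ('a set \<Rightarrow>\<^sub>0 nat) set" where
  "fibre T i = {m \<in> FY_deg i. keys m \<subseteq> T \<and> Des T \<subseteq> keys m}"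

text \<open>A descent lies in the support, so its exponent is at least 1 and it needs a mark, namely
  an ascending child. A tree lacking one has empty fibres.\<close>

definition good_tree :: "'a set set \<Rightarrow> bool" where
  "good_tree T \<longleftrightarrow> tree T \<and> child T ` Des T \<subseteq> Asc T"

text \<open>The exponent N of the overview. By \<open>card_Asc\<close> it is the number of elements
  other than roots in any tree.\<close>

abbreviation dimension :: nat where "dimension \<equiv> rk E - card (comps E)"

lemma card_Asc:
  assumes T: "tree T"
  shows "card (Asc T) + card (Des T) = dimension"
proof -
  have fin: "finite (Asc T)" "finite (Des T)"
    using finite_subset[OF _ nested_finite[OF tree_nst[OF T]]] Asc_sub Des_sub by auto
  have "card T = card (Asc T \<union> Des T) + card (comps E)"
    using card_Un_disjoint[of "Asc T \<union> Des T" "comps E"] fin finite_comps tree_partition[OF T] by simp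
  also have "card (Asc T \<union> Des T) = card (Asc T) + card (Des T)"
    using card_Un_disjoint[OF fin Asc_Des_disjoint] .
  finally show ?thesis using card_tree[OF T] by simp
qed

lemma card_child_Des:
  assumes T: "good_tree T"
  shows "card (child T ` Des T) = card (Des T)"
proof (rule card_image, rule inj_onI)
  have T': "tree T" using T unfolding good_tree_def by simp
  fix x y assume xy: "x \<in> Des T" "y \<in> Des T" "child T x = child T y"
  then have "child T x \<in> T" using T Asc_sub unfolding good_tree_def by blast
  then show "x = y" using path_system.inj[OF child_path_system[OF T']] xy(3) by blast
qed

lemma good_tree_Des_le: "good_tree T \<Longrightarrow> 2 * card (Des T) \<le> dimension"
proof -
  assume T: "good_tree T"
  then have T': "tree T" "child T ` Des T \<subseteq> Asc T" unfolding good_tree_def by simp_all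
  have "finite (Asc T)" using finite_subset[OF Asc_sub nested_finite[OF tree_nst[OF T'(1)]]] .
  then have "card (Des T) \<le> card (Asc T)" using card_mono[OF _ T'(2)] card_child_Des[OF T] by simp
  then show ?thesis using card_Asc[OF T'(1)] by linarith
qed

lemma card_fibre:
  assumes T: "tree T"
  shows "rat_of_nat (card (fibre T i)) =
    (if good_tree T then coeff ([:0, 1:] ^ card (Des T) * [:1, 1:] ^ (dimension - 2 * card (Des T))) i else 0)"
proof -
  interpret path_system T "child T" "Des T" card by (rule child_path_system[OF T])
  have "fibre T i = {m. admissible m \<and> (\<Sum>G\<in>keys m. lookup m G) = i}"
    unfolding fibre_def FY_deg_def admissible_iff_FY[OF T] mdeg_def by auto
  then have eq: "card (fibre T i) = card {Y. child T ` Des T \<subseteq> Y \<and> Y \<subseteq> Asc T \<and> card Y = i}"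
    using card_admissible[of i] child_image[OF T] by simp
  show ?thesis
  proof (cases "child T ` Des T \<subseteq> Asc T")
    case True
    then have g: "good_tree T" using T unfolding good_tree_def by simp
    have fin: "finite (Asc T)" using finite_subset[OF Asc_sub finite_T] .
    have "card (Asc T) - card (Des T) = dimension - 2 * card (Des T)"
      using card_Asc[OF T] by linarith
    then show ?thesis
      using g unfolding eq card_between[OF fin True] card_child_Des[OF g] coeff_gamma_term by simp
  next
    case False
    then have empty: "{Y. child T ` Des T \<subseteq> Y \<and> Y \<subseteq> Asc T \<and> card Y = i} = {}" by blast
    show ?thesis using False unfolding eq good_tree_def empty by simp
  qed
qed

lemma card_FY_deg: "card (FY_deg i) = (\<Sum>T\<in>{T. tree T}. card (fibre T i))"
proof -
  have "FY_deg i = (\<Union>T\<in>{T. tree T}. fibre T i)"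
  proof (intro set_eqI iffI)
    fix m assume m: "m \<in> FY_deg i"
    then have "nst (keys m)" unfolding FY_deg_def FY_def by simp
    then obtain T where "tree T" "keys m \<subseteq> T" "Des T \<subseteq> keys m"
      using tree_exists by blast
    then show "m \<in> (\<Union>T\<in>{T. tree T}. fibre T i)" using m unfolding fibre_def by blast
  qed (auto simp: fibre_def)
  moreover have "card (\<Union>T\<in>{T. tree T}. fibre T i) = (\<Sum>T\<in>{T. tree T}. card (fibre T i))"
  proof (rule card_UN_disjoint[OF finite_trees])
    show "\<forall>T\<in>{T. tree T}. finite (fibre T i)"
      using finite_FY_deg unfolding fibre_def by simp
    show "\<forall>T\<in>{T. tree T}. \<forall>T'\<in>{T. tree T}. T \<noteq> T' \<longrightarrow> fibre T i \<inter> fibre T' i = {}"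
    proof (intro ballI impI)
      fix T T' assume T: "T \<in> {T. tree T}" "T' \<in> {T. tree T}" "T \<noteq> T'"
      have False if "m \<in> fibre T i" "m \<in> fibre T' i" for m
        using tree_unique[of T "keys m" T'] T that unfolding fibre_def by simp
      then show "fibre T i \<inter> fibre T' i = {}" by blast
    qed
  qed
  ultimately show ?thesis by simp
qed

lemma gamma_positive_FY: "gamma_positive (\<lambda>i. card (FY_deg i))"
  unfolding gamma_positive_def
proof (intro exI conjI allI)
  let ?\<gamma> = "\<lambda>d. rat_of_nat (card {T. good_tree T \<and> card (Des T) = d})"
  let ?p = "\<lambda>d. [:0, 1 :: rat:] ^ d * [:1, 1:] ^ (dimension - 2 * d)"
  show "0 \<le> ?\<gamma> d" for d by simp
  fix i
  have sub: "{T. good_tree T} \<subseteq> {T. tree T}" unfolding good_tree_def by auto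
  have fin: "finite {T. good_tree T}" using finite_subset[OF sub finite_trees] .
  have "rat_of_nat (card (FY_deg i)) = (\<Sum>T\<in>{T. tree T}. rat_of_nat (card (fibre T i)))"
    unfolding card_FY_deg by simp
  also have "\<dots> = (\<Sum>T\<in>{T. tree T}. if good_tree T then coeff (?p (card (Des T))) i else 0)"
    by (rule sum.cong) (auto simp: card_fibre)
  also have "\<dots> = (\<Sum>T\<in>{T. good_tree T}. coeff (?p (card (Des T))) i)"
    by (rule sum.mono_neutral_cong_right[OF finite_trees sub]) auto
  \<comment> \<open>The remaining trees are grouped by their number of descents;
    \<open>good_tree_Des_le\<close> keeps it in the range of the expansion.\<close>
  also have "\<dots> = (\<Sum>d\<in>{..dimension div 2}. \<Sum>T\<in>{T \<in> {T. good_tree T}. card (Des T) = d}. coeff (?p (card (Des T))) i)"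
    using good_tree_Des_le by (intro sum.group[OF fin, symmetric]) fastforce+
  also have "\<dots> = (\<Sum>d\<in>{..dimension div 2}. ?\<gamma> d * coeff (?p d) i)"
    by (rule sum.cong) auto
  also have "\<dots> = coeff (\<Sum>d\<le>dimension div 2. smult (?\<gamma> d) (?p d)) i"
    by (simp add: coeff_sum)
  finally show "rat_of_nat (card (FY_deg i)) = coeff (\<Sum>d\<le>dimension div 2. smult (?\<gamma> d) (?p d)) i" .
qed

end

theorem theorem5p2:
  fixes E :: "'a set" and indep :: "'a set \<Rightarrow> bool" and \<G> :: "'a set set"
  assumes "matroid E indep"
    and "loopless E indep"
    and "building_set E indep \<G>"
    and "complete E indep \<G>"
  shows "gamma_positive (chow_dim E indep \<G>)"
proof -
  interpret built_matroid E indep \<G> by unfold_locales (fact assms)+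
  obtain pos where "complete_built E indep \<G> pos" by (rule complete_position[OF assms(4)])
  then interpret complete_built E indep \<G> pos .
  have "chow_dim E indep \<G> = (\<lambda>i. card (FY_deg i))" by (rule ext) (rule chow_dim_FY)
  then show ?thesis using gamma_positive_FY by simp
qed

end
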